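(* Let $\Theta\subseteq\mathbb R^d$ be compact with nonempty interior, let $k\ge k_0\ge1$, and let $G_0=\sum_{j=1}^{k_0}p_j^0\delta_{\theta_j^0}\in\mathcal E_{k_0}(\Theta)$. There exists a universal numerical constant $J>0$ such that the following holds. Assume that the parametric family $\mathcal F$ is 2-strongly identifiable, satisfies the smoothness condition A($2$), and satisfies the bracketing condition B($k$) with constant $J$ (all defined in the context). Then there exists a constant $C(G_0)>0$, depending only on $G_0,d,k,\mathcal F$, such that for all $n\ge2$, $$\mathbb E\big[\mathcal D(\overline G_n,G_0)\big]\le C(G_0)\sqrt{\frac{\log n}{n}},$$ where $\overline G_n$ is the maximum likelihood estimator of order at most $k$ based on $n$ i.i.d. observations from $p_{G_0}$.
   Context: Setting. $\mathcal F=\{f(x|\theta):x\in\mathcal X,\theta\in\Theta\}$ is a known parametric family of probability densities with respect to a $\sigma$-finite measure $\nu$ on $\mathcal X\subseteq\mathbb R^N$, $N\ge1$. A mixing measure is a finitely supported probability measure $G=\sum_{j=1}^{k'}p_j\delta_{\theta_j}$ on $\Theta$ (distinct atoms, weights $p_j>0$); $k'$ is its order. $\mathcal O_k(\Theta)$ is the set of mixing measures of order at most $k$, and $\mathcal E_k(\Theta)=\mathcal O_k(\Theta)\setminus\mathcal O_{k-1}(\Theta)$. Put $p_G(x)=\int f(x|\theta)\,dG(\theta)$. $X_1,\dots,X_n$ are i.i.d. with density $p_{G_0}$, and the MLE is $\overline G_n\in\arg\max_{G\in\mathcal O_k(\Theta)}\sum_{i=1}^n\log p_G(X_i)$. Loss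 function. For $G=\sum_{i=1}^{k'}p_i\delta_{\theta_i}$ of order $k'\le k$, define Voronoi cells $\mathcal A_j=\mathcal A_j(G)=\{i\in[k']:\|\theta_i-\theta_j^0\|\le\|\theta_i-\theta_\ell^0\|\ \forall\ell\ne j\}$, $j\in[k_0]$ ($[m]=\{1,\dots,m\}$, Euclidean norm), and $$\mathcal D(G,G_0)=\sum_{j:|\mathcal A_j|>1}\sum_{i\in\mathcal A_j}p_i\|\theta_i-\theta_j^0\|^2+\sum_{j:|\mathcal A_j|=1}\sum_{i\in\mathcal A_j}p_i\|\theta_i-\theta_j^0\|+\sum_{j=1}^{k_0}\Big|\sum_{i\in\mathcal A_j}p_i-p_j^0\Big|.$$ Strong identifiability. For an integer $r\ge0$, $\mathcal F$ is $r$-strongly identifiable if $f(x|\cdot)\in\mathcal C^r(\Theta)$ for $\nu$-almost every $x$ and if, for any $m\ge1$, any distinct $\theta_1,\dots,\theta_m\in\Theta$ and any reals $\alpha_\eta^{(i)}$ (multi-indices $|\eta|\le r$, $1\le i\le m$), $$\operatorname*{ess\,sup}_{x\in\mathcal X}\Big|\sum_{\ell=0}^r\sum_{|\eta|=\ell}\sum_{i=1}^m\alpha_\eta^{(i)}\frac{\partial^{|\eta|}f}{\partial\theta^\eta}(x|\theta_i)\Big|=0\ \Longrightarrow\ \max_{|\eta|\le r}\max_{1\le i\le m}|\alpha_\eta^{(i)}|=0 .$$ Condition A($r$). There exist $\Lambda,\delta>0$ with $\operatorname*{ess\,sup}_{x\in\mathcal X}\|f(x|\cdot)\|_{\mathcal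 C^{r+\delta}(\Theta)}\le\Lambda$, where $\mathcal C^\alpha(\Theta)$ is the Hölder space of regularity $\alpha$. Bracketing condition B($k$). Let $h^2(p,q)=\frac12\int(\sqrt p-\sqrt q)^2d\nu$. For $G_0\in\mathcal O_k(\Theta)$ and $\epsilon>0$, let $\bar p_G=(p_G+p_{G_0})/2$ and $\overline{\mathcal P}_k^{1/2}(\Theta,\epsilon)=\{\bar p_G^{1/2}:G\in\mathcal O_k(\Theta),\ h(\bar p_G,p_{G_0})\le\epsilon\}$. For $\mathcal P\subseteq L^2(\nu)$, $H_B(\epsilon,\mathcal P,\nu)$ is its $\epsilon$-bracketing entropy in the $L^2(\nu)$ metric (the logarithm of the minimal number of brackets $[l,u]$ with $\|u-l\|_{L^2(\nu)}\le\epsilon$ needed to cover $\mathcal P$). Define $$\mathcal J_B(\epsilon,\overline{\mathcal P}_k^{1/2}(\Theta,\epsilon),\nu)=\left(\int_0^\epsilon\sqrt{H_B(u,\overline{\mathcal P}_k^{1/2}(\Theta,u),\nu)}\,du\right)\vee\epsilon .$$ Condition B($k$) with constant $J$ says: there exists $L>0$, possibly depending on $d$ and $k$ but not on $n$ or $G_0$, such that for all $n\ge2$, all $G_0\in\mathcal O_k(\Theta)$ and all $\epsilon>L(\log n/n)^{1/2}$, $\mathcal J_B(\epsilon,\overline{\mathcal P}_k^{1/2}(\Theta,\epsilon),\nu)\le J\sqrt n\,\epsilon^2$. *)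

theory Defs
  imports "HOL-Probability.Probability"
begin

text \<open>
  The space \<open>R^d\<close> is the library's \<^const>\<open>Euclidean_space\<close> \<open>d\<close>, whose points are the functions
  \<open>nat \<Rightarrow> real\<close> vanishing from \<open>d\<close> on. Dimensions are thus terms, so that one numerical constant
  can be quantified in front of all dimensions.
\<close>

type_synonym rvec = "nat \<Rightarrow> real"

definition edist :: "nat \<Rightarrow> rvec \<Rightarrow> rvec \<Rightarrow> real" where
  "edist d \<theta> \<theta>' = L2_set (\<lambda>i. \<theta> i - \<theta>' i) {..<d}"


section \<open>Mixing measures and the Voronoi loss\<close>

definition mixing_le :: "rvec set \<Rightarrow> nat \<Rightarrow> rvec pmf set" where
  "mixing_le \<Theta> k = {G. finite (set_pmf G) \<and> set_pmf G \<subseteq> \<Theta> \<and> card (set_pmf G) \<le> k}"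

definition mixing_eq :: "rvec set \<Rightarrow> nat \<Rightarrow> rvec pmf set" where
  "mixing_eq \<Theta> k = mixing_le \<Theta> k - mixing_le \<Theta> (k - 1)"

definition mixture :: "('x \<Rightarrow> rvec \<Rightarrow> real) \<Rightarrow> rvec pmf \<Rightarrow> 'x \<Rightarrow> real" where
  "mixture f G x = (\<integral>\<theta>. f x \<theta> \<partial>measure_pmf G)"

text \<open>
  The atoms themselves serve as indices. As usual for these cells, an atom equidistant from
  several atoms of \<open>G0\<close> belongs to several cells.
\<close>

definition voronoi_cell :: "nat \<Rightarrow> rvec pmf \<Rightarrow> rvec pmf \<Rightarrow> rvec \<Rightarrow> rvec set" where
  "voronoi_cell d G G0 \<tau> =
     {\<theta> \<in> set_pmf G. \<forall>\<tau>'\<in>set_pmf G0. edist d \<theta> \<tau> \<le> edist d \<theta> \<tau>'}"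

definition voronoi_loss :: "nat \<Rightarrow> rvec pmf \<Rightarrow> rvec pmf \<Rightarrow> real" where
  "voronoi_loss d G G0 =
     (\<Sum>\<tau> | \<tau> \<in> set_pmf G0 \<and> card (voronoi_cell d G G0 \<tau>) > 1.
        \<Sum>\<theta>\<in>voronoi_cell d G G0 \<tau>. pmf G \<theta> * (edist d \<theta> \<tau>)\<^sup>2)
   + (\<Sum>\<tau> | \<tau> \<in> set_pmf G0 \<and> card (voronoi_cell d G G0 \<tau>) = 1.
        \<Sum>\<theta>\<in>voronoi_cell d G G0 \<tau>. pmf G \<theta> * edist d \<theta> \<tau>)
   + (\<Sum>\<tau>\<in>set_pmf G0. \<bar>(\<Sum>\<theta>\<in>voronoi_cell d G G0 \<tau>. pmf G \<theta>) - pmf G0 \<tau>\<bar>)"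


section \<open>The parametric family\<close>

definition density_family :: "nat \<Rightarrow> rvec measure \<Rightarrow> rvec set \<Rightarrow> (rvec \<Rightarrow> rvec \<Rightarrow> real) \<Rightarrow> bool" where
  "density_family N \<nu> \<Theta> f \<longleftrightarrow>
     space \<nu> \<subseteq> topspace (Euclidean_space N) \<and>
     sets \<nu> = sets (restrict_space borel (space \<nu>)) \<and>
     sigma_finite_measure \<nu> \<and>
     (\<forall>\<theta>\<in>\<Theta>. (\<lambda>x. f x \<theta>) \<in> borel_measurable \<nu> \<and> (\<forall>x\<in>space \<nu>. 0 \<le> f x \<theta>) \<and>
        (\<integral>\<^sup>+x. ennreal (f x \<theta>) \<partial>\<nu>) = 1)"


section \<open>Smoothness\<close>

definition partial_deriv :: "nat \<Rightarrow> (rvec \<Rightarrow> real) \<Rightarrow> rvec \<Rightarrow> real" where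
  "partial_deriv i g \<theta> = deriv (\<lambda>t. g (\<theta>(i := t))) (\<theta> i)"

text \<open>For \<open>U\<close> open in \<open>R^d\<close>.\<close>

fun Cr_on :: "nat \<Rightarrow> nat \<Rightarrow> rvec set \<Rightarrow> (rvec \<Rightarrow> real) \<Rightarrow> bool" where
  "Cr_on d 0 U g \<longleftrightarrow> continuous_on U g"
| "Cr_on d (Suc r) U g \<longleftrightarrow> continuous_on U g \<and>
     (\<forall>i<d. (\<forall>\<theta>\<in>U. (\<lambda>t. g (\<theta>(i := t))) field_differentiable at (\<theta> i)) \<and>
            Cr_on d r U (partial_deriv i g))"

text \<open>
  A function belongs to \<open>C^r(\<Theta>)\<close>, for compact \<open>\<Theta>\<close>, if it is the restriction of a \<open>C^r\<close> function
  on an open neighbourhood of \<open>\<Theta>\<close>. Its derivatives at points of \<open>\<Theta>\<close> are those of the extension;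
  on the closure of the interior of \<open>\<Theta>\<close> they do not depend on the extension.
\<close>

definition Cr_extension :: "nat \<Rightarrow> nat \<Rightarrow> rvec set \<Rightarrow> (rvec \<Rightarrow> real) \<Rightarrow> (rvec \<Rightarrow> real) \<Rightarrow> bool" where
  "Cr_extension d r \<Theta> g h \<longleftrightarrow> (\<forall>\<theta>\<in>\<Theta>. h \<theta> = g \<theta>) \<and>
     (\<exists>U. openin (Euclidean_space d) U \<and> \<Theta> \<subseteq> U \<and> Cr_on d r U h)"

definition mi_order :: "nat \<Rightarrow> (nat \<Rightarrow> nat) \<Rightarrow> nat" where
  "mi_order d \<eta> = (\<Sum>i<d. \<eta> i)"

definition multi_indices :: "nat \<Rightarrow> nat \<Rightarrow> (nat \<Rightarrow> nat) set" where
  "multi_indices d r = {\<eta>. (\<forall>i\<ge>d. \<eta> i = 0) \<and> mi_order d \<eta> \<le> r}"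

lemma finite_multi_indices: "finite (multi_indices d r)"
proof (rule finite_subset)
  show "multi_indices d r \<subseteq> {\<eta>. \<forall>i. (i \<in> {..<d} \<longrightarrow> \<eta> i \<in> {..r}) \<and> (i \<notin> {..<d} \<longrightarrow> \<eta> i = 0)}"
  proof
    fix \<eta> assume \<eta>: "\<eta> \<in> multi_indices d r"
    have "\<eta> i \<le> r" if "i < d" for i
    proof -
      have "\<eta> i \<le> (\<Sum>i<d. \<eta> i)"
        using that by (intro member_le_sum) auto
      then show ?thesis
        using \<eta> by (simp add: multi_indices_def mi_order_def)
    qed
    then show "\<eta> \<in> {\<eta>. \<forall>i. (i \<in> {..<d} \<longrightarrow> \<eta> i \<in> {..r}) \<and> (i \<notin> {..<d} \<longrightarrow> \<eta> i = 0)}"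
      using \<eta> by (auto simp: multi_indices_def)
  qed
  show "finite {\<eta>. \<forall>i. (i \<in> {..<d} \<longrightarrow> \<eta> i \<in> {..r}) \<and> (i \<notin> {..<d} \<longrightarrow> \<eta> i = (0::nat))}"
    by (rule finite_set_of_finite_funs) auto
qed

definition mi_deriv :: "nat \<Rightarrow> (nat \<Rightarrow> nat) \<Rightarrow> (rvec \<Rightarrow> real) \<Rightarrow> rvec \<Rightarrow> real" where
  "mi_deriv d \<eta> g = fold (\<lambda>i. partial_deriv i ^^ \<eta> i) [0..<d] g"

text \<open>
  With \<open>m = \<lfloor>\<alpha>\<rfloor>\<close> and \<open>s = \<alpha> - m\<close>, the norm of \<open>C^\<alpha>\<close> is the maximal sup-norm of the derivatives
  of order at most \<open>m\<close> plus the maximal \<open>s\<close>-Hoelder seminorm of those of order \<open>m\<close>; if \<open>\<alpha>\<close> is an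
  integer this is equivalent to the \<open>C^m\<close> norm. The infimum over the extensions only matters for
  derivatives at points outside the closure of the interior of \<open>\<Theta>\<close>; it is \<open>\<infinity>\<close> if the function
  is not in \<open>C^m(\<Theta>)\<close>.
\<close>

definition holder_size :: "nat \<Rightarrow> real \<Rightarrow> rvec set \<Rightarrow> (rvec \<Rightarrow> real) \<Rightarrow> ennreal" where
  "holder_size d \<alpha> \<Theta> h =
     (SUP \<eta>\<in>multi_indices d (nat \<lfloor>\<alpha>\<rfloor>). SUP \<theta>\<in>\<Theta>. ennreal \<bar>mi_deriv d \<eta> h \<theta>\<bar>)
   + (SUP \<eta>\<in>{\<eta> \<in> multi_indices d (nat \<lfloor>\<alpha>\<rfloor>). mi_order d \<eta> = nat \<lfloor>\<alpha>\<rfloor>}.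
        SUP (\<theta>, \<theta>')\<in>{(\<theta>, \<theta>'). \<theta> \<in> \<Theta> \<and> \<theta>' \<in> \<Theta> \<and> \<theta> \<noteq> \<theta>'}.
          ennreal (\<bar>mi_deriv d \<eta> h \<theta> - mi_deriv d \<eta> h \<theta>'\<bar> / edist d \<theta> \<theta>' powr (\<alpha> - of_int \<lfloor>\<alpha>\<rfloor>)))"

definition holder_norm :: "nat \<Rightarrow> real \<Rightarrow> rvec set \<Rightarrow> (rvec \<Rightarrow> real) \<Rightarrow> ennreal" where
  "holder_norm d \<alpha> \<Theta> g = (INF h\<in>{h. Cr_extension d (nat \<lfloor>\<alpha>\<rfloor>) \<Theta> g h}. holder_size d \<alpha> \<Theta> h)"

text \<open>
  Unlike \<^const>\<open>esssup\<close>, which is \<open>\<infinity>\<close> on functions that are not Borel measurable, this is also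
  meaningful for functions that are controlled only up to a null set, such as derivatives that
  exist almost everywhere in \<open>x\<close>.
\<close>

definition ess_sup :: "'x measure \<Rightarrow> ('x \<Rightarrow> ennreal) \<Rightarrow> ennreal" where
  "ess_sup M u = Inf {c. AE x in M. u x \<le> c}"

definition condition_A ::
    "nat \<Rightarrow> nat \<Rightarrow> 'x measure \<Rightarrow> rvec set \<Rightarrow> ('x \<Rightarrow> rvec \<Rightarrow> real) \<Rightarrow> bool" where
  "condition_A d r \<nu> \<Theta> f \<longleftrightarrow> (\<exists>\<Lambda>>0. \<exists>\<delta>>0.
     ess_sup \<nu> (\<lambda>x. holder_norm d (real r + \<delta>) \<Theta> (f x)) \<le> ennreal \<Lambda>)"

text \<open>
  \<open>S\<close> is the set of the distinct parameters, and \<open>F x\<close> is the \<open>C^r\<close> extension of \<open>f x\<close> whose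
  derivatives are meant.
\<close>

definition strongly_identifiable ::
    "nat \<Rightarrow> nat \<Rightarrow> 'x measure \<Rightarrow> rvec set \<Rightarrow> ('x \<Rightarrow> rvec \<Rightarrow> real) \<Rightarrow> bool" where
  "strongly_identifiable d r \<nu> \<Theta> f \<longleftrightarrow> (\<exists>F.
     (AE x in \<nu>. Cr_extension d r \<Theta> (f x) (F x)) \<and>
     (\<forall>S (a :: (nat \<Rightarrow> nat) \<Rightarrow> rvec \<Rightarrow> real). finite S \<longrightarrow> S \<noteq> {} \<longrightarrow> S \<subseteq> \<Theta> \<longrightarrow>
        ess_sup \<nu> (\<lambda>x. ennreal \<bar>\<Sum>\<eta>\<in>multi_indices d r. \<Sum>\<theta>\<in>S. a \<eta> \<theta> * mi_deriv d \<eta> (F x) \<theta>\<bar>) = 0 \<longrightarrow>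
        (\<forall>\<eta>\<in>multi_indices d r. \<forall>\<theta>\<in>S. a \<eta> \<theta> = 0)))"


section \<open>Bracketing entropy\<close>

definition hellinger :: "'x measure \<Rightarrow> ('x \<Rightarrow> real) \<Rightarrow> ('x \<Rightarrow> real) \<Rightarrow> real" where
  "hellinger \<nu> p q = sqrt (1 / 2 * (\<integral>x. (sqrt (p x) - sqrt (q x))\<^sup>2 \<partial>\<nu>))"

definition bar_mixture :: "('x \<Rightarrow> rvec \<Rightarrow> real) \<Rightarrow> rvec pmf \<Rightarrow> rvec pmf \<Rightarrow> 'x \<Rightarrow> real" where
  "bar_mixture f G0 G x = (mixture f G x + mixture f G0 x) / 2"

definition sqrt_class ::
    "'x measure \<Rightarrow> rvec set \<Rightarrow> ('x \<Rightarrow> rvec \<Rightarrow> real) \<Rightarrow> nat \<Rightarrow> rvec pmf \<Rightarrow> real \<Rightarrow> ('x \<Rightarrow> real) set" where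
  "sqrt_class \<nu> \<Theta> f k G0 \<epsilon> =
     {(\<lambda>x. sqrt (bar_mixture f G0 G x)) | G.
        G \<in> mixing_le \<Theta> k \<and> hellinger \<nu> (bar_mixture f G0 G) (mixture f G0) \<le> \<epsilon>}"

text \<open>The order between elements of \<open>L^2(\<nu>)\<close> is the almost-everywhere order.\<close>

definition bracket :: "'x measure \<Rightarrow> real \<Rightarrow> ('x \<Rightarrow> real) \<times> ('x \<Rightarrow> real) \<Rightarrow> bool" where
  "bracket \<nu> \<epsilon> = (\<lambda>(l, u). l \<in> borel_measurable \<nu> \<and> u \<in> borel_measurable \<nu> \<and>
     (AE x in \<nu>. l x \<le> u x) \<and> (\<integral>\<^sup>+x. ennreal ((u x - l x)\<^sup>2) \<partial>\<nu>) \<le> ennreal (\<epsilon>\<^sup>2))"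

definition bracketing_number :: "'x measure \<Rightarrow> real \<Rightarrow> ('x \<Rightarrow> real) set \<Rightarrow> enat" where
  "bracketing_number \<nu> \<epsilon> P = Inf {enat (card B) | B.
     finite B \<and> (\<forall>b\<in>B. bracket \<nu> \<epsilon> b) \<and>
     (\<forall>g\<in>P. \<exists>(l, u)\<in>B. AE x in \<nu>. l x \<le> g x \<and> g x \<le> u x)}"

definition bracketing_entropy :: "'x measure \<Rightarrow> real \<Rightarrow> ('x \<Rightarrow> real) set \<Rightarrow> ennreal" where
  "bracketing_entropy \<nu> \<epsilon> P =
     (case bracketing_number \<nu> \<epsilon> P of enat m \<Rightarrow> ennreal (ln (real m)) | \<infinity> \<Rightarrow> \<infinity>)"

definition ennreal_sqrt :: "ennreal \<Rightarrow> ennreal" where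
  "ennreal_sqrt t = (if t = \<infinity> then \<infinity> else ennreal (sqrt (enn2real t)))"

text \<open>The radius of the localized class in the integrand is the integration variable.\<close>

definition bracketing_integral ::
    "'x measure \<Rightarrow> rvec set \<Rightarrow> ('x \<Rightarrow> rvec \<Rightarrow> real) \<Rightarrow> nat \<Rightarrow> rvec pmf \<Rightarrow> real \<Rightarrow> ennreal" where
  "bracketing_integral \<nu> \<Theta> f k G0 \<epsilon> =
     max (\<integral>\<^sup>+u\<in>{0<..\<epsilon>}. ennreal_sqrt (bracketing_entropy \<nu> u (sqrt_class \<nu> \<Theta> f k G0 u)) \<partial>lborel)
         (ennreal \<epsilon>)"

definition condition_B ::
    "nat \<Rightarrow> real \<Rightarrow> 'x measure \<Rightarrow> rvec set \<Rightarrow> ('x \<Rightarrow> rvec \<Rightarrow> real) \<Rightarrow> bool" where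
  "condition_B k J \<nu> \<Theta> f \<longleftrightarrow> (\<exists>L>0. \<forall>n\<ge>2. \<forall>G0\<in>mixing_le \<Theta> k. \<forall>\<epsilon>.
     \<epsilon> > L * sqrt (ln (real n) / real n) \<longrightarrow>
     bracketing_integral \<nu> \<Theta> f k G0 \<epsilon> \<le> ennreal (J * sqrt (real n) * \<epsilon>\<^sup>2))"


section \<open>Maximum likelihood\<close>

text \<open>The logarithm with value \<open>-\<infinity>\<close> at 0; note that \<open>ln 0 = 0\<close> in the library.\<close>

definition elog :: "real \<Rightarrow> ereal" where
  "elog t = (if t > 0 then ereal (ln t) else -\<infinity>)"

definition log_likelihood :: "('x \<Rightarrow> rvec \<Rightarrow> real) \<Rightarrow> nat \<Rightarrow> (nat \<Rightarrow> 'x) \<Rightarrow> rvec pmf \<Rightarrow> ereal" where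
  "log_likelihood f n xs G = (\<Sum>i<n. elog (mixture f G (xs i)))"

definition is_MLE ::
    "rvec set \<Rightarrow> nat \<Rightarrow> ('x \<Rightarrow> rvec \<Rightarrow> real) \<Rightarrow> nat \<Rightarrow> (nat \<Rightarrow> 'x) \<Rightarrow> rvec pmf \<Rightarrow> bool" where
  "is_MLE \<Theta> k f n xs G \<longleftrightarrow> is_arg_max (log_likelihood f n xs) (\<lambda>G. G \<in> mixing_le \<Theta> k) G"

text \<open>The joint law of \<open>n\<close> i.i.d. observations with density \<open>mixture f G0\<close>.\<close>

definition sample_law :: "'x measure \<Rightarrow> ('x \<Rightarrow> rvec \<Rightarrow> real) \<Rightarrow> rvec pmf \<Rightarrow> nat \<Rightarrow> (nat \<Rightarrow> 'x) measure" where
  "sample_law \<nu> f G0 n = (\<Pi>\<^sub>M i\<in>{..<n}. density \<nu> (\<lambda>x. ennreal (mixture f G0 x)))"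

end

theory Submission
  imports Defs
begin

text \<open>
  The radius of the class in the entropy integral of condition B is the integration variable, so only
  local brackets are available: the ball of radius \<open>u\<close> around any centre is covered by polynomially many
  (in \<open>1/u\<close>) brackets of size \<open>u\<close> for the barred densities \<open>(p + c)/2\<close>. A bracket \<open>[a, b]\<close> for \<open>p\<close> is
  refined by recentring at a density \<open>c\<close> that lies in it. With
  \<open>\<Phi> = \<integral>(\<surd>b - \<surd>a)\<^sup>2\<close> and \<open>S = \<integral>(\<surd>((b + c)/2) - \<surd>((a + c)/2))\<^sup>2\<close>, the radius of the bracket around \<open>c\<close>
  is at most \<open>\<surd>(S/2)\<close>, each local bracket multiplies \<open>S\<close> by at most 0.72, and \<open>\<Phi>/2 - S\<close> decreases along nested brackets;
  as \<open>S \<ge> \<Phi>/16\<close>, every refinement multiplies \<open>\<Phi>\<close> by a factor smaller than 1.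

  Along the resulting tree of nested upper brackets \<open>B\<close> the likelihood can only decrease. The increments
  \<open>(\<surd>B - \<surd>B')/\<surd>B\<close> are nonnegative, hence have sub-Gaussian lower tails, and chaining them over the tree shows that
  outside an event of probability \<open>2/n\<close> no density with Hellinger distance of order \<open>\<surd>(log n/n)\<close> or more from the
  truth has a larger barred likelihood than the truth. Uncountably many almost sure bounds are
  handled by continuity in the parameters.

  The loss is bounded by the \<open>L\<^sup>1\<close> distance of the densities by compactness: along a sequence violating this,
  the difference of the densities, expanded to second order and divided by the sum of all coefficients,
  converges to a nontrivial combination of derivatives, which vanishes by Fatou's lemma;
  this contradicts strong identifiability.
\<close>

section \<open>Square integrable functions and gaps between square roots\<close>

text \<open>The entropy bound is used at one scale at a time: for a squared radius \<open>v\<close>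
  the sample size in condition B is taken of order \<open>(1/v) ln (1/v)\<close>, the smallest order
  it admits, so that the bound on the entropy becomes a multiple of \<open>ln (1/v)\<close>. The
  constant \<open>J\<close> enters only the degree of the resulting polynomial, so every positive
  \<open>J\<close> serves. The number 0.72 is \<open>(6/5)\<^sup>2 / 2\<close>: 6/5 is the ratio of
  bracket size to radius, and 1/2 comes from the Hellinger distance. One refinement then multiplies
  \<open>\<Phi>\<close> by \<open>1 - 2 * (1 - 0.72) / 16 = 0.965\<close>. Chaining is forced by the
  size of the tree: every level multiplies the number of brackets by a power of \<open>n\<close> and
  the depth can be of order \<open>ln n\<close>, so one union bound over the leaves would pay an
  entropy of order \<open>(ln n)\<^sup>2\<close> and lose a factor \<open>sqrt (ln n)\<close> in the
  rate. Along the tree, level \<open>j\<close> pays only \<open>(j + 1) ln n\<close>, against a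
  variance that has shrunk by \<open>0.965 ^ j\<close>, and the deviations are summable.\<close>

definition square_integrable :: "'a measure \<Rightarrow> ('a \<Rightarrow> real) \<Rightarrow> bool" where
  "square_integrable M g \<longleftrightarrow> g \<in> borel_measurable M \<and> integrable M (\<lambda>x. (g x)\<^sup>2)"

definition L2_norm :: "'a measure \<Rightarrow> ('a \<Rightarrow> real) \<Rightarrow> real" where
  "L2_norm M g = sqrt (\<integral>x. (g x)\<^sup>2 \<partial>M)"

lemma L2_norm_nonneg: "0 \<le> L2_norm M g"
  by (simp add: L2_norm_def)

lemma L2_norm_power2: "(L2_norm M g)\<^sup>2 = (\<integral>x. (g x)\<^sup>2 \<partial>M)"
  by (simp add: L2_norm_def)

lemma square_integrable_mult:
  assumes "square_integrable M g" "square_integrable M h"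
  shows "integrable M (\<lambda>x. g x * h x)"
proof (rule Bochner_Integration.integrable_bound)
  show "integrable M (\<lambda>x. (g x)\<^sup>2 + (h x)\<^sup>2)"
    using assms by (auto simp: square_integrable_def)
  show "(\<lambda>x. g x * h x) \<in> borel_measurable M"
    using assms by (auto simp: square_integrable_def)
  have "\<bar>g x * h x\<bar> \<le> (g x)\<^sup>2 + (h x)\<^sup>2" for x
  proof -
    have "2 * (\<bar>g x\<bar> * \<bar>h x\<bar>) \<le> (g x)\<^sup>2 + (h x)\<^sup>2"
      using sum_squares_bound[of "\<bar>g x\<bar>" "\<bar>h x\<bar>"] by simp
    moreover have "0 \<le> \<bar>g x\<bar> * \<bar>h x\<bar>" by simp
    ultimately show ?thesis unfolding abs_mult by linarith
  qed
  then show "AE x in M. norm (g x * h x) \<le> norm ((g x)\<^sup>2 + (h x)\<^sup>2)"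
    by (intro AE_I2) simp
qed

lemma L2_Cauchy_Schwarz:
  assumes "square_integrable M g" "square_integrable M h"
  shows "\<bar>(\<integral>x. g x * h x \<partial>M)\<bar> \<le> L2_norm M g * L2_norm M h"
proof -
  let ?A = "\<integral>x. (g x)\<^sup>2 \<partial>M" and ?B = "\<integral>x. g x * h x \<partial>M" and ?C = "\<integral>x. (h x)\<^sup>2 \<partial>M"
  \<comment> \<open>The form is kept homogeneous in \<open>s\<close> and \<open>t\<close>: for
    \<open>?C > 0\<close> the point \<open>(?C, ?B)\<close> gives the inequality, and for
    \<open>?C = 0\<close> the point chosen below would make the form equal to -1.\<close>
  have quad: "0 \<le> s\<^sup>2 * ?A - 2 * s * t * ?B + t\<^sup>2 * ?C" for s t
  proof -
    have "0 \<le> (\<integral>x. (s * g x - t * h x)\<^sup>2 \<partial>M)"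
      by simp
    also have "\<dots> = (\<integral>x. s\<^sup>2 * (g x)\<^sup>2 - 2 * s * t * (g x * h x) + t\<^sup>2 * (h x)\<^sup>2 \<partial>M)"
      by (simp add: power2_diff power_mult_distrib algebra_simps)
    also have "\<dots> = s\<^sup>2 * ?A - 2 * s * t * ?B + t\<^sup>2 * ?C"
      using assms square_integrable_mult[OF assms] by (simp add: square_integrable_def)
    finally show ?thesis .
  qed
  have "?B\<^sup>2 \<le> ?A * ?C"
  proof (cases "?C = 0")
    case True
    have "?B = 0"
    proof (rule ccontr)
      assume B: "?B \<noteq> 0"
      have "0 \<le> ?A - 2 * ((?A + 1) / (2 * ?B)) * ?B"
        using quad[of 1 "(?A + 1) / (2 * ?B)"] True by simp
      then show False using B by simp
    qed
    then show ?thesis using True by simp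
  next
    case False
    moreover have "0 \<le> ?C" by simp
    ultimately have C: "?C > 0" by linarith
    have "0 \<le> ?C * (?A * ?C - ?B\<^sup>2)"
      using quad[of ?C ?B] by (simp add: power2_eq_square algebra_simps)
    then show ?thesis using C by (simp add: zero_le_mult_iff)
  qed
  then have "sqrt (?B\<^sup>2) \<le> sqrt (?A * ?C)" by (rule real_sqrt_le_mono)
  then show ?thesis by (simp add: L2_norm_def real_sqrt_mult)
qed

lemma square_integrable_add:
  assumes "square_integrable M g" "square_integrable M h"
  shows "square_integrable M (\<lambda>x. g x + h x)"
  using assms square_integrable_mult[OF assms]
  by (auto simp: square_integrable_def power2_sum mult.assoc)

lemma square_integrable_diff:
  assumes "square_integrable M g" "square_integrable M h"
  shows "square_integrable M (\<lambda>x. g x - h x)"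
  using assms square_integrable_mult[OF assms]
  by (auto simp: square_integrable_def power2_diff mult.assoc)

lemma L2_norm_triangle:
  assumes "square_integrable M g" "square_integrable M h"
  shows "L2_norm M (\<lambda>x. g x + h x) \<le> L2_norm M g + L2_norm M h"
proof -
  have "(L2_norm M (\<lambda>x. g x + h x))\<^sup>2 = (\<integral>x. (g x)\<^sup>2 + (h x)\<^sup>2 + 2 * (g x * h x) \<partial>M)"
    by (simp add: L2_norm_power2 power2_sum mult.assoc)
  also have "\<dots> = (L2_norm M g)\<^sup>2 + (L2_norm M h)\<^sup>2 + 2 * (\<integral>x. g x * h x \<partial>M)"
    using assms square_integrable_mult[OF assms] by (simp add: square_integrable_def L2_norm_power2)
  also have "\<dots> \<le> (L2_norm M g + L2_norm M h)\<^sup>2"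
    using L2_Cauchy_Schwarz[OF assms] by (simp add: power2_sum)
  finally show ?thesis
    by (rule power2_le_imp_le) (simp add: L2_norm_nonneg)
qed

lemma square_integrable_bound:
  assumes "square_integrable M h" "g \<in> borel_measurable M" "AE x in M. \<bar>g x\<bar> \<le> \<bar>h x\<bar>"
  shows "square_integrable M g" "L2_norm M g \<le> L2_norm M h"
proof -
  have *: "AE x in M. (g x)\<^sup>2 \<le> (h x)\<^sup>2"
    using assms(3) by eventually_elim (metis abs_le_square_iff)
  have "integrable M (\<lambda>x. (g x)\<^sup>2)"
  proof (rule Bochner_Integration.integrable_bound)
    show "integrable M (\<lambda>x. (h x)\<^sup>2)" using assms(1) by (simp add: square_integrable_def)
    show "(\<lambda>x. (g x)\<^sup>2) \<in> borel_measurable M" using assms(2) by simp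
    show "AE x in M. norm ((g x)\<^sup>2) \<le> norm ((h x)\<^sup>2)" using * by simp
  qed
  then show s: "square_integrable M g"
    using assms(2) by (simp add: square_integrable_def)
  have "(\<integral>x. (g x)\<^sup>2 \<partial>M) \<le> (\<integral>x. (h x)\<^sup>2 \<partial>M)"
    using s assms(1) * by (intro integral_mono_AE) (auto simp: square_integrable_def)
  then show "L2_norm M g \<le> L2_norm M h" by (simp add: L2_norm_def)
qed

lemma square_integrable_of_nn_integral:
  assumes "g \<in> borel_measurable M" "(\<integral>\<^sup>+x. ennreal ((g x)\<^sup>2) \<partial>M) \<le> ennreal c" "0 \<le> c"
  shows "square_integrable M g" "(\<integral>x. (g x)\<^sup>2 \<partial>M) \<le> c"
proof -
  have fin: "(\<integral>\<^sup>+x. ennreal ((g x)\<^sup>2) \<partial>M) < \<infinity>"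
    using assms(2) by (rule le_less_trans) simp
  show s: "square_integrable M g"
    unfolding square_integrable_def
    using assms(1) fin by (auto intro!: integrableI_nonneg)
  have "ennreal (\<integral>x. (g x)\<^sup>2 \<partial>M) \<le> ennreal c"
    using s assms(2) by (subst nn_integral_eq_integral[symmetric]) (auto simp: square_integrable_def)
  then show "(\<integral>x. (g x)\<^sup>2 \<partial>M) \<le> c" using assms(3) by simp
qed

section \<open>Pointwise comparison of bracket widths before and after averaging with a
  centre\<close>

definition root_gap :: "real \<Rightarrow> real \<Rightarrow> real" where
  "root_gap a b = (sqrt b - sqrt a)\<^sup>2"

text \<open>The same gap after both ends are averaged with the centre \<open>c\<close>; only gaps of
  this kind are controlled by condition B.\<close>

definition bar_gap :: "real \<Rightarrow> real \<Rightarrow> real \<Rightarrow> real" where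
  "bar_gap c a b = (sqrt ((b + c) / 2) - sqrt ((a + c) / 2))\<^sup>2"

lemma root_gap_eq: "0 \<le> a \<Longrightarrow> 0 \<le> b \<Longrightarrow> root_gap a b = a + b - 2 * sqrt (a * b)"
  by (simp add: root_gap_def power2_diff real_sqrt_mult)

lemma bar_gap_eq:
  "0 \<le> a \<Longrightarrow> 0 \<le> b \<Longrightarrow> 0 \<le> c \<Longrightarrow> bar_gap c a b = (a + b) / 2 + c - sqrt ((a + c) * (b + c))"
proof -
  assume "0 \<le> a" "0 \<le> b" "0 \<le> c"
  then have "bar_gap c a b = (b + c) / 2 + (a + c) / 2 - 2 * sqrt ((b + c) / 2 * ((a + c) / 2))"
    by (simp only: bar_gap_def power2_diff real_sqrt_mult real_sqrt_pow2) simp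
  also have "sqrt ((b + c) / 2 * ((a + c) / 2)) = sqrt ((a + c) * (b + c)) / 2"
    by (simp add: real_sqrt_divide real_sqrt_mult)
  finally show ?thesis by (simp add: field_simps)
qed

text \<open>The squares of \<open>u\<close> and \<open>v\<close> have the same increment, so after
  multiplication by \<open>(v' + v) * (u' + u)\<close> the claim reads
  \<open>z * (u' + u) \<le> s * (v' + v)\<close>. This rests on
  \<open>a * (b + c) \<le> (a + c) * b\<close>, which is \<open>a \<le> b\<close> in
  disguise.\<close>

lemma sqrt_mult_shift_mono:
  assumes "0 \<le> a" "a \<le> b" "b \<le> b'" "0 \<le> c"
  shows "sqrt ((a + c) * (b + c)) - sqrt (a * b) \<le> sqrt ((a + c) * (b' + c)) - sqrt (a * b')"
proof -
  define s where "s = sqrt (a + c)"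
  define u where "u = sqrt (b + c)"
  define u' where "u' = sqrt (b' + c)"
  define v where "v = sqrt b"
  define v' where "v' = sqrt b'"
  define z where "z = sqrt a"
  have pos: "0 \<le> s" "0 \<le> u" "0 \<le> u'" "0 \<le> v" "0 \<le> v'" "0 \<le> z"
    using assms by (auto simp: s_def u_def u'_def v_def v'_def z_def)
  have uu: "u \<le> u'" "v \<le> v'" using assms by (auto simp: u_def u'_def v_def v'_def)
  have zu: "z * u \<le> s * v" "z * u' \<le> s * v'"
    unfolding z_def u_def s_def v_def u'_def v'_def real_sqrt_mult[symmetric]
    using assms by (auto intro!: real_sqrt_le_mono mult_left_mono simp: distrib_left distrib_right
      mult.commute[of _ c])
  have sq: "u'\<^sup>2 - u\<^sup>2 = v'\<^sup>2 - v\<^sup>2"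
    using assms by (simp add: u_def u'_def v_def v'_def)
  have "z * (v' - v) \<le> s * (u' - u)"
  proof (cases "v' + v = 0 \<or> u' + u = 0")
    case True
    then have "v = 0 \<and> v' = 0 \<or> u = 0 \<and> u' = 0" using pos by auto
    then have "v'\<^sup>2 = v\<^sup>2" using sq by auto
    then have "v' = v" using pos by simp
    then show ?thesis using pos uu by simp
  next
    case False
    have "z * (v' - v) * ((v' + v) * (u' + u)) = z * (u' + u) * (v'\<^sup>2 - v\<^sup>2)"
      by (simp add: power2_eq_square algebra_simps)
    also have "\<dots> \<le> s * (v' + v) * (v'\<^sup>2 - v\<^sup>2)"
      using zu uu pos by (intro mult_right_mono) (auto simp: algebra_simps power_mono)
    also have "\<dots> = s * (u' - u) * ((v' + v) * (u' + u))"
      unfolding sq[symmetric] by (simp add: power2_eq_square algebra_simps)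
    finally show ?thesis using False pos by (auto simp: mult_le_cancel_right)
  qed
  then show ?thesis
    unfolding real_sqrt_mult s_def[symmetric] u_def[symmetric] u'_def[symmetric] v_def[symmetric]
      v'_def[symmetric] z_def[symmetric] by (simp add: algebra_simps)
qed

text \<open>The mirror image for the lower end: now \<open>(b + c) * a \<le> b * (a + c)\<close>,
  valid as long as the lower end stays below \<open>b\<close>.\<close>

lemma sqrt_mult_shift_antimono:
  assumes "0 \<le> a" "a \<le> a'" "a' \<le> b" "0 \<le> c"
  shows "sqrt ((a' + c) * (b + c)) - sqrt (a' * b) \<le> sqrt ((a + c) * (b + c)) - sqrt (a * b)"
proof -
  define s where "s = sqrt (b + c)"
  define u where "u = sqrt (a + c)"
  define u' where "u' = sqrt (a' + c)"
  define v where "v = sqrt a"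
  define v' where "v' = sqrt a'"
  define z where "z = sqrt b"
  have pos: "0 \<le> s" "0 \<le> u" "0 \<le> u'" "0 \<le> v" "0 \<le> v'" "0 \<le> z"
    using assms by (auto simp: s_def u_def u'_def v_def v'_def z_def)
  have uu: "u \<le> u'" "v \<le> v'" using assms by (auto simp: u_def u'_def v_def v'_def)
  have zu: "s * v \<le> z * u" "s * v' \<le> z * u'"
    unfolding z_def u_def s_def v_def u'_def v'_def real_sqrt_mult[symmetric]
    using assms by (auto intro!: real_sqrt_le_mono mult_left_mono simp: distrib_left distrib_right
      mult.commute[of _ c])
  have sq: "u'\<^sup>2 - u\<^sup>2 = v'\<^sup>2 - v\<^sup>2"
    using assms by (simp add: u_def u'_def v_def v'_def)
  have "s * (u' - u) \<le> z * (v' - v)"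
  proof (cases "v' + v = 0 \<or> u' + u = 0")
    case True
    then have "v = 0 \<and> v' = 0 \<or> u = 0 \<and> u' = 0" using pos by auto
    then have "u'\<^sup>2 = u\<^sup>2" using sq by auto
    then have "u' = u" using pos by simp
    then show ?thesis using pos uu by simp
  next
    case False
    have "s * (u' - u) * ((v' + v) * (u' + u)) = s * (v' + v) * (v'\<^sup>2 - v\<^sup>2)"
      unfolding sq[symmetric] by (simp add: power2_eq_square algebra_simps)
    also have "\<dots> \<le> z * (u' + u) * (v'\<^sup>2 - v\<^sup>2)"
      using zu uu pos by (intro mult_right_mono) (auto simp: algebra_simps power_mono)
    also have "\<dots> = z * (v' - v) * ((v' + v) * (u' + u))"
      by (simp add: power2_eq_square algebra_simps)
    finally show ?thesis using False pos by (auto simp: mult_le_cancel_right)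
  qed
  then show ?thesis
    unfolding real_sqrt_mult s_def[symmetric] u_def[symmetric] u'_def[symmetric] v_def[symmetric]
      v'_def[symmetric] z_def[symmetric] by (simp add: algebra_simps)
qed

text \<open>The linear terms cancel in \<open>root_gap a b / 2 - bar_gap c a b\<close>, which equals
  \<open>sqrt ((a + c) * (b + c)) - sqrt (a * b) - c\<close>. The two preceding lemmas make this
  monotone in each end, the lower end being moved while the upper one is \<open>b'\<close>.\<close>

lemma gap_nested:
  assumes "0 \<le> a" "a \<le> a'" "a' \<le> b'" "b' \<le> b" "0 \<le> c"
  shows "root_gap a' b' / 2 + bar_gap c a b \<le> root_gap a b / 2 + bar_gap c a' b'"
proof -
  have "sqrt ((a' + c) * (b' + c)) - sqrt (a' * b') \<le> sqrt ((a + c) * (b' + c)) - sqrt (a * b')"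
    using assms by (intro sqrt_mult_shift_antimono) auto
  also have "\<dots> \<le> sqrt ((a + c) * (b + c)) - sqrt (a * b)"
    using assms by (intro sqrt_mult_shift_mono) auto
  finally show ?thesis
    using assms by (simp add: root_gap_eq bar_gap_eq field_simps)
qed

text \<open>Nesting applied to the degenerate bracket \<open>[b, b]\<close>, where both gaps
  vanish.\<close>

lemma bar_gap_le: 
  assumes "0 \<le> a" "a \<le> b" "0 \<le> c"
  shows "bar_gap c a b \<le> root_gap a b / 2"
  using gap_nested[of a b b b c] assms by (simp add: root_gap_def bar_gap_def)

text \<open>Rationalising both gaps compares them with \<open>b - a\<close>: the barred roots differ
  by \<open>(b - a) / 2\<close> divided by their sum \<open>P\<close>, and
  \<open>P\<^sup>2 \<le> 2 * (1 + K) * b\<close>, whereas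
  \<open>(sqrt b - sqrt a) * sqrt b \<le> b - a\<close>. A centre inside the bracket allows
  \<open>K = 1\<close> and gives the constant 16.\<close>

lemma root_gap_le_bar_gap:
  assumes "0 \<le> a" "a \<le> b" "0 \<le> c" "c \<le> K * b" "1 \<le> K"
  shows "root_gap a b \<le> 8 * (1 + K) * bar_gap c a b"
proof (cases "b = 0")
  case True then show ?thesis using assms by (simp add: root_gap_def bar_gap_def)
next
  case False
  then have b: "b > 0" using assms by auto
  define P where "P = sqrt ((b + c) / 2) + sqrt ((a + c) / 2)"
  have P: "P > 0" unfolding P_def using b assms by (intro add_pos_nonneg) auto
  have "sqrt ((b + c) / 2) \<le> sqrt ((1 + K) * b / 2)" "sqrt ((a + c) / 2) \<le> sqrt ((1 + K) * b / 2)"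
    using assms by (auto intro!: real_sqrt_le_mono simp: algebra_simps)
  then have "P \<le> 2 * sqrt ((1 + K) * b / 2)" unfolding P_def by linarith
  then have "P\<^sup>2 \<le> (2 * sqrt ((1 + K) * b / 2))\<^sup>2" using P by (intro power_mono) auto
  then have P2: "P\<^sup>2 \<le> 2 * (1 + K) * b" using assms b by (simp add: power_mult_distrib algebra_simps)
  have "(sqrt ((b + c) / 2) - sqrt ((a + c) / 2)) * P = (sqrt ((b + c) / 2))\<^sup>2 - (sqrt ((a + c) / 2))\<^sup>2"
    by (simp add: P_def power2_eq_square algebra_simps)
  also have "\<dots> = (b - a) / 2" using assms b by (simp add: field_simps)
  finally have D: "bar_gap c a b * P\<^sup>2 = ((b - a) / 2)\<^sup>2"
    by (simp only: bar_gap_def power_mult_distrib[symmetric])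
  have "(sqrt b - sqrt a) * sqrt b \<le> (sqrt b - sqrt a) * (sqrt b + sqrt a)"
    using assms by (intro mult_left_mono) auto
  also have "\<dots> = b - a" using assms b by (simp add: algebra_simps)
  finally have "((sqrt b - sqrt a) * sqrt b)\<^sup>2 \<le> (b - a)\<^sup>2"
    using assms by (intro power_mono) auto
  then have "root_gap a b * b \<le> (b - a)\<^sup>2" using b by (simp add: root_gap_def power_mult_distrib)
  also have "\<dots> = 4 * (bar_gap c a b * P\<^sup>2)" unfolding D by (simp add: power2_eq_square)
  also have "\<dots> \<le> 4 * (bar_gap c a b * (2 * (1 + K) * b))"
    using P2 by (intro mult_left_mono) (auto simp: bar_gap_def)
  also have "\<dots> = 8 * (1 + K) * bar_gap c a b * b" by simp
  finally show ?thesis using b by simp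
qed

text \<open>For brackets that contain some density \<open>p\<close> but perhaps not the centre. If
  \<open>c\<close> exceeds \<open>2 * b\<close>, the barred gap may be far too small, but then
  \<open>p < c / 2\<close> is itself far from \<open>c\<close>: the last square is at least
  \<open>0.0169 * c\<close>, while the root gap is at most \<open>c / 2\<close>.\<close>

lemma root_gap_le_bar_gap_center:
  assumes "0 \<le> a" "a \<le> p" "p \<le> b" "0 \<le> c"
  shows "root_gap a b \<le> 30 * (bar_gap c a b + (sqrt ((p + c) / 2) - sqrt c)\<^sup>2)"
proof (cases "c \<le> 2 * b")
  case True
  then have "root_gap a b \<le> 24 * bar_gap c a b"
    using root_gap_le_bar_gap[of a b c 2] assms by simp
  also have "\<dots> \<le> 30 * (bar_gap c a b + (sqrt ((p + c) / 2) - sqrt c)\<^sup>2)"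
    by (simp add: bar_gap_def)
  finally show ?thesis .
next
  case False
  have "root_gap a b \<le> (sqrt b)\<^sup>2"
    unfolding root_gap_def using assms by (intro power_mono) auto
  then have 1: "root_gap a b \<le> c / 2" using assms False by simp
  have "sqrt ((p + c) / 2) \<le> sqrt (3 / 4 * c)"
    using assms False by (intro real_sqrt_le_mono) auto
  also have "\<dots> \<le> 87 / 100 * sqrt c"
  proof (rule real_le_lsqrt)
    have "(87 / 100 * sqrt c)\<^sup>2 = 7569 / 10000 * c"
      using assms by (simp add: power_mult_distrib power2_eq_square)
    then show "3 / 4 * c \<le> (87 / 100 * sqrt c)\<^sup>2" using assms by simp
  qed (use assms in auto)
  finally have "(13 / 100 * sqrt c)\<^sup>2 \<le> (sqrt c - sqrt ((p + c) / 2))\<^sup>2"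
    using assms by (intro power_mono) auto
  then have "169 / 10000 * c \<le> (sqrt ((p + c) / 2) - sqrt c)\<^sup>2"
    using assms by (simp add: power_mult_distrib power2_commute[of "sqrt c"] power_divide)
  moreover have "0 \<le> bar_gap c a b" by (simp add: bar_gap_def)
  ultimately show ?thesis using 1 assms by (simp add: field_simps)
qed

section \<open>Local brackets and their refinement\<close>

text \<open>The abstract form of what condition B and continuity in the parameters yield:
  \<open>local_brackets\<close> speaks of squared radii and squared sizes, and
  \<open>AE_uniform\<close> exchanges a possibly uncountable quantifier with the null sets. The
  bound 1000 on \<open>v\<close> leaves room for \<open>207 * r\<^sup>2\<close> with
  \<open>r \<le> 2\<close>.\<close>

locale density_class =
  fixes \<nu> :: "'a measure" and P :: "('a \<Rightarrow> real) set" and A :: real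
  assumes dens_measurable: "p \<in> P \<Longrightarrow> p \<in> borel_measurable \<nu>"
    and dens_nonneg: "p \<in> P \<Longrightarrow> x \<in> space \<nu> \<Longrightarrow> 0 \<le> p x"
    and dens_one: "p \<in> P \<Longrightarrow> (\<integral>\<^sup>+x. ennreal (p x) \<partial>\<nu>) = 1"
    and A_ge: "1000 \<le> A"
    and local_brackets: "c \<in> P \<Longrightarrow> 0 < v \<Longrightarrow> v \<le> 1000 \<Longrightarrow>
      \<exists>B. finite B \<and> real (card B) \<le> (A / v) powr A \<and>
        (\<forall>(l, u)\<in>B. l \<in> borel_measurable \<nu> \<and> u \<in> borel_measurable \<nu> \<and>
           (\<integral>\<^sup>+x. ennreal ((u x - l x)\<^sup>2) \<partial>\<nu>) \<le> ennreal (72 / 100 * v)) \<and>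
        (\<forall>p\<in>P. (\<integral>x. (sqrt ((p x + c x) / 2) - sqrt (c x))\<^sup>2 \<partial>\<nu>) \<le> v \<longrightarrow>
           (\<exists>(l, u)\<in>B. AE x in \<nu>. l x \<le> sqrt ((p x + c x) / 2) \<and> sqrt ((p x + c x) / 2) \<le> u x))"
    and AE_uniform: "Q \<subseteq> P \<Longrightarrow> (\<And>p. p \<in> Q \<Longrightarrow> AE x in \<nu>. p x \<le> b x) \<Longrightarrow>
      AE x in \<nu>. \<forall>p\<in>Q. p x \<le> b x"
begin

definition between :: "('a \<Rightarrow> real) \<Rightarrow> ('a \<Rightarrow> real) \<Rightarrow> ('a \<Rightarrow> real) set" where
  "between a b = {p \<in> P. AE x in \<nu>. a x \<le> p x \<and> p x \<le> b x}"

text \<open>The order of the two ends is left out on purpose: it holds almost everywhere as soon as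
  some density lies between them, and only such pieces are ever kept.\<close>

definition piece :: "real \<Rightarrow> ('a \<Rightarrow> real) \<Rightarrow> ('a \<Rightarrow> real) \<Rightarrow> bool" where
  "piece V a b \<longleftrightarrow> a \<in> borel_measurable \<nu> \<and> b \<in> borel_measurable \<nu> \<and> (\<forall>x. 0 \<le> a x) \<and>
     integrable \<nu> (\<lambda>x. root_gap (a x) (b x)) \<and> (\<integral>x. root_gap (a x) (b x) \<partial>\<nu>) \<le> V"

lemma sqrt_dens: "p \<in> P \<Longrightarrow> square_integrable \<nu> (\<lambda>x. sqrt (p x))"
  and integral_dens: "p \<in> P \<Longrightarrow> (\<integral>x. p x \<partial>\<nu>) = 1"
  and integrable_dens: "p \<in> P \<Longrightarrow> integrable \<nu> p"
proof -
  assume p: "p \<in> P"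
  show i: "integrable \<nu> p"
    using dens_measurable[OF p] dens_nonneg[OF p] dens_one[OF p] by (intro integrableI_nonneg) auto
  have "integrable \<nu> (\<lambda>x. (sqrt (p x))\<^sup>2)"
    using i by (subst Bochner_Integration.integrable_cong[OF refl, of _ _ p]) (simp_all add: dens_nonneg p)
  then show "square_integrable \<nu> (\<lambda>x. sqrt (p x))"
    using dens_measurable[OF p] by (simp add: square_integrable_def)
  have "ennreal (\<integral>x. p x \<partial>\<nu>) = 1"
    using i dens_one[OF p] nn_integral_eq_integral[OF i] dens_nonneg[OF p] by simp
  then show "(\<integral>x. p x \<partial>\<nu>) = 1"
    by (metis ennreal_eq_1)
qed

lemma sqrt_bar:
  assumes "p \<in> P" "c \<in> P"
  shows "square_integrable \<nu> (\<lambda>x. sqrt ((p x + c x) / 2))"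
  unfolding square_integrable_def
proof
  have "integrable \<nu> (\<lambda>x. (p x + c x) / 2)"
    using assms integrable_dens by auto
  then show "integrable \<nu> (\<lambda>x. (sqrt ((p x + c x) / 2))\<^sup>2)"
    by (subst Bochner_Integration.integrable_cong[OF refl, of _ _ "\<lambda>x. (p x + c x) / 2"])
      (simp_all add: dens_nonneg assms)
qed (use assms[THEN dens_measurable] in measurable)

lemma betweenD:
  assumes "p \<in> between a b"
  shows "p \<in> P" "AE x in \<nu>. a x \<le> p x \<and> p x \<le> b x"
  using assms by (auto simp: between_def)


text \<open>A bound for the number of pieces of one refinement: a piece is split only if its gap
  exceeds \<open>0.965 * V\<close>, so that the squared radius \<open>S\<close> around a member
  exceeds \<open>0.965 * V / 16\<close>, hence \<open>V / 17\<close>.\<close>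

definition parts :: "real \<Rightarrow> real" where
  "parts V = (17 * A / V) powr A"

lemma parts_ge_1: "0 < V \<Longrightarrow> V \<le> 1000 \<Longrightarrow> 1 \<le> parts V"
  unfolding parts_def using A_ge by (intro ge_one_powr_ge_zero) (auto simp: field_simps)

lemma parts_antimono: "0 < V \<Longrightarrow> V \<le> V' \<Longrightarrow> parts V' \<le> parts V"
  unfolding parts_def using A_ge by (intro powr_mono2) (auto intro!: divide_left_mono)

text \<open>With the centre in the bracket, \<open>sqrt c\<close> is the barred root of
  \<open>c\<close> itself. It lies between the barred ends together with that of any other member
  \<open>p\<close>, which bounds the distance of the two by the barred gap.\<close>

lemma bar_gap_between:
  assumes "piece V a b" "c \<in> between a b"
  shows "integrable \<nu> (\<lambda>x. bar_gap (c x) (a x) (b x))"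
    "(\<integral>x. bar_gap (c x) (a x) (b x) \<partial>\<nu>) \<le> (\<integral>x. root_gap (a x) (b x) \<partial>\<nu>) / 2"
    "(\<integral>x. root_gap (a x) (b x) \<partial>\<nu>) \<le> 16 * (\<integral>x. bar_gap (c x) (a x) (b x) \<partial>\<nu>)"
    "p \<in> between a b \<Longrightarrow>
      (\<integral>x. (sqrt ((p x + c x) / 2) - sqrt (c x))\<^sup>2 \<partial>\<nu>) \<le> (\<integral>x. bar_gap (c x) (a x) (b x) \<partial>\<nu>)"
proof -
  have [measurable]: "a \<in> borel_measurable \<nu>" "b \<in> borel_measurable \<nu>" "c \<in> borel_measurable \<nu>"
    using assms dens_measurable[OF betweenD(1)[OF assms(2)]] by (auto simp: piece_def)
  have a: "0 \<le> a x" for x using assms by (auto simp: piece_def)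
  have ic: "integrable \<nu> (\<lambda>x. root_gap (a x) (b x))" using assms by (auto simp: piece_def)
  have le: "AE x in \<nu>. a x \<le> c x \<and> c x \<le> b x" by (rule betweenD(2)[OF assms(2)])
  have upper: "AE x in \<nu>. bar_gap (c x) (a x) (b x) \<le> root_gap (a x) (b x) / 2"
    using le by eventually_elim (meson a bar_gap_le order_trans)
  have lower: "AE x in \<nu>. root_gap (a x) (b x) \<le> 16 * bar_gap (c x) (a x) (b x)"
    using le
  proof eventually_elim
    case (elim x)
    then show ?case using root_gap_le_bar_gap[of "a x" "b x" "c x" 1] a[of x] by auto
  qed
  have nn: "0 \<le> bar_gap (c x) (a x) (b x)" for x by (simp add: bar_gap_def)
  show ib: "integrable \<nu> (\<lambda>x. bar_gap (c x) (a x) (b x))"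
  proof (rule Bochner_Integration.integrable_bound)
    show "integrable \<nu> (\<lambda>x. root_gap (a x) (b x) / 2)" using ic by simp
    show "(\<lambda>x. bar_gap (c x) (a x) (b x)) \<in> borel_measurable \<nu>"
      unfolding bar_gap_def by measurable
    show "AE x in \<nu>. norm (bar_gap (c x) (a x) (b x)) \<le> norm (root_gap (a x) (b x) / 2)"
      using upper by eventually_elim (use nn in auto)
  qed
  have "(\<integral>x. bar_gap (c x) (a x) (b x) \<partial>\<nu>) \<le> (\<integral>x. root_gap (a x) (b x) / 2 \<partial>\<nu>)"
    using upper ib ic by (intro integral_mono_AE) auto
  then show "(\<integral>x. bar_gap (c x) (a x) (b x) \<partial>\<nu>) \<le> (\<integral>x. root_gap (a x) (b x) \<partial>\<nu>) / 2"
    by simp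
  have "(\<integral>x. root_gap (a x) (b x) \<partial>\<nu>) \<le> (\<integral>x. 16 * bar_gap (c x) (a x) (b x) \<partial>\<nu>)"
    using lower ib ic by (intro integral_mono_AE) auto
  then show "(\<integral>x. root_gap (a x) (b x) \<partial>\<nu>) \<le> 16 * (\<integral>x. bar_gap (c x) (a x) (b x) \<partial>\<nu>)"
    by simp
  assume p: "p \<in> between a b"
  show "(\<integral>x. (sqrt ((p x + c x) / 2) - sqrt (c x))\<^sup>2 \<partial>\<nu>) \<le> (\<integral>x. bar_gap (c x) (a x) (b x) \<partial>\<nu>)"
  proof (rule integral_mono_AE)
    show "integrable \<nu> (\<lambda>x. (sqrt ((p x + c x) / 2) - sqrt (c x))\<^sup>2)"
      using square_integrable_diff[OF sqrt_bar sqrt_dens] betweenD(1)[OF p] betweenD(1)[OF assms(2)]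
      by (auto simp: square_integrable_def)
    show "AE x in \<nu>. (sqrt ((p x + c x) / 2) - sqrt (c x))\<^sup>2 \<le> bar_gap (c x) (a x) (b x)"
      using le betweenD(2)[OF p]
    proof eventually_elim
      case (elim x)
      let ?u = "sqrt ((b x + c x) / 2)" and ?l = "sqrt ((a x + c x) / 2)"
      have "?l \<le> sqrt ((p x + c x) / 2)" "sqrt ((p x + c x) / 2) \<le> ?u" "?l \<le> sqrt (c x)" "sqrt (c x) \<le> ?u"
        using elim by (auto intro!: real_sqrt_le_mono)
      then have "\<bar>sqrt ((p x + c x) / 2) - sqrt (c x)\<bar> \<le> \<bar>?u - ?l\<bar>" by linarith
      then show ?case unfolding bar_gap_def by (metis abs_le_square_iff)
    qed
  qed (rule ib)
qed

text \<open>A bracket of the barred class with centre \<open>c\<close> becomes a bracket of the class itself.\<close>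

definition unbar :: "('a \<Rightarrow> real) \<Rightarrow> ('a \<Rightarrow> real) \<Rightarrow> 'a \<Rightarrow> real" where
  "unbar c l x = 2 * (max (l x) 0)\<^sup>2 - c x"

lemma le_unbar:
  assumes "sqrt ((p + c x) / 2) \<le> u x" "0 \<le> p" "0 \<le> c x"
  shows "p \<le> unbar c u x"
proof -
  have "(sqrt ((p + c x) / 2))\<^sup>2 \<le> (max (u x) 0)\<^sup>2"
    using assms by (intro power_mono) auto
  then show ?thesis using assms by (simp add: unbar_def)
qed

lemma unbar_le:
  assumes "l x \<le> sqrt ((p + c x) / 2)" "0 \<le> p" "0 \<le> c x"
  shows "unbar c l x \<le> p"
proof -
  have "(max (l x) 0)\<^sup>2 \<le> (sqrt ((p + c x) / 2))\<^sup>2"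
    using assms by (intro power_mono) auto
  then show ?thesis using assms by (simp add: unbar_def)
qed

lemma bar_gap_unbar:
  assumes "unbar c l x \<le> a" "a \<le> b" "b \<le> unbar c u x" "0 \<le> a" "0 \<le> c x"
  shows "bar_gap (c x) a b \<le> (u x - l x)\<^sup>2"
proof -
  have "sqrt ((b + c x) / 2) \<le> sqrt ((max (u x) 0)\<^sup>2)" "sqrt ((max (l x) 0)\<^sup>2) \<le> sqrt ((a + c x) / 2)"
    by (rule real_sqrt_le_mono, use assms in \<open>simp add: unbar_def\<close>)+
  then have "sqrt ((b + c x) / 2) \<le> max (u x) 0" "max (l x) 0 \<le> sqrt ((a + c x) / 2)"
    by (auto simp: real_sqrt_abs)
  moreover have "sqrt ((a + c x) / 2) \<le> sqrt ((b + c x) / 2)"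
    using assms by (intro real_sqrt_le_mono) simp
  moreover have "max (u x) 0 - max (l x) 0 \<le> \<bar>u x - l x\<bar>" by (auto simp: max_def)
  ultimately have "\<bar>sqrt ((b + c x) / 2) - sqrt ((a + c x) / 2)\<bar> \<le> \<bar>u x - l x\<bar>"
    by linarith
  then show ?thesis unfolding bar_gap_def by (metis abs_le_square_iff)
qed

lemma measurable_unbar:
  "c \<in> borel_measurable \<nu> \<Longrightarrow> l \<in> borel_measurable \<nu> \<Longrightarrow> unbar c l \<in> borel_measurable \<nu>"
  unfolding unbar_def by measurable

text \<open>With \<open>\<Phi>\<close> and \<open>S\<close> the gaps before and
  \<open>\<Phi>'\<close> and \<open>S'\<close> those after intersecting with a local bracket,
  nesting gives \<open>\<Phi>' \<le> \<Phi> - 2 * (S - S')\<close>. As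
  \<open>S' \<le> 0.72 * S\<close> and \<open>S \<ge> \<Phi> / 16\<close>, this is at most
  \<open>(1 - 0.035) * \<Phi>\<close>.\<close>

lemma refine:
  assumes "piece V a b" "0 < V" "V \<le> 1000"
  shows "\<exists>T. finite T \<and> real (card T) \<le> parts V \<and> between a b \<subseteq> (\<Union>(a', b')\<in>T. between a' b') \<and>
    (\<forall>(a', b')\<in>T. piece (965 / 1000 * V) a' b' \<and> (\<forall>x. a x \<le> a' x) \<and> (\<forall>x. b' x \<le> b x))"
\<comment> \<open>A piece that is empty or already small enough is not split: the lower bound on
  \<open>S\<close>, and with it the count \<open>parts V\<close>, holds only for a gap close to
  \<open>V\<close>.\<close>
proof (cases "between a b = {} \<or> (\<integral>x. root_gap (a x) (b x) \<partial>\<nu>) \<le> 965 / 1000 * V")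
  case True
  then consider "between a b = {}" | "(\<integral>x. root_gap (a x) (b x) \<partial>\<nu>) \<le> 965 / 1000 * V" by blast
  then show ?thesis
  proof cases
    case 1
    then show ?thesis using parts_ge_1[OF assms(2,3)] by (intro exI[of _ "{}"]) auto
  next
    case 2
    then have "piece (965 / 1000 * V) a b" using assms(1) by (auto simp: piece_def)
    then show ?thesis using parts_ge_1[OF assms(2,3)] by (intro exI[of _ "{(a, b)}"]) auto
  qed
next
  case False
  then obtain c where c: "c \<in> between a b" by blast
  have big: "965 / 1000 * V < (\<integral>x. root_gap (a x) (b x) \<partial>\<nu>)" using False by simp
  have V: "(\<integral>x. root_gap (a x) (b x) \<partial>\<nu>) \<le> V" using assms by (simp add: piece_def)
  have [measurable]: "a \<in> borel_measurable \<nu>" "b \<in> borel_measurable \<nu>" "c \<in> borel_measurable \<nu>"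
    using assms dens_measurable[OF betweenD(1)[OF c]] by (auto simp: piece_def)
  have a: "0 \<le> a x" for x using assms by (auto simp: piece_def)
  have cP: "c \<in> P" by (rule betweenD(1)[OF c])
  have ic: "integrable \<nu> (\<lambda>x. root_gap (a x) (b x))" using assms by (auto simp: piece_def)
  define S where "S = (\<integral>x. bar_gap (c x) (a x) (b x) \<partial>\<nu>)"
  note gaps = bar_gap_between[OF assms(1) c, folded S_def]
  have S: "V / 17 < S" "S \<le> V / 2" "0 < S" "S \<le> 1000"
    using gaps(2,3) big V assms(2,3) by auto
  obtain B where B: "finite B" "real (card B) \<le> (A / S) powr A"
      and B3: "\<forall>(l, u)\<in>B. l \<in> borel_measurable \<nu> \<and> u \<in> borel_measurable \<nu> \<and>
         (\<integral>\<^sup>+x. ennreal ((u x - l x)\<^sup>2) \<partial>\<nu>) \<le> ennreal (72 / 100 * S)"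
      and B4: "\<forall>p\<in>P. (\<integral>x. (sqrt ((p x + c x) / 2) - sqrt (c x))\<^sup>2 \<partial>\<nu>) \<le> S \<longrightarrow>
         (\<exists>(l, u)\<in>B. AE x in \<nu>. l x \<le> sqrt ((p x + c x) / 2) \<and> sqrt ((p x + c x) / 2) \<le> u x)"
    using local_brackets[OF cP S(3,4)] by (elim exE conjE) (rule that)
  define F where "F = (\<lambda>(l, u). (\<lambda>x. max (a x) (unbar c l x), \<lambda>x. min (b x) (unbar c u x)))"
  \<comment> \<open>Intersections without a member are discarded; a member \<open>q\<close> of each
    remaining one certifies that its ends are ordered almost everywhere.\<close>
  define T where "T = {ab \<in> F ` B. between (fst ab) (snd ab) \<noteq> {}}"
  have "T \<subseteq> F ` B" by (simp add: T_def)
  then have "card T \<le> card (F ` B)" using B(1) by (intro card_mono) auto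
  also have "\<dots> \<le> card B" using B(1) by (rule card_image_le)
  finally have card_T: "card T \<le> card B" .
  have "(A / S) powr A \<le> parts V"
    unfolding parts_def using S A_ge assms(2) by (intro powr_mono2) (auto simp: field_simps)
  then have card: "real (card T) \<le> parts V" using B(2) card_T by simp
  have cover: "between a b \<subseteq> (\<Union>(a', b')\<in>T. between a' b')"
  proof
    fix p assume p: "p \<in> between a b"
    have pP: "p \<in> P" by (rule betweenD(1)[OF p])
    obtain l u where lu: "(l, u) \<in> B"
      "AE x in \<nu>. l x \<le> sqrt ((p x + c x) / 2) \<and> sqrt ((p x + c x) / 2) \<le> u x"
      using B4 pP gaps(4)[OF p] by fast
    have "AE x in \<nu>. fst (F (l, u)) x \<le> p x \<and> p x \<le> snd (F (l, u)) x"
      using lu(2) betweenD(2)[OF p] AE_space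
    proof eventually_elim
      case (elim x)
      then show ?case
        using le_unbar[of "p x" c x u] unbar_le[of l x "p x" c] dens_nonneg[OF pP] dens_nonneg[OF cP]
        by (auto simp: F_def)
    qed
    then have "p \<in> between (fst (F (l, u))) (snd (F (l, u)))" using pP by (simp add: between_def)
    moreover from this have "F (l, u) \<in> T" using lu(1) by (auto simp: T_def)
    ultimately show "p \<in> (\<Union>(a', b')\<in>T. between a' b')" by (auto simp: case_prod_beta' intro!: bexI[of _ "F (l, u)"])
  qed
  have "piece (965 / 1000 * V) a' b' \<and> (\<forall>x. a x \<le> a' x) \<and> (\<forall>x. b' x \<le> b x)" if T: "(a', b') \<in> T" for a' b'
  proof (intro conjI allI)
    obtain l u where lu: "(l, u) \<in> B" and a': "a' = (\<lambda>x. max (a x) (unbar c l x))"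
      and b': "b' = (\<lambda>x. min (b x) (unbar c u x))"
      using T by (auto simp: T_def F_def)
    obtain q where q: "q \<in> between a' b'" using T by (auto simp: T_def)
    have lu': "l \<in> borel_measurable \<nu>" "u \<in> borel_measurable \<nu>"
        "(\<integral>\<^sup>+x. ennreal ((u x - l x)\<^sup>2) \<partial>\<nu>) \<le> ennreal (72 / 100 * S)"
      using B3 lu by fast+
    have [measurable]: "l \<in> borel_measurable \<nu>" "u \<in> borel_measurable \<nu>" using lu' by auto
    have [measurable]: "unbar c l \<in> borel_measurable \<nu>" "unbar c u \<in> borel_measurable \<nu>"
      by (intro measurable_unbar; measurable)+
    have [measurable]: "a' \<in> borel_measurable \<nu>" "b' \<in> borel_measurable \<nu>"
      unfolding a' b' by measurable
    show le: "a x \<le> a' x" "b' x \<le> b x" for x by (auto simp: a' b')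
    have a'b': "AE x in \<nu>. a' x \<le> b' x \<and> 0 \<le> c x"
      using betweenD(2)[OF q] AE_space by eventually_elim (use dens_nonneg[OF cP] in auto)
    have lu_int: "square_integrable \<nu> (\<lambda>x. u x - l x)" "(\<integral>x. (u x - l x)\<^sup>2 \<partial>\<nu>) \<le> 72 / 100 * S"
      using square_integrable_of_nn_integral[of "\<lambda>x. u x - l x" \<nu> "72 / 100 * S"] lu' S by auto
    have bg: "AE x in \<nu>. bar_gap (c x) (a' x) (b' x) \<le> (u x - l x)\<^sup>2"
      using a'b'
    proof eventually_elim
      case (elim x)
      have "0 \<le> a' x" using le(1)[of x] a[of x] by linarith
      then show ?case using elim by (intro bar_gap_unbar) (auto simp: a' b')
    qed
    have ibg: "integrable \<nu> (\<lambda>x. bar_gap (c x) (a' x) (b' x))"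
    proof (rule Bochner_Integration.integrable_bound)
      show "integrable \<nu> (\<lambda>x. (u x - l x)\<^sup>2)" using lu_int by (simp add: square_integrable_def)
      show "(\<lambda>x. bar_gap (c x) (a' x) (b' x)) \<in> borel_measurable \<nu>" unfolding bar_gap_def by measurable
      show "AE x in \<nu>. norm (bar_gap (c x) (a' x) (b' x)) \<le> norm ((u x - l x)\<^sup>2)"
        using bg by eventually_elim (simp add: bar_gap_def)
    qed
    have "(\<integral>x. bar_gap (c x) (a' x) (b' x) \<partial>\<nu>) \<le> (\<integral>x. (u x - l x)\<^sup>2 \<partial>\<nu>)"
      using ibg bg lu_int by (intro integral_mono_AE) (auto simp: square_integrable_def)
    then have S': "(\<integral>x. bar_gap (c x) (a' x) (b' x) \<partial>\<nu>) \<le> 72 / 100 * S" using lu_int by simp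
    have nested: "AE x in \<nu>. root_gap (a' x) (b' x) / 2 + bar_gap (c x) (a x) (b x)
        \<le> root_gap (a x) (b x) / 2 + bar_gap (c x) (a' x) (b' x)"
      using a'b' by eventually_elim (intro gap_nested, use le a in auto)
    have irg: "integrable \<nu> (\<lambda>x. root_gap (a' x) (b' x))"
    proof (rule Bochner_Integration.integrable_bound)
      show "integrable \<nu> (\<lambda>x. root_gap (a x) (b x) + 2 * bar_gap (c x) (a' x) (b' x))" using ic ibg by auto
      show "(\<lambda>x. root_gap (a' x) (b' x)) \<in> borel_measurable \<nu>" unfolding root_gap_def by measurable
      show "AE x in \<nu>. norm (root_gap (a' x) (b' x)) \<le> norm (root_gap (a x) (b x) + 2 * bar_gap (c x) (a' x) (b' x))"
        using nested
      proof eventually_elim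
        case (elim x)
        moreover have "0 \<le> bar_gap (c x) (a x) (b x)" "0 \<le> root_gap (a' x) (b' x)"
          by (auto simp: bar_gap_def root_gap_def)
        ultimately show ?case unfolding real_norm_def by linarith
      qed
    qed
    have "(\<integral>x. root_gap (a' x) (b' x) / 2 + bar_gap (c x) (a x) (b x) \<partial>\<nu>)
        \<le> (\<integral>x. root_gap (a x) (b x) / 2 + bar_gap (c x) (a' x) (b' x) \<partial>\<nu>)"
      using nested ic irg ibg gaps(1) by (intro integral_mono_AE) auto
    then have "(\<integral>x. root_gap (a' x) (b' x) \<partial>\<nu>) / 2 + S
        \<le> (\<integral>x. root_gap (a x) (b x) \<partial>\<nu>) / 2 + (\<integral>x. bar_gap (c x) (a' x) (b' x) \<partial>\<nu>)"
      using ic irg ibg gaps(1) by (simp add: S_def)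
    then have "(\<integral>x. root_gap (a' x) (b' x) \<partial>\<nu>) \<le> 965 / 1000 * V"
      using S' gaps(3) V by linarith
    moreover have "0 \<le> a' x" for x using le(1)[of x] a[of x] by linarith
    ultimately show "piece (965 / 1000 * V) a' b'" using irg by (simp add: piece_def)
  qed
  then show ?thesis using card cover B(1) by (intro exI[of _ T]) (auto simp: T_def)
qed

text \<open>Here the centre need not lie in the unbarred brackets, so the gap is bounded through a
  member of the ball: \<open>30 * (0.72 + 1) * 4 = 206.4\<close>. The number 68 is 17 times 4, which
  cancels the 17 in \<open>parts\<close>.\<close>

lemma initial_cover:
  assumes c: "c \<in> P" and r: "0 < r" "r \<le> 2"
  shows "\<exists>T. finite T \<and> real (card T) \<le> parts (68 * r\<^sup>2) \<and> (\<forall>(a, b)\<in>T. piece (207 * r\<^sup>2) a b) \<and>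
    {p \<in> P. (\<integral>x. (sqrt ((p x + c x) / 2) - sqrt (c x))\<^sup>2 \<partial>\<nu>) \<le> 4 * r\<^sup>2} \<subseteq> (\<Union>(a, b)\<in>T. between a b)"
proof -
  define v where "v = 4 * r\<^sup>2"
  have "r\<^sup>2 \<le> 2\<^sup>2" using r by (intro power_mono) auto
  then have v: "0 < v" "v \<le> 1000" using r by (auto simp: v_def)
  have [measurable]: "c \<in> borel_measurable \<nu>" using c by (rule dens_measurable)
  obtain B where B: "finite B" "real (card B) \<le> (A / v) powr A"
      and B3: "\<forall>(l, u)\<in>B. l \<in> borel_measurable \<nu> \<and> u \<in> borel_measurable \<nu> \<and>
         (\<integral>\<^sup>+x. ennreal ((u x - l x)\<^sup>2) \<partial>\<nu>) \<le> ennreal (72 / 100 * v)"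
      and B4: "\<forall>p\<in>P. (\<integral>x. (sqrt ((p x + c x) / 2) - sqrt (c x))\<^sup>2 \<partial>\<nu>) \<le> v \<longrightarrow>
         (\<exists>(l, u)\<in>B. AE x in \<nu>. l x \<le> sqrt ((p x + c x) / 2) \<and> sqrt ((p x + c x) / 2) \<le> u x)"
    using local_brackets[OF c v] by (elim exE conjE) (rule that)
  define F where "F = (\<lambda>(l, u). (\<lambda>x. max 0 (unbar c l x), unbar c u))"
  define Q where "Q = {p \<in> P. (\<integral>x. (sqrt ((p x + c x) / 2) - sqrt (c x))\<^sup>2 \<partial>\<nu>) \<le> v}"
  \<comment> \<open>Only brackets that meet the ball are kept, because the bound on the gap uses the
    distance of a member \<open>q\<close> from \<open>c\<close>.\<close>
  define T where "T = {ab \<in> F ` B. between (fst ab) (snd ab) \<inter> Q \<noteq> {}}"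
  have "T \<subseteq> F ` B" by (simp add: T_def)
  then have "card T \<le> card (F ` B)" using B(1) by (intro card_mono) auto
  also have "\<dots> \<le> card B" using B(1) by (rule card_image_le)
  finally have card_T: "card T \<le> card B" .
  have "(A / v) powr A = parts (68 * r\<^sup>2)"
    unfolding parts_def v_def by simp
  then have card: "real (card T) \<le> parts (68 * r\<^sup>2)" using B(2) card_T by simp
  have cover: "Q \<subseteq> (\<Union>(a, b)\<in>T. between a b)"
  proof
    fix p assume p: "p \<in> Q"
    then have pP: "p \<in> P" by (simp add: Q_def)
    obtain l u where lu: "(l, u) \<in> B"
      "AE x in \<nu>. l x \<le> sqrt ((p x + c x) / 2) \<and> sqrt ((p x + c x) / 2) \<le> u x"
      using B4 p unfolding Q_def by fast
    have "AE x in \<nu>. fst (F (l, u)) x \<le> p x \<and> p x \<le> snd (F (l, u)) x"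
      using lu(2) AE_space
    proof eventually_elim
      case (elim x)
      then show ?case
        using le_unbar[of "p x" c x u] unbar_le[of l x "p x" c] dens_nonneg[OF pP] dens_nonneg[OF c]
        by (auto simp: F_def)
    qed
    then have "p \<in> between (fst (F (l, u))) (snd (F (l, u)))" using pP by (simp add: between_def)
    moreover from this have "F (l, u) \<in> T" using lu(1) p by (auto simp: T_def)
    ultimately show "p \<in> (\<Union>(a, b)\<in>T. between a b)" by (auto simp: case_prod_beta' intro!: bexI[of _ "F (l, u)"])
  qed
  have "piece (207 * r\<^sup>2) a b" if T: "(a, b) \<in> T" for a b
  proof -
    obtain l u where lu: "(l, u) \<in> B" and a: "a = (\<lambda>x. max 0 (unbar c l x))" and b: "b = unbar c u"
      using T by (auto simp: T_def F_def)
    obtain q where q: "q \<in> between a b" "q \<in> Q" using T by (auto simp: T_def)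
    have lu': "l \<in> borel_measurable \<nu>" "u \<in> borel_measurable \<nu>"
        "(\<integral>\<^sup>+x. ennreal ((u x - l x)\<^sup>2) \<partial>\<nu>) \<le> ennreal (72 / 100 * v)"
      using B3 lu by fast+
    have [measurable]: "l \<in> borel_measurable \<nu>" "u \<in> borel_measurable \<nu>" using lu' by auto
    have [measurable]: "unbar c l \<in> borel_measurable \<nu>" "unbar c u \<in> borel_measurable \<nu>"
      by (intro measurable_unbar; measurable)+
    have [measurable]: "a \<in> borel_measurable \<nu>" "b \<in> borel_measurable \<nu>"
      unfolding a b by measurable
    have lu_int: "square_integrable \<nu> (\<lambda>x. u x - l x)" "(\<integral>x. (u x - l x)\<^sup>2 \<partial>\<nu>) \<le> 72 / 100 * v"
      using square_integrable_of_nn_integral[of "\<lambda>x. u x - l x" \<nu> "72 / 100 * v"] lu' v by auto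
    have qint: "integrable \<nu> (\<lambda>x. (sqrt ((q x + c x) / 2) - sqrt (c x))\<^sup>2)"
      using square_integrable_diff[OF sqrt_bar sqrt_dens] betweenD(1)[OF q(1)] c
      by (auto simp: square_integrable_def)
    have le: "AE x in \<nu>. root_gap (a x) (b x) \<le> 30 * ((u x - l x)\<^sup>2 + (sqrt ((q x + c x) / 2) - sqrt (c x))\<^sup>2)"
      using betweenD(2)[OF q(1)] AE_space
    proof eventually_elim
      case (elim x)
      have "bar_gap (c x) (a x) (b x) \<le> (u x - l x)\<^sup>2"
        using elim dens_nonneg[OF c] by (intro bar_gap_unbar) (auto simp: a b)
      moreover have "root_gap (a x) (b x) \<le> 30 * (bar_gap (c x) (a x) (b x) + (sqrt ((q x + c x) / 2) - sqrt (c x))\<^sup>2)"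
        using elim dens_nonneg[OF c] by (intro root_gap_le_bar_gap_center) (auto simp: a)
      ultimately show ?case by simp
    qed
    have int: "integrable \<nu> (\<lambda>x. 30 * ((u x - l x)\<^sup>2 + (sqrt ((q x + c x) / 2) - sqrt (c x))\<^sup>2))"
      using lu_int qint by (auto simp: square_integrable_def)
    have irg: "integrable \<nu> (\<lambda>x. root_gap (a x) (b x))"
    proof (rule Bochner_Integration.integrable_bound[OF int])
      show "(\<lambda>x. root_gap (a x) (b x)) \<in> borel_measurable \<nu>" unfolding root_gap_def by measurable
      show "AE x in \<nu>. norm (root_gap (a x) (b x)) \<le> norm (30 * ((u x - l x)\<^sup>2 + (sqrt ((q x + c x) / 2) - sqrt (c x))\<^sup>2))"
        using le by eventually_elim (simp add: root_gap_def)
    qed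
    have "(\<integral>x. root_gap (a x) (b x) \<partial>\<nu>) \<le> (\<integral>x. 30 * ((u x - l x)\<^sup>2 + (sqrt ((q x + c x) / 2) - sqrt (c x))\<^sup>2) \<partial>\<nu>)"
      using le irg int by (intro integral_mono_AE) auto
    also have "\<dots> = 30 * ((\<integral>x. (u x - l x)\<^sup>2 \<partial>\<nu>) + (\<integral>x. (sqrt ((q x + c x) / 2) - sqrt (c x))\<^sup>2 \<partial>\<nu>))"
      using lu_int qint by (simp add: square_integrable_def)
    also have "\<dots> \<le> 30 * (72 / 100 * v + v)"
      using lu_int(2) q(2) by (intro mult_left_mono add_mono) (auto simp: Q_def)
    also have "\<dots> \<le> 207 * r\<^sup>2" by (simp add: v_def)
    finally show ?thesis using irg by (simp add: piece_def a b)
  qed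
  then show ?thesis using card cover B(1) unfolding Q_def v_def
    by (intro exI[of _ T]) (auto simp: T_def)
qed

end

section \<open>Exponential inequalities for independent observations\<close>

lemma exp_minus_le: "0 \<le> (y::real) \<Longrightarrow> exp (- y) \<le> 1 - y + y\<^sup>2 / 2"
proof -
  assume y: "0 \<le> y"
  let ?h = "\<lambda>y::real. 1 - y + y\<^sup>2 / 2 - exp (- y)"
  have "?h 0 \<le> ?h y"
  proof (rule DERIV_nonneg_imp_nondecreasing[OF y])
    fix x :: real assume "0 \<le> x" "x \<le> y"
    have "(?h has_real_derivative (x - 1 + exp (- x))) (at x)"
      by (auto intro!: derivative_eq_intros)
    moreover have "0 \<le> x - 1 + exp (- x)" using exp_ge_add_one_self[of "- x"] by linarith
    ultimately show "\<exists>z. (?h has_real_derivative z) (at x) \<and> 0 \<le> z" by blast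
  qed
  then show ?thesis by simp
qed

text \<open>Markov's inequality for a product whose expectation factorises by independence.\<close>

lemma (in prob_space) prob_prod_ge:
  fixes g :: "'a \<Rightarrow> real"
  assumes [measurable]: "g \<in> borel_measurable M" and g: "\<And>x. 0 \<le> g x"
    and c: "(\<integral>\<^sup>+x. ennreal (g x) \<partial>M) \<le> ennreal c" and K: "0 < K" "0 \<le> c"
  shows "{xs \<in> space (\<Pi>\<^sub>M i\<in>{..<n::nat}. M). K \<le> (\<Prod>i<n. g (xs i))} \<in> sets (\<Pi>\<^sub>M i\<in>{..<n}. M)"
    "measure (\<Pi>\<^sub>M i\<in>{..<n}. M) {xs \<in> space (\<Pi>\<^sub>M i\<in>{..<n}. M). K \<le> (\<Prod>i<n. g (xs i))} \<le> c ^ n / K"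
proof -
  let ?M = "\<Pi>\<^sub>M i\<in>{..<n}. M"
  let ?E = "{xs \<in> space ?M. K \<le> (\<Prod>i<n. g (xs i))}"
  interpret prod: prob_space ?M by (rule prob_space_PiM) unfold_locales
  interpret psf: product_sigma_finite "\<lambda>_. M" by unfold_locales
  show E: "?E \<in> sets ?M" by measurable
  have "(\<integral>\<^sup>+xs. (\<Prod>i<n. ennreal (g (xs i))) \<partial>?M) = (\<Prod>i<n. \<integral>\<^sup>+x. ennreal (g x) \<partial>M)"
    by (intro psf.product_nn_integral_prod) auto
  also have "\<dots> \<le> ennreal (c ^ n)"
    using c K(2) by (auto simp: ennreal_power[symmetric] intro!: power_mono)
  finally have int: "(\<integral>\<^sup>+xs. (\<Prod>i<n. ennreal (g (xs i))) \<partial>?M) \<le> ennreal (c ^ n)" .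
  have "emeasure ?M ?E \<le> (\<integral>\<^sup>+xs. ennreal (1 / K) * (\<Prod>i<n. ennreal (g (xs i))) \<partial>?M)"
  proof -
    have "emeasure ?M ?E = (\<integral>\<^sup>+xs. indicator ?E xs \<partial>?M)" using E by simp
    also have "\<dots> \<le> (\<integral>\<^sup>+xs. ennreal (1 / K) * (\<Prod>i<n. ennreal (g (xs i))) \<partial>?M)"
    proof (intro nn_integral_mono)
      fix xs
      show "indicator ?E xs \<le> ennreal (1 / K) * (\<Prod>i<n. ennreal (g (xs i)))"
      proof (cases "xs \<in> ?E")
        case True
        have "ennreal (1 / K) * (\<Prod>i<n. ennreal (g (xs i))) = ennreal ((\<Prod>i<n. g (xs i)) / K)"
          using g K by (simp add: prod_ennreal ennreal_mult[symmetric] prod_nonneg)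
        also have "\<dots> \<ge> ennreal 1" using True K by (intro ennreal_leI) simp
        finally show ?thesis using True by simp
      qed simp
    qed
    finally show ?thesis .
  qed
  also have "\<dots> \<le> ennreal (1 / K) * ennreal (c ^ n)"
    using int by (subst nn_integral_cmult) (auto intro!: mult_left_mono)
  also have "\<dots> = ennreal (c ^ n / K)" using K by (simp add: ennreal_mult[symmetric])
  finally show "measure ?M ?E \<le> c ^ n / K"
    using K by (simp add: prod.emeasure_eq_measure)
qed

text \<open>Only the second moment enters, because \<open>exp (- y) \<le> 1 - y + y\<^sup>2 / 2\<close> for \<open>y \<ge> 0\<close>.\<close>

lemma (in prob_space) lower_deviation:
  fixes W :: "'a \<Rightarrow> real" and n :: nat
  assumes [measurable]: "W \<in> borel_measurable M" and W: "AE x in M. 0 \<le> W x \<and> W x \<le> 1"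
    and V: "(\<integral>x. (W x)\<^sup>2 \<partial>M) \<le> V" "0 < V" and t: "0 \<le> t" and n: "0 < n"
  shows "{xs \<in> space (\<Pi>\<^sub>M i\<in>{..<n}. M). (\<Sum>i<n. W (xs i)) \<le> real n * expectation W - t} \<in> sets (\<Pi>\<^sub>M i\<in>{..<n}. M)"
    "measure (\<Pi>\<^sub>M i\<in>{..<n}. M) {xs \<in> space (\<Pi>\<^sub>M i\<in>{..<n}. M). (\<Sum>i<n. W (xs i)) \<le> real n * expectation W - t}
       \<le> exp (- (t\<^sup>2) / (2 * real n * V))"
proof -
  \<comment> \<open>The minimiser of the exponent \<open>n * l\<^sup>2 * V / 2 - l * t\<close> of
    the Chernoff bound.\<close>
  define l where "l = t / (real n * V)"
  have l: "0 \<le> l" using t V n by (simp add: l_def)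
  define g where "g = (\<lambda>x. exp (- l * W x))"
  define e where "e = expectation W"
  have [measurable]: "g \<in> borel_measurable M" unfolding g_def by measurable
  have iW: "integrable M W"
    using W by (intro integrable_const_bound[of _ 1]) auto
  have iW2: "integrable M (\<lambda>x. (W x)\<^sup>2)"
  proof (rule integrable_const_bound[of _ 1])
    show "AE x in M. norm ((W x)\<^sup>2) \<le> 1" using W by eventually_elim (simp add: power_le_one)
  qed measurable
  have ig: "integrable M g"
  proof (rule integrable_const_bound[of _ 1])
    show "AE x in M. norm (g x) \<le> 1" using W by eventually_elim (use l in \<open>simp add: g_def\<close>)
  qed measurable
  have "expectation g \<le> (\<integral>x. 1 - l * W x + l\<^sup>2 * (W x)\<^sup>2 / 2 \<partial>M)"
  proof (rule integral_mono_AE[OF ig])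
    show "integrable M (\<lambda>x. 1 - l * W x + l\<^sup>2 * (W x)\<^sup>2 / 2)" using iW iW2 by auto
    show "AE x in M. g x \<le> 1 - l * W x + l\<^sup>2 * (W x)\<^sup>2 / 2"
      using W by eventually_elim (use l exp_minus_le in \<open>simp add: g_def power_mult_distrib[symmetric]\<close>)
  qed
  also have "\<dots> = 1 + (- l * e + l\<^sup>2 * (\<integral>x. (W x)\<^sup>2 \<partial>M) / 2)"
    using iW iW2 by (simp add: e_def prob_space)
  also have "\<dots> \<le> 1 + (- l * e + l\<^sup>2 * V / 2)"
    using V by (simp add: mult_left_mono)
  also have "\<dots> \<le> exp (- l * e + l\<^sup>2 * V / 2)"
    by (rule exp_ge_add_one_self)
  finally have eg: "expectation g \<le> exp (- l * e + l\<^sup>2 * V / 2)" .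
  have "(\<integral>\<^sup>+x. ennreal (g x) \<partial>M) = ennreal (expectation g)"
    using ig by (intro nn_integral_eq_integral) (auto simp: g_def)
  then have c: "(\<integral>\<^sup>+x. ennreal (g x) \<partial>M) \<le> ennreal (exp (- l * e + l\<^sup>2 * V / 2))"
    using eg by (simp add: ennreal_leI)
  define K where "K = exp (l * (t - real n * e))"
  note pp = prob_prod_ge[OF \<open>g \<in> borel_measurable M\<close> _ c, of K n]
  let ?M = "\<Pi>\<^sub>M i\<in>{..<n}. M"
  let ?E = "{xs \<in> space ?M. (\<Sum>i<n. W (xs i)) \<le> real n * e - t}"
  let ?F = "{xs \<in> space ?M. K \<le> (\<Prod>i<n. g (xs i))}"
  interpret prod: prob_space ?M by (rule prob_space_PiM) unfold_locales
  have "?E \<in> sets ?M" by measurable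
  then show "{xs \<in> space ?M. (\<Sum>i<n. W (xs i)) \<le> real n * expectation W - t} \<in> sets ?M"
    by (simp add: e_def)
  have sub: "?E \<subseteq> ?F"
  proof safe
    fix xs assume xs: "(\<Sum>i<n. W (xs i)) \<le> real n * e - t"
    have "(\<Prod>i<n. g (xs i)) = exp (- l * (\<Sum>i<n. W (xs i)))"
      by (simp add: g_def exp_sum[symmetric] sum_distrib_left sum_negf)
    also have "\<dots> \<ge> exp (- l * (real n * e - t))"
      using xs l by (simp add: mult_left_mono)
    finally show "K \<le> (\<Prod>i<n. g (xs i))" by (simp add: K_def algebra_simps)
  qed
  have "prod.prob ?E \<le> prod.prob ?F"
    by (rule prod.finite_measure_mono[OF sub]) (rule pp(1); simp add: g_def K_def)
  also have "\<dots> \<le> exp (- l * e + l\<^sup>2 * V / 2) ^ n / K"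
    by (rule pp(2)) (auto simp: g_def K_def)
  also have "\<dots> = exp (real n * (- l * e + l\<^sup>2 * V / 2) - l * (t - real n * e))"
    by (simp add: K_def exp_diff exp_of_nat_mult)
  also have "real n * (- l * e + l\<^sup>2 * V / 2) - l * (t - real n * e) = - (t\<^sup>2) / (2 * real n * V)"
    using V n by (simp add: l_def field_simps power2_eq_square)
  finally show "prod.prob {xs \<in> space ?M. (\<Sum>i<n. W (xs i)) \<le> real n * expectation W - t} \<le> exp (- (t\<^sup>2) / (2 * real n * V))"
    by (simp add: e_def)
qed

section \<open>Likelihood ratios of barred functions under the true density\<close>

context density_class
begin

definition law :: "('a \<Rightarrow> real) \<Rightarrow> 'a measure" where
  "law p = density \<nu> (\<lambda>x. ennreal (p x))"

definition sample :: "('a \<Rightarrow> real) \<Rightarrow> nat \<Rightarrow> (nat \<Rightarrow> 'a) measure" where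
  "sample p n = (\<Pi>\<^sub>M i\<in>{..<n}. law p)"

definition rbar :: "('a \<Rightarrow> real) \<Rightarrow> ('a \<Rightarrow> real) \<Rightarrow> 'a \<Rightarrow> real" where
  "rbar p b x = sqrt ((b x + p x) / 2)"

text \<open>Half the log-likelihood ratio of \<open>(b + p) / 2\<close> against \<open>p\<close>.
  Averaging with the true density bounds the quotient below by \<open>1 / sqrt 2\<close> wherever
  \<open>b\<close> is nonnegative and \<open>p\<close> positive.\<close>

definition log_ratio :: "('a \<Rightarrow> real) \<Rightarrow> nat \<Rightarrow> ('a \<Rightarrow> real) \<Rightarrow> (nat \<Rightarrow> 'a) \<Rightarrow> real" where
  "log_ratio p n b xs = (\<Sum>i<n. ln (rbar p b (xs i) / sqrt (p (xs i))))"

text \<open>The Hellinger affinity if \<open>b\<close> is a density; for an upper bracket end it can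
  exceed 1.\<close>

definition affinity :: "('a \<Rightarrow> real) \<Rightarrow> ('a \<Rightarrow> real) \<Rightarrow> real" where
  "affinity p b = (\<integral>x. rbar p b x * sqrt (p x) \<partial>\<nu>)"

text \<open>Twice the squared Hellinger distance of the barred density from
  \<open>p\<close>.\<close>

definition radius2 :: "('a \<Rightarrow> real) \<Rightarrow> ('a \<Rightarrow> real) \<Rightarrow> real" where
  "radius2 p q = (\<integral>x. (rbar p q x - sqrt (p x))\<^sup>2 \<partial>\<nu>)"

lemma prob_space_law: "p \<in> P \<Longrightarrow> prob_space (law p)"
  using dens_measurable[of p] dens_one[of p]
  by (intro prob_spaceI) (simp add: law_def emeasure_density cong: nn_integral_cong)

lemma prob_space_sample: "p \<in> P \<Longrightarrow> prob_space (sample p n)"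
  unfolding sample_def by (intro prob_space_PiM prob_space_law)

lemma AE_law: "p \<in> P \<Longrightarrow> AE x in \<nu>. Q x \<Longrightarrow> AE x in law p. Q x \<and> 0 < p x"
  unfolding law_def using dens_measurable[of p] by (subst AE_density) (auto elim: eventually_mono)

lemma AE_sample:
  assumes "p \<in> P" "AE x in \<nu>. Q x"
  shows "AE xs in sample p n. \<forall>i<n. Q (xs i) \<and> 0 < p (xs i)"
proof -
  have "AE xs in sample p n. \<forall>i\<in>{..<n}. Q (xs i) \<and> 0 < p (xs i)"
    unfolding sample_def
    by (intro AE_finite_allI finite_lessThan AE_PiM_component prob_space_law AE_law assms)
  then show ?thesis by eventually_elim simp
qed

text \<open>The averaging point is now the true density \<open>p\<close>, wherever it lies relative
  to the bracket. Raising the lower end to the member \<open>q\<close> only shrinks the gap, which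
  bounds the step from \<open>b\<close> to \<open>q\<close>; the distance from \<open>b\<close> to
  \<open>p\<close> is then measured through \<open>q\<close>.\<close>

lemma rbar_facts:
  assumes p: "p \<in> P" and "piece V a b" and q: "q \<in> between a b"
  shows "square_integrable \<nu> (rbar p b)" "rbar p b \<in> borel_measurable \<nu>"
    "L2_norm \<nu> (\<lambda>x. rbar p b x - rbar p q x) \<le> sqrt (V / 2)"
    "square_integrable \<nu> (\<lambda>x. rbar p b x - rbar p q x)"
    "L2_norm \<nu> (\<lambda>x. rbar p b x - sqrt (p x)) \<le> sqrt V + sqrt (radius2 p q)"
proof -
  have [measurable]: "a \<in> borel_measurable \<nu>" "b \<in> borel_measurable \<nu>" "p \<in> borel_measurable \<nu>"
      "q \<in> borel_measurable \<nu>"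
    using assms dens_measurable betweenD(1)[OF q] by (auto simp: piece_def)
  have a: "0 \<le> a x" for x using assms by (auto simp: piece_def)
  have ic: "integrable \<nu> (\<lambda>x. root_gap (a x) (b x))" "(\<integral>x. root_gap (a x) (b x) \<partial>\<nu>) \<le> V"
    using assms by (auto simp: piece_def)
  show mb: "rbar p b \<in> borel_measurable \<nu>" unfolding rbar_def by measurable
  have mq: "rbar p q \<in> borel_measurable \<nu>" unfolding rbar_def by measurable
  have le: "AE x in \<nu>. (rbar p b x - rbar p q x)\<^sup>2 \<le> root_gap (a x) (b x) / 2"
    using betweenD(2)[OF q] AE_space
  proof eventually_elim
    case (elim x)
    have "(rbar p b x - rbar p q x)\<^sup>2 = bar_gap (p x) (q x) (b x)"
      by (simp add: rbar_def bar_gap_def)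
    also have "\<dots> \<le> root_gap (q x) (b x) / 2"
      using elim a[of x] dens_nonneg[OF p] by (intro bar_gap_le) auto
    also have "root_gap (q x) (b x) \<le> root_gap (a x) (b x)"
      unfolding root_gap_def using elim a[of x] by (intro power_mono) auto
    finally show ?case by simp
  qed
  have i: "integrable \<nu> (\<lambda>x. (rbar p b x - rbar p q x)\<^sup>2)"
  proof (rule Bochner_Integration.integrable_bound)
    show "integrable \<nu> (\<lambda>x. root_gap (a x) (b x) / 2)" using ic by simp
    show "(\<lambda>x. (rbar p b x - rbar p q x)\<^sup>2) \<in> borel_measurable \<nu>" using mb mq by measurable
    show "AE x in \<nu>. norm ((rbar p b x - rbar p q x)\<^sup>2) \<le> norm (root_gap (a x) (b x) / 2)"
      using le by eventually_elim (simp add: root_gap_def)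
  qed
  show s: "square_integrable \<nu> (\<lambda>x. rbar p b x - rbar p q x)"
    using i mb mq by (simp add: square_integrable_def)
  have "(\<integral>x. (rbar p b x - rbar p q x)\<^sup>2 \<partial>\<nu>) \<le> (\<integral>x. root_gap (a x) (b x) / 2 \<partial>\<nu>)"
    using i le ic by (intro integral_mono_AE) auto
  also have "\<dots> \<le> V / 2" using ic by simp
  finally show n: "L2_norm \<nu> (\<lambda>x. rbar p b x - rbar p q x) \<le> sqrt (V / 2)"
    by (simp add: L2_norm_def)
  have sq: "square_integrable \<nu> (rbar p q)"
    using sqrt_bar[OF betweenD(1)[OF q] p] unfolding rbar_def .
  show "square_integrable \<nu> (rbar p b)"
    using square_integrable_add[OF s sq] by simp
  have "0 \<le> (\<integral>x. root_gap (a x) (b x) \<partial>\<nu>)" by (simp add: root_gap_def)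
  then have V: "0 \<le> V" using ic(2) by simp
  have "L2_norm \<nu> (\<lambda>x. (rbar p b x - rbar p q x) + (rbar p q x - sqrt (p x)))
      \<le> L2_norm \<nu> (\<lambda>x. rbar p b x - rbar p q x) + L2_norm \<nu> (\<lambda>x. rbar p q x - sqrt (p x))"
    by (intro L2_norm_triangle s square_integrable_diff sq sqrt_dens p)
  also have "\<dots> \<le> sqrt V + sqrt (radius2 p q)"
    using n real_sqrt_le_mono[of "V / 2" V] V unfolding radius2_def L2_norm_def by linarith
  finally show "L2_norm \<nu> (\<lambda>x. rbar p b x - sqrt (p x)) \<le> sqrt V + sqrt (radius2 p q)" by simp
qed

end

section \<open>Deviation of the likelihood along nested brackets\<close>

lemma square_integrable_cmult: "square_integrable M g \<Longrightarrow> square_integrable M (\<lambda>x. c * g x)"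
  by (auto simp: square_integrable_def power_mult_distrib)

lemma L2_norm_cmult: "L2_norm M (\<lambda>x. c * g x) = \<bar>c\<bar> * L2_norm M g"
  by (simp add: L2_norm_def power_mult_distrib real_sqrt_mult)

context density_class
begin

lemma rbar_ge:
  assumes "p \<in> P" "x \<in> space \<nu>" "0 \<le> c" "c \<le> b x"
  shows "sqrt (p x / 2) \<le> rbar p b x"
  using assms dens_nonneg[OF assms(1,2)] by (auto simp: rbar_def intro!: real_sqrt_le_mono)

text \<open>One edge of the tree. Since \<open>ln y \<le> y - 1\<close>, the log ratio drops by at
  least the sum of the values of \<open>W\<close>. The mean of \<open>W\<close> is the drop of the
  affinity, which telescopes along a path, up to an error of second order; its second moment is at
  most \<open>V\<close>. A member \<open>q\<close> near \<open>p\<close> is required so that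
  \<open>b\<close> is near \<open>p\<close> as well.\<close>

lemma edge_deviation:
  assumes p: "p \<in> P" and ab: "piece V a b" and ab': "piece V' a' b'"
    and le: "\<And>x. a x \<le> a' x" "\<And>x. b' x \<le> b x"
    and q: "q \<in> between a' b'" "radius2 p q \<le> 4 * r\<^sup>2" and pos: "0 < V" "0 \<le> t" "0 < n" "0 \<le> r"
  shows "\<exists>E\<in>sets (sample p n). measure (sample p n) E \<le> exp (- (t\<^sup>2) / (2 * real n * V)) \<and>
    (AE xs in sample p n. xs \<notin> E \<longrightarrow> log_ratio p n b' xs \<le> log_ratio p n b xs
       - n * (affinity p b - affinity p b') + (t + n * (sqrt V * (sqrt V + 2 * r))))"
proof -
  have qP: "q \<in> P" by (rule betweenD(1)[OF q(1)])
  have a: "0 \<le> a x" "0 \<le> a' x" for x using ab ab' by (auto simp: piece_def)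
  have qab: "q \<in> between a b"
  proof -
    have "AE x in \<nu>. a x \<le> q x \<and> q x \<le> b x"
      using betweenD(2)[OF q(1)] by eventually_elim (use le in \<open>meson order_trans\<close>)
    then show ?thesis using qP by (simp add: between_def)
  qed
  have [measurable]: "p \<in> borel_measurable \<nu>" using p by (rule dens_measurable)
  note fb = rbar_facts[OF p ab qab] and fb' = rbar_facts[OF p ab' q(1)]
  have [measurable]: "rbar p b \<in> borel_measurable \<nu>" "rbar p b' \<in> borel_measurable \<nu>" using fb fb' by auto
  interpret D: prob_space "law p" by (rule prob_space_law[OF p])
  have F: "AE x in \<nu>. x \<in> space \<nu> \<and> 0 \<le> p x \<and> rbar p q x \<le> rbar p b' x \<and> rbar p b' x \<le> rbar p b x \<and>
      sqrt (p x / 2) \<le> rbar p b' x \<and> 0 \<le> rbar p b' x"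
    using betweenD(2)[OF q(1)] AE_space
  proof eventually_elim
    case (elim x)
    have "0 \<le> sqrt (p x / 2)" using elim dens_nonneg[OF p] by auto
    moreover have "sqrt (p x / 2) \<le> rbar p b' x"
      by (rule rbar_ge[where c = "q x"]) (use elim p dens_nonneg[OF qP] in auto)
    moreover have "rbar p b' x \<le> rbar p b x" "rbar p q x \<le> rbar p b' x"
      using elim le(2)[of x] by (auto simp: rbar_def intro!: real_sqrt_le_mono)
    ultimately show ?case using elim dens_nonneg[OF p] by (auto intro: order_trans[of 0 "sqrt (p x / 2)"])
  qed
  then have F2: "AE x in \<nu>. 0 \<le> rbar p b' x \<and> rbar p b' x \<le> rbar p b x \<and> sqrt (p x / 2) \<le> rbar p b' x"
    by eventually_elim simp
  define G where "G = (\<lambda>x. rbar p b x - rbar p b' x)"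
  \<comment> \<open>Chosen so that \<open>p / rbar p b = sqrt p - H\<close>. The first part of
    \<open>p * W\<close> integrates exactly to the difference of affinities, and the rest is the
    integral of \<open>G * H\<close>, small by Cauchy-Schwarz.\<close>
  define H where "H = (\<lambda>x. sqrt (p x) / rbar p b x * (rbar p b x - sqrt (p x)))"
  define W where "W = (\<lambda>x. G x / rbar p b x)"
  have [measurable]: "G \<in> borel_measurable \<nu>" "H \<in> borel_measurable \<nu>" "W \<in> borel_measurable \<nu>"
    unfolding G_def H_def W_def by measurable
  have G: "square_integrable \<nu> G" "L2_norm \<nu> G \<le> sqrt (V / 2)"
  proof -
    have *: "AE x in \<nu>. \<bar>G x\<bar> \<le> \<bar>rbar p b x - rbar p q x\<bar>"
      using F by eventually_elim (auto simp: G_def)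
    show "square_integrable \<nu> G"
      by (rule square_integrable_bound(1)[OF fb(4) _ *]) measurable
    have "L2_norm \<nu> G \<le> L2_norm \<nu> (\<lambda>x. rbar p b x - rbar p q x)"
      by (rule square_integrable_bound(2)[OF fb(4) _ *]) measurable
    then show "L2_norm \<nu> G \<le> sqrt (V / 2)" using fb(3) by simp
  qed
  \<comment> \<open>The gain from the barred functions: \<open>rbar p b\<close> is at least
    \<open>sqrt (p / 2)\<close>, so dividing by it costs only a constant.\<close>
  have ratio: "AE x in \<nu>. \<bar>sqrt (p x) / rbar p b x\<bar> \<le> sqrt 2"
    using F
  proof eventually_elim
    case (elim x)
    show ?case
    proof (cases "p x = 0")
      case False
      then have "0 < sqrt (p x / 2)" using elim by simp
      then have "0 < rbar p b x" "sqrt (p x / 2) \<le> rbar p b x" using elim by linarith+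
      moreover have "sqrt (p x) = sqrt 2 * sqrt (p x / 2)" by (simp add: real_sqrt_mult[symmetric])
      ultimately show ?thesis using elim by (simp add: divide_le_eq)
    qed simp
  qed
  have H: "square_integrable \<nu> H" "L2_norm \<nu> H \<le> sqrt 2 * (sqrt V + 2 * r)"
  proof -
    have sd: "square_integrable \<nu> (\<lambda>x. rbar p b x - sqrt (p x))"
      by (intro square_integrable_diff fb(1) sqrt_dens p)
    have *: "AE x in \<nu>. \<bar>H x\<bar> \<le> \<bar>sqrt 2 * (rbar p b x - sqrt (p x))\<bar>"
      using ratio by eventually_elim (simp only: H_def abs_mult, rule mult_right_mono, auto)
    show "square_integrable \<nu> H"
      by (rule square_integrable_bound(1)[OF square_integrable_cmult[OF sd] _ *]) measurable
    have "L2_norm \<nu> H \<le> L2_norm \<nu> (\<lambda>x. sqrt 2 * (rbar p b x - sqrt (p x)))"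
      by (rule square_integrable_bound(2)[OF square_integrable_cmult[OF sd] _ *]) measurable
    also have "\<dots> = sqrt 2 * L2_norm \<nu> (\<lambda>x. rbar p b x - sqrt (p x))" by (simp add: L2_norm_cmult)
    also have "\<dots> \<le> sqrt 2 * (sqrt V + 2 * r)"
    proof (rule mult_left_mono)
      have "sqrt (radius2 p q) \<le> sqrt ((2 * r)\<^sup>2)"
        using q(2) by (intro real_sqrt_le_mono) (simp add: power_mult_distrib)
      also have "\<dots> = 2 * r" using pos by (subst real_sqrt_abs) simp
      finally have "sqrt (radius2 p q) \<le> 2 * r" .
      then show "L2_norm \<nu> (\<lambda>x. rbar p b x - sqrt (p x)) \<le> sqrt V + 2 * r"
        using fb(5) by linarith
    qed simp
    finally show "L2_norm \<nu> H \<le> sqrt 2 * (sqrt V + 2 * r)" .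
  qed
  have GH: "(\<integral>x. G x * H x \<partial>\<nu>) \<le> sqrt V * (sqrt V + 2 * r)"
  proof -
    have "(\<integral>x. G x * H x \<partial>\<nu>) \<le> L2_norm \<nu> G * L2_norm \<nu> H"
      using L2_Cauchy_Schwarz[OF G(1) H(1)] by simp
    also have "\<dots> \<le> sqrt (V / 2) * (sqrt 2 * (sqrt V + 2 * r))"
      using G(2) H(2) pos by (intro mult_mono) (auto simp: L2_norm_nonneg)
    also have "\<dots> = sqrt V * (sqrt V + 2 * r)" by (simp add: real_sqrt_divide)
    finally show ?thesis .
  qed
  have pW: "AE x in \<nu>. p x * W x = G x * sqrt (p x) - G x * H x"
    using F
  proof eventually_elim
    case (elim x)
    show ?case
    proof (cases "p x = 0")
      case False
      then have "0 < sqrt (p x / 2)" using elim by simp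
      then have "rbar p b x \<noteq> 0" using elim by linarith
      moreover have "p x = sqrt (p x) * sqrt (p x)" using elim by simp
      ultimately show ?thesis unfolding W_def H_def by (simp add: field_simps)
    qed (simp add: H_def)
  qed
  have "D.expectation W = (\<integral>x. p x * W x \<partial>\<nu>)"
    unfolding law_def using p dens_nonneg by (subst integral_density) auto
  also have "\<dots> = (\<integral>x. G x * sqrt (p x) - G x * H x \<partial>\<nu>)"
    using pW by (intro integral_cong_AE) auto
  also have "\<dots> = (\<integral>x. G x * sqrt (p x) \<partial>\<nu>) - (\<integral>x. G x * H x \<partial>\<nu>)"
    using G(1) H(1) sqrt_dens[OF p] by (intro Bochner_Integration.integral_diff square_integrable_mult)
  also have "(\<integral>x. G x * sqrt (p x) \<partial>\<nu>) = affinity p b - affinity p b'"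
    unfolding G_def affinity_def left_diff_distrib
    using fb(1) fb'(1) sqrt_dens[OF p] by (intro Bochner_Integration.integral_diff square_integrable_mult)
  finally have EW: "D.expectation W \<ge> affinity p b - affinity p b' - sqrt V * (sqrt V + 2 * r)"
    using GH by simp
  have "D.expectation (\<lambda>x. (W x)\<^sup>2) = (\<integral>x. p x * (W x)\<^sup>2 \<partial>\<nu>)"
    unfolding law_def using p dens_nonneg by (subst integral_density) auto
  also have "\<dots> \<le> (\<integral>x. 2 * (G x)\<^sup>2 \<partial>\<nu>)"
  proof (rule integral_mono_AE')
    show "integrable \<nu> (\<lambda>x. 2 * (G x)\<^sup>2)" using G(1) by (simp add: square_integrable_def)
    show "AE x in \<nu>. p x * (W x)\<^sup>2 \<le> 2 * (G x)\<^sup>2"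
      using F ratio
    proof eventually_elim
      case (elim x)
      have "p x * (W x)\<^sup>2 = (sqrt (p x) / rbar p b x)\<^sup>2 * (G x)\<^sup>2"
        using elim by (simp add: W_def power_divide)
      also have "\<dots> \<le> (sqrt 2)\<^sup>2 * (G x)\<^sup>2"
        using elim by (intro mult_right_mono) (metis abs_le_square_iff abs_of_nonneg real_sqrt_ge_zero zero_le_numeral, simp)
      finally show ?case by simp
    qed
    show "AE x in \<nu>. 0 \<le> 2 * (G x)\<^sup>2" by simp
  qed
  also have "\<dots> = 2 * (L2_norm \<nu> G)\<^sup>2" by (simp add: L2_norm_power2)
  also have "\<dots> \<le> 2 * (sqrt (V / 2))\<^sup>2"
    using G(2) by (intro mult_left_mono power_mono) (auto simp: L2_norm_nonneg)
  also have "\<dots> = V" using pos by simp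
  finally have EW2: "D.expectation (\<lambda>x. (W x)\<^sup>2) \<le> V" .
  have F': "AE x in law p. (0 \<le> rbar p b' x \<and> rbar p b' x \<le> rbar p b x \<and> sqrt (p x / 2) \<le> rbar p b' x) \<and> 0 < p x"
    using AE_law[OF p F2] .
  have W01: "AE x in law p. 0 \<le> W x \<and> W x \<le> 1"
    using F' by eventually_elim (auto simp: W_def G_def divide_le_eq)
  have "W \<in> borel_measurable (law p)" by (simp add: law_def)
  note dev = D.lower_deviation[OF this W01 EW2 pos(1,2,3), folded sample_def]
  define E where "E = {xs \<in> space (sample p n). (\<Sum>i<n. W (xs i)) \<le> n * D.expectation W - t}"
  have "AE xs in sample p n. \<forall>i<n. (0 \<le> rbar p b' (xs i) \<and> rbar p b' (xs i) \<le> rbar p b (xs i) \<and>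
      sqrt (p (xs i) / 2) \<le> rbar p b' (xs i)) \<and> 0 < p (xs i)"
    by (rule AE_sample[OF p]) (rule F2)
  then have "AE xs in sample p n. xs \<notin> E \<longrightarrow> log_ratio p n b' xs \<le> log_ratio p n b xs
       - n * (affinity p b - affinity p b') + (t + n * (sqrt V * (sqrt V + 2 * r)))"
    using AE_space
  proof eventually_elim
    case (elim xs)
    show ?case
    proof
      assume "xs \<notin> E"
      then have sW: "n * D.expectation W - t \<le> (\<Sum>i<n. W (xs i))" using elim by (auto simp: E_def)
      have "ln (rbar p b' (xs i) / sqrt (p (xs i))) \<le> ln (rbar p b (xs i) / sqrt (p (xs i))) - W (xs i)" if "i < n" for i
      proof -
        let ?B = "rbar p b (xs i)" and ?B' = "rbar p b' (xs i)" and ?s = "sqrt (p (xs i))"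
        have "0 < p (xs i)" "?B' \<le> ?B" "sqrt (p (xs i) / 2) \<le> ?B'" using elim that by auto
        then have "0 < ?s" "0 < sqrt (p (xs i) / 2)" by auto
        then have B: "0 < ?s" "0 < ?B'" "0 < ?B" using \<open>?B' \<le> ?B\<close> \<open>sqrt (p (xs i) / 2) \<le> ?B'\<close> by linarith+
        have "ln (?B' / ?s) = ln (?B / ?s) + ln (?B' / ?B)"
          using B by (simp add: ln_div)
        also have "ln (?B' / ?B) \<le> ?B' / ?B - 1" using B by (intro ln_le_minus_one) simp
        also have "?B' / ?B - 1 = - W (xs i)" using B by (simp add: W_def G_def field_simps)
        finally show ?thesis by simp
      qed
      then have "log_ratio p n b' xs \<le> (\<Sum>i<n. ln (rbar p b (xs i) / sqrt (p (xs i))) - W (xs i))"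
        unfolding log_ratio_def by (intro sum_mono) auto
      also have "\<dots> = log_ratio p n b xs - (\<Sum>i<n. W (xs i))"
        by (simp add: log_ratio_def sum_subtractf)
      also have "\<dots> \<le> log_ratio p n b xs - (n * D.expectation W - t)" using sW by simp
      also have "\<dots> \<le> log_ratio p n b xs - (n * (affinity p b - affinity p b' - sqrt V * (sqrt V + 2 * r)) - t)"
        using EW by (intro diff_mono diff_mono mult_left_mono) auto
      finally show "log_ratio p n b' xs \<le> log_ratio p n b xs
         - n * (affinity p b - affinity p b') + (t + n * (sqrt V * (sqrt V + 2 * r)))"
        by (simp add: algebra_simps)
    qed
  qed
  moreover have "E \<in> sets (sample p n)" "measure (sample p n) E \<le> exp (- (t\<^sup>2) / (2 * real n * V))"
    using dev by (auto simp: E_def)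
  ultimately show ?thesis by blast
qed

text \<open>At the end of a path no probability is spent: all members \<open>q\<close> lie below
  \<open>b\<close> simultaneously by \<open>AE_uniform\<close>, so their ratios are smaller.
  Restoring the affinity of \<open>q\<close> costs \<open>sqrt V\<close>, of first order in the
  width, which dictates how deep the tree must go.\<close>

lemma leaf_bound:
  assumes p: "p \<in> P" and ab: "piece V a b"
  shows "AE xs in sample p n. \<forall>q\<in>between a b. log_ratio p n q xs \<le> log_ratio p n b xs
       - n * (affinity p b - affinity p q) + n * sqrt V"
proof -
  have "AE x in \<nu>. \<forall>q\<in>between a b. q x \<le> b x"
    by (rule AE_uniform) (auto simp: between_def elim: eventually_mono)
  then have "AE x in \<nu>. (\<forall>q\<in>between a b. q x \<le> b x) \<and> x \<in> space \<nu>"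
    using AE_space by eventually_elim simp
  then have "AE xs in sample p n. \<forall>i<n. ((\<forall>q\<in>between a b. q (xs i) \<le> b (xs i)) \<and> xs i \<in> space \<nu>) \<and> 0 < p (xs i)"
    by (rule AE_sample[OF p])
  then show ?thesis
  proof eventually_elim
    case (elim xs)
    show ?case
    proof
      fix q assume q: "q \<in> between a b"
      have qP: "q \<in> P" by (rule betweenD(1)[OF q])
      note fb = rbar_facts[OF p ab q]
      have "0 \<le> (\<integral>x. root_gap (a x) (b x) \<partial>\<nu>)" by (simp add: root_gap_def)
      then have V: "0 \<le> V" using ab unfolding piece_def by linarith
      have "log_ratio p n q xs \<le> log_ratio p n b xs"
        unfolding log_ratio_def
      proof (rule sum_mono)
        fix i assume i: "i \<in> {..<n}"
        have "0 < p (xs i)" "0 \<le> q (xs i)" "q (xs i) \<le> b (xs i)"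
          using elim i q dens_nonneg[OF qP] by auto
        then have "0 < rbar p q (xs i)" "rbar p q (xs i) \<le> rbar p b (xs i)"
          by (auto simp: rbar_def intro!: real_sqrt_le_mono)
        then show "ln (rbar p q (xs i) / sqrt (p (xs i))) \<le> ln (rbar p b (xs i) / sqrt (p (xs i)))"
          using \<open>0 < p (xs i)\<close> by (simp add: divide_right_mono)
      qed
      moreover have "affinity p b - affinity p q \<le> sqrt V"
      proof -
        have sq: "square_integrable \<nu> (rbar p q)" using sqrt_bar[OF qP p] unfolding rbar_def .
        have "affinity p b - affinity p q = (\<integral>x. (rbar p b x - rbar p q x) * sqrt (p x) \<partial>\<nu>)"
          unfolding affinity_def left_diff_distrib
          using fb(1) sq sqrt_dens[OF p]
          by (intro Bochner_Integration.integral_diff[symmetric] square_integrable_mult)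
        also have "\<dots> \<le> L2_norm \<nu> (\<lambda>x. rbar p b x - rbar p q x) * L2_norm \<nu> (\<lambda>x. sqrt (p x))"
          using L2_Cauchy_Schwarz[OF fb(4) sqrt_dens[OF p]] by simp
        also have "L2_norm \<nu> (\<lambda>x. sqrt (p x)) = 1"
        proof -
          have "(\<integral>x. (sqrt (p x))\<^sup>2 \<partial>\<nu>) = (\<integral>x. p x \<partial>\<nu>)"
            using dens_nonneg[OF p] by (intro Bochner_Integration.integral_cong) auto
          then show ?thesis by (simp add: L2_norm_def integral_dens[OF p])
        qed
        also have "L2_norm \<nu> (\<lambda>x. rbar p b x - rbar p q x) * 1 \<le> sqrt V"
          using fb(3) real_sqrt_le_mono[of "V / 2" V] V by linarith
        finally show ?thesis .
      qed
      then have "n * (affinity p b - affinity p q) \<le> n * sqrt V" by (intro mult_left_mono) auto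
      ultimately show "log_ratio p n q xs \<le> log_ratio p n b xs - n * (affinity p b - affinity p q) + n * sqrt V"
        by linarith
    qed
  qed
qed

text \<open>The mean of \<open>rbar p b / sqrt p\<close> under the true law is the affinity, at most
  \<open>exp (affinity p b - 1)\<close>; Markov's inequality for the product does the rest.\<close>

lemma root_bound:
  assumes p: "p \<in> P" and ab: "piece V a b" and q: "q \<in> between a b"
  shows "\<exists>E\<in>sets (sample p n). measure (sample p n) E \<le> exp (- s) \<and>
    (AE xs in sample p n. xs \<notin> E \<longrightarrow> log_ratio p n b xs \<le> n * (affinity p b - 1) + s)"
proof -
  interpret D: prob_space "law p" by (rule prob_space_law[OF p])
  have qP: "q \<in> P" by (rule betweenD(1)[OF q])
  note fb = rbar_facts[OF p ab q]
  have [measurable]: "rbar p b \<in> borel_measurable \<nu>" "p \<in> borel_measurable \<nu>"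
    using fb p dens_measurable by auto
  \<comment> \<open>The absolute values make \<open>g\<close> nonnegative everywhere, as
    \<open>prob_prod_ge\<close> demands; they change nothing almost everywhere.\<close>
  define g where "g = (\<lambda>x. \<bar>rbar p b x\<bar> / sqrt \<bar>p x\<bar>)"
  have [measurable]: "g \<in> borel_measurable \<nu>" unfolding g_def by measurable
  have F: "AE x in \<nu>. x \<in> space \<nu> \<and> 0 \<le> rbar p b x \<and> (0 < p x \<longrightarrow> 0 < rbar p b x)"
    using betweenD(2)[OF q] AE_space
  proof eventually_elim
    case (elim x)
    have "sqrt (p x / 2) \<le> rbar p b x"
      by (rule rbar_ge[where c = "q x"]) (use elim p dens_nonneg[OF qP] in auto)
    moreover have "0 \<le> sqrt (p x / 2)" "0 < p x \<Longrightarrow> 0 < sqrt (p x / 2)" using dens_nonneg[OF p] elim by auto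
    ultimately show ?case using elim by linarith
  qed
  have F1: "AE x in \<nu>. 0 \<le> rbar p b x * sqrt (p x)"
    using F by eventually_elim (use dens_nonneg[OF p] in auto)
  have F2: "AE x in \<nu>. 0 < p x \<longrightarrow> 0 < rbar p b x" using F by eventually_elim simp
  have "(\<integral>\<^sup>+x. ennreal (g x) \<partial>law p) = (\<integral>\<^sup>+x. ennreal (p x) * ennreal (g x) \<partial>\<nu>)"
    unfolding law_def by (intro nn_integral_density) measurable
  also have "\<dots> = (\<integral>\<^sup>+x. ennreal (rbar p b x * sqrt (p x)) \<partial>\<nu>)"
  proof (rule nn_integral_cong_AE)
    show "AE x in \<nu>. ennreal (p x) * ennreal (g x) = ennreal (rbar p b x * sqrt (p x))"
      using F
    proof eventually_elim
      case (elim x)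
      have "0 \<le> p x" using elim dens_nonneg[OF p] by auto
      moreover from this have "p x * (rbar p b x / sqrt (p x)) = rbar p b x * sqrt (p x)"
        by (metis mult.commute real_div_sqrt times_divide_eq_left times_divide_eq_right)
      ultimately show ?case using elim by (simp add: g_def ennreal_mult[symmetric])
    qed
  qed
  also have "\<dots> = ennreal (affinity p b)"
    unfolding affinity_def
    by (intro nn_integral_eq_integral square_integrable_mult fb(1) sqrt_dens p F1)
  finally have c: "(\<integral>\<^sup>+x. ennreal (g x) \<partial>law p) \<le> ennreal (exp (affinity p b - 1))"
    using exp_ge_add_one_self[of "affinity p b - 1"] by (auto intro!: ennreal_leI)
  define K where "K = exp (n * (affinity p b - 1) + s)"
  define E where "E = {xs \<in> space (sample p n). K \<le> (\<Prod>i<n. g (xs i))}"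
  have gm: "g \<in> borel_measurable (law p)" by (simp add: law_def)
  have g0: "0 \<le> g x" for x by (simp add: g_def)
  have "exp (affinity p b - 1) ^ n / K = exp (- s)"
    by (simp add: K_def exp_of_nat_mult[symmetric] exp_diff[symmetric])
  then have E: "E \<in> sets (sample p n)" "measure (sample p n) E \<le> exp (- s)"
    using D.prob_prod_ge[OF gm g0 c, of K n] unfolding sample_def E_def K_def by auto
  have "AE xs in sample p n. \<forall>i<n. (0 < p (xs i) \<longrightarrow> 0 < rbar p b (xs i)) \<and> 0 < p (xs i)"
    by (rule AE_sample[OF p F2])
  then have "AE xs in sample p n. xs \<notin> E \<longrightarrow> log_ratio p n b xs \<le> n * (affinity p b - 1) + s"
    using AE_space
  proof eventually_elim
    case (elim xs)
    show ?case
    proof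
      assume "xs \<notin> E"
      then have "(\<Prod>i<n. g (xs i)) < K" using elim by (auto simp: E_def)
      have pos: "0 < g (xs i)" "g (xs i) = rbar p b (xs i) / sqrt (p (xs i))" if "i < n" for i
        using elim that by (auto simp: g_def)
      have "log_ratio p n b xs = (\<Sum>i<n. ln (g (xs i)))"
        unfolding log_ratio_def using pos by (intro sum.cong) auto
      also have "\<dots> = ln (\<Prod>i<n. g (xs i))" using pos(1) by (subst ln_prod) (auto dest: pos(1))
      also have "\<dots> \<le> ln K" using \<open>(\<Prod>i<n. g (xs i)) < K\<close> pos(1) by (intro ln_mono) (auto intro!: prod_pos simp del: pos(2))
      finally show "log_ratio p n b xs \<le> n * (affinity p b - 1) + s" by (simp add: K_def)
    qed
  qed
  then show ?thesis using E by blast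
qed

end

lemma (in prob_space) prob_UN_le:
  assumes "finite T" "\<And>x. x \<in> T \<Longrightarrow> E x \<in> sets M" "\<And>x. x \<in> T \<Longrightarrow> prob (E x) \<le> e"
    "real (card T) \<le> N" "0 \<le> e"
  shows "prob (\<Union>x\<in>T. E x) \<le> N * e"
proof -
  have "prob (\<Union>x\<in>T. E x) \<le> (\<Sum>x\<in>T. prob (E x))"
    using assms by (intro finite_measure_subadditive_finite) auto
  also have "\<dots> \<le> (\<Sum>x\<in>T. e)" using assms by (intro sum_mono) auto
  also have "\<dots> \<le> N * e" using assms by (simp add: mult_right_mono)
  finally show ?thesis .
qed

lemma (in prob_space) prob_Un_le:
  assumes "A \<in> sets M" "B \<in> sets M" "prob A \<le> a" "prob B \<le> b"
  shows "prob (A \<union> B) \<le> a + b"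
proof -
  have "prob (A \<union> B) \<le> prob A + prob B"
    using assms by (intro measure_subadditive) auto
  then show ?thesis using assms by simp
qed

section \<open>Chaining over the tree of refinements\<close>

context density_class
begin

abbreviation shrink :: real where "shrink \<equiv> 965 / 1000"

text \<open>Induction on the number \<open>m\<close> of remaining levels below a piece of level
  \<open>i\<close>. The affinities of consecutive upper ends cancel, so only those of the start and
  of the final density survive. The union over at most \<open>N\<close> children at each level
  produces the factor \<open>N ^ (j + 1)\<close>.\<close>

lemma chain:
  fixes t :: "nat \<Rightarrow> real"
  assumes p: "p \<in> P" and V0: "0 < V0" "V0 \<le> 1000" and t: "\<And>j. 0 \<le> t j" and n: "0 < n" and r: "0 \<le> r"
    and N: "\<And>j. j < L \<Longrightarrow> parts (V0 * shrink ^ j) \<le> N"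
  shows "i + m = L \<Longrightarrow> piece (V0 * shrink ^ i) a b \<Longrightarrow> \<exists>E\<in>sets (sample p n).
    measure (sample p n) E \<le>
      (\<Sum>j<m. N ^ (j + 1) * exp (- ((t (i + j))\<^sup>2) / (2 * real n * (V0 * shrink ^ (i + j))))) \<and>
    (AE xs in sample p n. xs \<notin> E \<longrightarrow> (\<forall>q\<in>between a b. radius2 p q \<le> 4 * r\<^sup>2 \<longrightarrow>
       log_ratio p n q xs \<le> log_ratio p n b xs - n * (affinity p b - affinity p q)
         + (\<Sum>j<m. t (i + j) + n * (sqrt (V0 * shrink ^ (i + j)) * (sqrt (V0 * shrink ^ (i + j)) + 2 * r)))
         + n * sqrt (V0 * shrink ^ (i + m))))"
proof (induction m arbitrary: i a b)
  case 0
  show ?case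
    by (rule bexI[of _ "{}"]) (use leaf_bound[OF p 0(2), of n] in \<open>auto elim: eventually_mono\<close>)
next
  case (Suc m)
  interpret S: prob_space "sample p n" by (rule prob_space_sample[OF p])
  define V where "V = V0 * shrink ^ i"
  have "V \<le> V0 * 1" unfolding V_def using V0 by (intro mult_left_mono power_le_one) auto
  moreover have "0 < V" using V0 by (simp add: V_def)
  ultimately have V: "0 < V" "V \<le> 1000" using V0 by linarith+
  have N': "parts V \<le> N" unfolding V_def using Suc.prems by (intro N) simp
  have N1: "1 \<le> N" using parts_ge_1[OF V] N' by simp
  obtain T where T: "finite T" "real (card T) \<le> parts V" "between a b \<subseteq> (\<Union>(a', b')\<in>T. between a' b')"
    "\<And>a' b'. (a', b') \<in> T \<Longrightarrow> piece (shrink * V) a' b' \<and> (\<forall>x. a x \<le> a' x) \<and> (\<forall>x. b' x \<le> b x)"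
    using refine[OF Suc.prems(2)[folded V_def] V] by blast
  \<comment> \<open>Children that miss the ball are dropped: they contain no density for which
    anything is claimed, and \<open>edge_deviation\<close> needs such a member.\<close>
  define T' where "T' = {ab \<in> T. \<exists>q\<in>between (fst ab) (snd ab). radius2 p q \<le> 4 * r\<^sup>2}"
  define e where "e = exp (- ((t i)\<^sup>2) / (2 * real n * V))"
  define d where "d = (\<Sum>j<m. N ^ (j + 1) * exp (- ((t (Suc i + j))\<^sup>2) / (2 * real n * (V0 * shrink ^ (Suc i + j)))))"
  define w where "w = (\<Sum>j<m. t (Suc i + j) + n * (sqrt (V0 * shrink ^ (Suc i + j)) * (sqrt (V0 * shrink ^ (Suc i + j)) + 2 * r)))"
  define w0 where "w0 = t i + n * (sqrt V * (sqrt V + 2 * r))"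
  have T': "finite T'" "real (card T') \<le> N"
  proof -
    have "card T' \<le> card T" using T(1) by (intro card_mono) (auto simp: T'_def)
    then show "real (card T') \<le> N" using T(2) N' by simp
  qed (use T(1) in \<open>auto simp: T'_def\<close>)
  have ex: "\<exists>E\<in>sets (sample p n). S.prob E \<le> e + d \<and>
    (AE xs in sample p n. xs \<notin> E \<longrightarrow> (\<forall>q\<in>between (fst ab) (snd ab). radius2 p q \<le> 4 * r\<^sup>2 \<longrightarrow>
       log_ratio p n q xs \<le> log_ratio p n b xs - n * (affinity p b - affinity p q)
         + (w0 + w) + n * sqrt (V0 * shrink ^ (i + Suc m))))" if ab: "ab \<in> T'" for ab
  proof -
    obtain a' b' where ab_eq: "ab = (a', b')" by force
    obtain q where q: "q \<in> between a' b'" "radius2 p q \<le> 4 * r\<^sup>2" using ab by (auto simp: T'_def ab_eq)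
    have mem: "(a', b') \<in> T" using ab by (auto simp: T'_def ab_eq)
    have pc: "piece (V0 * shrink ^ Suc i) a' b'" using T(4)[OF mem] by (simp add: V_def mult_ac)
    have "\<exists>E\<in>sets (sample p n). measure (sample p n) E \<le> exp (- ((t i)\<^sup>2) / (2 * real n * V)) \<and>
      (AE xs in sample p n. xs \<notin> E \<longrightarrow> log_ratio p n b' xs \<le> log_ratio p n b xs
       - n * (affinity p b - affinity p b') + (t i + n * (sqrt V * (sqrt V + 2 * r))))"
      by (rule edge_deviation[OF p Suc.prems(2)[folded V_def] pc _ _ q V(1) t n r])
        (use T(4)[OF mem] in auto)
    then obtain E1 where E1: "E1 \<in> sets (sample p n)" "S.prob E1 \<le> e"
      "AE xs in sample p n. xs \<notin> E1 \<longrightarrow> log_ratio p n b' xs \<le> log_ratio p n b xs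
         - n * (affinity p b - affinity p b') + w0"
      unfolding e_def w0_def by blast
    have sL: "Suc i + m = L" using Suc.prems(1) by simp
    obtain E2 where E2: "E2 \<in> sets (sample p n)" "S.prob E2 \<le> d"
      "AE xs in sample p n. xs \<notin> E2 \<longrightarrow> (\<forall>q\<in>between a' b'. radius2 p q \<le> 4 * r\<^sup>2 \<longrightarrow>
       log_ratio p n q xs \<le> log_ratio p n b' xs - n * (affinity p b' - affinity p q)
         + w + n * sqrt (V0 * shrink ^ (Suc i + m)))"
      using Suc.IH[OF sL pc, folded d_def w_def] by blast
    have "AE xs in sample p n. xs \<notin> E1 \<union> E2 \<longrightarrow> (\<forall>q\<in>between a' b'. radius2 p q \<le> 4 * r\<^sup>2 \<longrightarrow>
       log_ratio p n q xs \<le> log_ratio p n b xs - n * (affinity p b - affinity p q)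
         + (w0 + w) + n * sqrt (V0 * shrink ^ (i + Suc m)))"
      using E1(3) E2(3)
    proof eventually_elim
      case (elim xs)
      show ?case
      proof (intro impI ballI)
        fix q assume "xs \<notin> E1 \<union> E2" and q: "q \<in> between a' b'" "radius2 p q \<le> 4 * r\<^sup>2"
        then have "log_ratio p n b' xs \<le> log_ratio p n b xs - n * (affinity p b - affinity p b') + w0"
          "log_ratio p n q xs \<le> log_ratio p n b' xs - n * (affinity p b' - affinity p q)
             + w + n * sqrt (V0 * shrink ^ (i + Suc m))"
          using elim by auto
        then show "log_ratio p n q xs \<le> log_ratio p n b xs - n * (affinity p b - affinity p q)
         + (w0 + w) + n * sqrt (V0 * shrink ^ (i + Suc m))"
          unfolding right_diff_distrib by linarith
      qed
    qed
    moreover have "S.prob (E1 \<union> E2) \<le> e + d"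
      by (rule S.prob_Un_le[OF E1(1) E2(1) E1(2) E2(2)])
    ultimately show ?thesis using E1(1) E2(1) unfolding ab_eq fst_conv snd_conv by (intro bexI[of _ "E1 \<union> E2"]) auto
  qed
  then have "\<forall>ab\<in>T'. \<exists>E. E \<in> sets (sample p n) \<and> S.prob E \<le> e + d \<and>
    (AE xs in sample p n. xs \<notin> E \<longrightarrow> (\<forall>q\<in>between (fst ab) (snd ab). radius2 p q \<le> 4 * r\<^sup>2 \<longrightarrow>
       log_ratio p n q xs \<le> log_ratio p n b xs - n * (affinity p b - affinity p q)
         + (w0 + w) + n * sqrt (V0 * shrink ^ (i + Suc m))))"
    by blast
  from bchoice[OF this] obtain E where E0: "\<forall>ab\<in>T'. E ab \<in> sets (sample p n) \<and> S.prob (E ab) \<le> e + d \<and>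
    (AE xs in sample p n. xs \<notin> E ab \<longrightarrow> (\<forall>q\<in>between (fst ab) (snd ab). radius2 p q \<le> 4 * r\<^sup>2 \<longrightarrow>
       log_ratio p n q xs \<le> log_ratio p n b xs - n * (affinity p b - affinity p q)
         + (w0 + w) + n * sqrt (V0 * shrink ^ (i + Suc m))))"
    by (rule exE)
  note E = E0[THEN bspec, THEN conjunct1]
    E0[THEN bspec, THEN conjunct2, THEN conjunct1]
    E0[THEN bspec, THEN conjunct2, THEN conjunct2]
  have d0: "0 \<le> e + d" unfolding e_def d_def using N1 by (intro add_nonneg_nonneg sum_nonneg mult_nonneg_nonneg) auto
  \<comment> \<open>Splitting off level \<open>i\<close> leaves the sum of the children multiplied
    by one more factor \<open>N\<close>.\<close>
  have sum_d: "(\<Sum>j<Suc m. N ^ (j + 1) * exp (- ((t (i + j))\<^sup>2) / (2 * real n * (V0 * shrink ^ (i + j))))) = N * (e + d)"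
    unfolding sum.lessThan_Suc_shift e_def d_def V_def by (simp add: sum_distrib_left distrib_left mult.assoc)
  have sum_w: "(\<Sum>j<Suc m. t (i + j) + n * (sqrt (V0 * shrink ^ (i + j)) * (sqrt (V0 * shrink ^ (i + j)) + 2 * r))) = w0 + w"
    unfolding sum.lessThan_Suc_shift w0_def w_def V_def by simp
  have "AE xs in sample p n. \<forall>ab\<in>T'. xs \<notin> E ab \<longrightarrow> (\<forall>q\<in>between (fst ab) (snd ab). radius2 p q \<le> 4 * r\<^sup>2 \<longrightarrow>
       log_ratio p n q xs \<le> log_ratio p n b xs - n * (affinity p b - affinity p q)
         + (w0 + w) + n * sqrt (V0 * shrink ^ (i + Suc m)))"
    by (intro AE_finite_allI T'(1) E(3))
  then have "AE xs in sample p n. xs \<notin> (\<Union>ab\<in>T'. E ab) \<longrightarrow> (\<forall>q\<in>between a b. radius2 p q \<le> 4 * r\<^sup>2 \<longrightarrow>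
       log_ratio p n q xs \<le> log_ratio p n b xs - n * (affinity p b - affinity p q)
         + (w0 + w) + n * sqrt (V0 * shrink ^ (i + Suc m)))"
  proof eventually_elim
    case (elim xs)
    show ?case
    proof (intro impI ballI)
      fix q assume xs: "xs \<notin> (\<Union>ab\<in>T'. E ab)" and q: "q \<in> between a b" "radius2 p q \<le> 4 * r\<^sup>2"
      obtain ab where "ab \<in> T" "q \<in> between (fst ab) (snd ab)" using T(3) q(1) by (auto simp: case_prod_beta')
      moreover from this q(2) have "ab \<in> T'" by (auto simp: T'_def)
      ultimately show "log_ratio p n q xs \<le> log_ratio p n b xs - n * (affinity p b - affinity p q)
         + (w0 + w) + n * sqrt (V0 * shrink ^ (i + Suc m))"
        using elim xs q(2) by blast
    qed
  qed
  moreover have "S.prob (\<Union>ab\<in>T'. E ab) \<le> N * (e + d)"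
    by (intro S.prob_UN_le T' E d0)
  moreover have "(\<Union>ab\<in>T'. E ab) \<in> sets (sample p n)" using T'(1) E(1) by auto
  ultimately show ?case unfolding sum_d sum_w by blast
qed

text \<open>A preparatory cover, without any statement on the likelihood: the chain must start from
  brackets whose width is a small fraction of \<open>r\<close>, and a fixed number \<open>m\<close>
  of refinements achieves this at the price \<open>N ^ (m + 1)\<close>.\<close>

lemma iterated_cover:
  assumes p: "p \<in> P" and r: "0 < r" "r \<le> 2"
    and N: "parts (68 * r\<^sup>2) \<le> N" "\<And>j. j < m \<Longrightarrow> parts (207 * r\<^sup>2 * shrink ^ j) \<le> N"
  shows "\<exists>T. finite T \<and> real (card T) \<le> N ^ (m + 1) \<and> (\<forall>(a, b)\<in>T. piece (207 * r\<^sup>2 * shrink ^ m) a b) \<and>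
    {q \<in> P. radius2 p q \<le> 4 * r\<^sup>2} \<subseteq> (\<Union>(a, b)\<in>T. between a b)"
  using N(2)
proof (induction m)
  case 0
  show ?case using initial_cover[OF p r] N(1) unfolding radius2_def rbar_def
    by (elim exE conjE) (rule exI, auto)
next
  case (Suc m)
  obtain T where T: "finite T" "real (card T) \<le> N ^ (m + 1)"
      "\<And>ab. ab \<in> T \<Longrightarrow> piece (207 * r\<^sup>2 * shrink ^ m) (fst ab) (snd ab)"
      "{q \<in> P. radius2 p q \<le> 4 * r\<^sup>2} \<subseteq> (\<Union>(a, b)\<in>T. between a b)"
    using Suc by (auto simp: case_prod_beta')
  define V where "V = 207 * r\<^sup>2 * shrink ^ m"
  have r2: "r\<^sup>2 \<le> 4" using power_mono[of r 2 2] r by simp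
  have "V \<le> 207 * r\<^sup>2 * 1" unfolding V_def by (intro mult_left_mono power_le_one) auto
  moreover have "0 < V" using r by (simp add: V_def)
  ultimately have V: "0 < V" "V \<le> 1000" using r2 by linarith+
  have "\<exists>T'. finite T' \<and> real (card T') \<le> N \<and> between (fst ab) (snd ab) \<subseteq> (\<Union>(a', b')\<in>T'. between a' b') \<and>
    (\<forall>(a', b')\<in>T'. piece (207 * r\<^sup>2 * shrink ^ Suc m) a' b')" if ab: "ab \<in> T" for ab
  proof -
    obtain T' where "finite T'" "real (card T') \<le> parts V" "between (fst ab) (snd ab) \<subseteq> (\<Union>(a', b')\<in>T'. between a' b')"
      "\<forall>(a', b')\<in>T'. piece (shrink * V) a' b' \<and> (\<forall>x. fst ab x \<le> a' x) \<and> (\<forall>x. b' x \<le> snd ab x)"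
      using refine[OF T(3)[OF ab, folded V_def] V] by blast
    moreover have "parts V \<le> N" unfolding V_def by (rule Suc.prems) simp
    moreover have "shrink * V = 207 * r\<^sup>2 * shrink ^ Suc m" by (simp add: V_def)
    ultimately show ?thesis by (intro exI[of _ T']) auto
  qed
  then have "\<forall>ab\<in>T. \<exists>T'. finite T' \<and> real (card T') \<le> N \<and> between (fst ab) (snd ab) \<subseteq> (\<Union>(a', b')\<in>T'. between a' b') \<and>
    (\<forall>(a', b')\<in>T'. piece (207 * r\<^sup>2 * shrink ^ Suc m) a' b')"
    by blast
  from bchoice[OF this] obtain C where C0: "\<forall>ab\<in>T. finite (C ab) \<and> real (card (C ab)) \<le> N \<and> between (fst ab) (snd ab) \<subseteq> (\<Union>(a', b')\<in>C ab. between a' b') \<and>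
    (\<forall>(a', b')\<in>C ab. piece (207 * r\<^sup>2 * shrink ^ Suc m) a' b')"
    by (rule exE)
  note C = C0[THEN bspec, THEN conjunct1]
    C0[THEN bspec, THEN conjunct2, THEN conjunct1]
    C0[THEN bspec, THEN conjunct2, THEN conjunct2, THEN conjunct1]
    C0[THEN bspec, THEN conjunct2, THEN conjunct2, THEN conjunct2]
  have N0: "0 \<le> N" using parts_ge_1[OF V] Suc.prems[of m] by (simp add: V_def)
  have "real (card (\<Union>ab\<in>T. C ab)) \<le> real (\<Sum>ab\<in>T. card (C ab))"
    by (intro of_nat_mono card_UN_le T(1))
  also have "\<dots> \<le> (\<Sum>ab\<in>T. N)" unfolding of_nat_sum by (intro sum_mono C(2))
  also have "\<dots> \<le> N ^ (m + 1) * N" using T(2) N0 by (simp add: mult_right_mono)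
  finally have card: "real (card (\<Union>ab\<in>T. C ab)) \<le> N ^ (Suc m + 1)" by (simp add: mult_ac)
  have cov: "{q \<in> P. radius2 p q \<le> 4 * r\<^sup>2} \<subseteq> (\<Union>(a, b)\<in>(\<Union>ab\<in>T. C ab). between a b)"
  proof
    fix q assume "q \<in> {q \<in> P. radius2 p q \<le> 4 * r\<^sup>2}"
    then obtain ab where ab: "ab \<in> T" "q \<in> between (fst ab) (snd ab)" using T(4) by (auto simp: case_prod_beta')
    then obtain ab' where "ab' \<in> C ab" "q \<in> between (fst ab') (snd ab')" using C(3)[OF ab(1)] by (auto simp: case_prod_beta')
    then show "q \<in> (\<Union>(a, b)\<in>(\<Union>ab\<in>T. C ab). between a b)" using ab(1) by (auto simp: case_prod_beta')
  qed
  show ?case using card cov T(1) C(1,4) by (intro exI[of _ "\<Union>ab\<in>T. C ab"]) auto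
qed

text \<open>The root bound for each starting bracket, followed by the chain below it. The affinity
  of the upper end cancels, leaving \<open>n * (affinity p q - 1)\<close> as the drift.\<close>

lemma shell_bound:
  fixes t :: "nat \<Rightarrow> real"
  assumes p: "p \<in> P" and r: "0 < r" "r \<le> 2" and t: "\<And>j. 0 \<le> t j" and n: "0 < n"
    and N: "parts (68 * r\<^sup>2) \<le> N" "\<And>j. j < m + L \<Longrightarrow> parts (207 * r\<^sup>2 * shrink ^ j) \<le> N"
    and V: "V = 207 * r\<^sup>2 * shrink ^ m"
  shows "\<exists>E\<in>sets (sample p n).
    measure (sample p n) E \<le> N ^ (m + 1) * (exp (- s) +
      (\<Sum>j<L. N ^ (j + 1) * exp (- ((t j)\<^sup>2) / (2 * real n * (V * shrink ^ j))))) \<and>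
    (AE xs in sample p n. xs \<notin> E \<longrightarrow> (\<forall>q\<in>P. radius2 p q \<le> 4 * r\<^sup>2 \<longrightarrow>
       log_ratio p n q xs \<le> n * (affinity p q - 1) + s
         + (\<Sum>j<L. t j + n * (sqrt (V * shrink ^ j) * (sqrt (V * shrink ^ j) + 2 * r)))
         + n * sqrt (V * shrink ^ L)))"
proof -
  interpret S: prob_space "sample p n" by (rule prob_space_sample[OF p])
  obtain T where T: "finite T" "real (card T) \<le> N ^ (m + 1)"
      "\<And>ab. ab \<in> T \<Longrightarrow> piece V (fst ab) (snd ab)"
      "{q \<in> P. radius2 p q \<le> 4 * r\<^sup>2} \<subseteq> (\<Union>(a, b)\<in>T. between a b)"
    using iterated_cover[OF p r N(1), of m] N(2) unfolding V by (auto simp: case_prod_beta')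
  have r2: "r\<^sup>2 \<le> 4" using power_mono[of r 2 2] r by simp
  have "V \<le> 207 * r\<^sup>2 * 1" unfolding V by (intro mult_left_mono power_le_one) auto
  moreover have "0 < V" using r by (simp add: V)
  ultimately have V': "0 < V" "V \<le> 1000" using r2 by linarith+
  have NV: "parts (V * shrink ^ j) \<le> N" if "j < L" for j
    using N(2)[of "m + j"] that by (simp add: V power_add mult.assoc)
  have "1 \<le> parts (68 * r\<^sup>2)" using r r2 by (intro parts_ge_1) auto
  then have N1: "1 \<le> N" using N(1) by simp
  define T' where "T' = {ab \<in> T. between (fst ab) (snd ab) \<noteq> {}}"
  define d where "d = (\<Sum>j<L. N ^ (j + 1) * exp (- ((t j)\<^sup>2) / (2 * real n * (V * shrink ^ j))))"
  define w where "w = (\<Sum>j<L. t j + n * (sqrt (V * shrink ^ j) * (sqrt (V * shrink ^ j) + 2 * r)))"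
  have T': "finite T'" "real (card T') \<le> N ^ (m + 1)"
  proof -
    have "card T' \<le> card T" using T(1) by (intro card_mono) (auto simp: T'_def)
    then show "real (card T') \<le> N ^ (m + 1)" using T(2) by simp
  qed (use T(1) in \<open>auto simp: T'_def\<close>)
  have "\<exists>E\<in>sets (sample p n). S.prob E \<le> exp (- s) + d \<and>
    (AE xs in sample p n. xs \<notin> E \<longrightarrow> (\<forall>q\<in>between (fst ab) (snd ab). radius2 p q \<le> 4 * r\<^sup>2 \<longrightarrow>
       log_ratio p n q xs \<le> n * (affinity p q - 1) + s + w + n * sqrt (V * shrink ^ L)))" if ab: "ab \<in> T'" for ab
  proof -
    let ?b = "snd ab"
    have pc: "piece V (fst ab) ?b" using ab T(3) by (simp add: T'_def)
    obtain q where "q \<in> between (fst ab) ?b" using ab by (auto simp: T'_def)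
    from root_bound[OF p pc this, of n s]
    obtain E1 where E1: "E1 \<in> sets (sample p n)" "S.prob E1 \<le> exp (- s)"
      "AE xs in sample p n. xs \<notin> E1 \<longrightarrow> log_ratio p n ?b xs \<le> n * (affinity p ?b - 1) + s"
      by blast
    have pc0: "piece (V * shrink ^ 0) (fst ab) ?b" using pc by simp
    note chain0 = chain[where i = 0 and m = L and L = L and t = t, OF p V' t n less_imp_le[OF r(1)] NV add_0 pc0,
        unfolded add_0, folded d_def w_def]
    obtain E2 where E2: "E2 \<in> sets (sample p n)" "S.prob E2 \<le> d"
      "AE xs in sample p n. xs \<notin> E2 \<longrightarrow> (\<forall>q\<in>between (fst ab) ?b. radius2 p q \<le> 4 * r\<^sup>2 \<longrightarrow>
       log_ratio p n q xs \<le> log_ratio p n ?b xs - n * (affinity p ?b - affinity p q)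
         + w + n * sqrt (V * shrink ^ L))"
      using chain0 by blast
    have "AE xs in sample p n. xs \<notin> E1 \<union> E2 \<longrightarrow> (\<forall>q\<in>between (fst ab) ?b. radius2 p q \<le> 4 * r\<^sup>2 \<longrightarrow>
       log_ratio p n q xs \<le> n * (affinity p q - 1) + s + w + n * sqrt (V * shrink ^ L))"
      using E1(3) E2(3)
    proof eventually_elim
      case (elim xs)
      show ?case
      proof (intro impI ballI)
        fix q assume "xs \<notin> E1 \<union> E2" and q: "q \<in> between (fst ab) ?b" "radius2 p q \<le> 4 * r\<^sup>2"
        then have "log_ratio p n ?b xs \<le> n * (affinity p ?b - 1) + s"
          "log_ratio p n q xs \<le> log_ratio p n ?b xs - n * (affinity p ?b - affinity p q)
             + w + n * sqrt (V * shrink ^ L)"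
          using elim by auto
        then show "log_ratio p n q xs \<le> n * (affinity p q - 1) + s + w + n * sqrt (V * shrink ^ L)"
          unfolding right_diff_distrib by linarith
      qed
    qed
    moreover have "S.prob (E1 \<union> E2) \<le> exp (- s) + d"
      by (rule S.prob_Un_le[OF E1(1) E2(1) E1(2) E2(2)])
    ultimately show ?thesis using E1(1) E2(1) by (intro bexI[of _ "E1 \<union> E2"]) auto
  qed
  then have "\<forall>ab\<in>T'. \<exists>E. E \<in> sets (sample p n) \<and> S.prob E \<le> exp (- s) + d \<and>
    (AE xs in sample p n. xs \<notin> E \<longrightarrow> (\<forall>q\<in>between (fst ab) (snd ab). radius2 p q \<le> 4 * r\<^sup>2 \<longrightarrow>
       log_ratio p n q xs \<le> n * (affinity p q - 1) + s + w + n * sqrt (V * shrink ^ L)))"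
    by blast
  from bchoice[OF this] obtain E where E0: "\<forall>ab\<in>T'. E ab \<in> sets (sample p n) \<and> S.prob (E ab) \<le> exp (- s) + d \<and>
    (AE xs in sample p n. xs \<notin> E ab \<longrightarrow> (\<forall>q\<in>between (fst ab) (snd ab). radius2 p q \<le> 4 * r\<^sup>2 \<longrightarrow>
       log_ratio p n q xs \<le> n * (affinity p q - 1) + s + w + n * sqrt (V * shrink ^ L)))"
    by (rule exE)
  note E = E0[THEN bspec, THEN conjunct1]
    E0[THEN bspec, THEN conjunct2, THEN conjunct1]
    E0[THEN bspec, THEN conjunct2, THEN conjunct2]
  have d0: "0 \<le> exp (- s) + d" unfolding d_def using N1 by (intro add_nonneg_nonneg sum_nonneg mult_nonneg_nonneg) auto
  have "AE xs in sample p n. \<forall>ab\<in>T'. xs \<notin> E ab \<longrightarrow> (\<forall>q\<in>between (fst ab) (snd ab). radius2 p q \<le> 4 * r\<^sup>2 \<longrightarrow>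
       log_ratio p n q xs \<le> n * (affinity p q - 1) + s + w + n * sqrt (V * shrink ^ L))"
    by (intro AE_finite_allI T'(1) E(3))
  then have "AE xs in sample p n. xs \<notin> (\<Union>ab\<in>T'. E ab) \<longrightarrow> (\<forall>q\<in>P. radius2 p q \<le> 4 * r\<^sup>2 \<longrightarrow>
       log_ratio p n q xs \<le> n * (affinity p q - 1) + s + w + n * sqrt (V * shrink ^ L))"
  proof eventually_elim
    case (elim xs)
    show ?case
    proof (intro impI ballI)
      fix q assume xs: "xs \<notin> (\<Union>ab\<in>T'. E ab)" and q: "q \<in> P" "radius2 p q \<le> 4 * r\<^sup>2"
      obtain ab where "ab \<in> T" "q \<in> between (fst ab) (snd ab)" using T(4) q by (auto simp: case_prod_beta')
      moreover from this have "ab \<in> T'" by (auto simp: T'_def)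
      ultimately show "log_ratio p n q xs \<le> n * (affinity p q - 1) + s + w + n * sqrt (V * shrink ^ L)"
        using elim xs q(2) by blast
    qed
  qed
  moreover have "S.prob (\<Union>ab\<in>T'. E ab) \<le> N ^ (m + 1) * (exp (- s) + d)"
    by (intro S.prob_UN_le T' E d0)
  moreover have "(\<Union>ab\<in>T'. E ab) \<in> sets (sample p n)" using T'(1) E(1) by auto
  ultimately show ?thesis unfolding d_def w_def by blast
qed

text \<open>Expanding the square, with both densities of integral 1. It turns the drift of the log
  ratio into \<open>- n * radius2 p q / 2\<close>.\<close>

lemma affinity_eq:
  assumes "p \<in> P" "q \<in> P"
  shows "affinity p q = 1 - radius2 p q / 2"
proof -
  have sq: "square_integrable \<nu> (rbar p q)" using sqrt_bar[OF assms(2,1)] unfolding rbar_def .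
  have "radius2 p q = (\<integral>x. (q x + p x) / 2 - 2 * (rbar p q x * sqrt (p x)) + p x \<partial>\<nu>)"
    unfolding radius2_def
    by (intro Bochner_Integration.integral_cong refl)
      (simp add: power2_diff rbar_def dens_nonneg assms)
  also have "\<dots> = (1 + 1) / 2 - 2 * affinity p q + 1"
    using integrable_dens[OF assms(1)] integrable_dens[OF assms(2)] integral_dens[OF assms(1)] integral_dens[OF assms(2)]
      square_integrable_mult[OF sq sqrt_dens[OF assms(1)]]
    by (simp add: affinity_def)
  finally show ?thesis by (simp add: field_simps)
qed

end

section \<open>The rate of the likelihood estimator\<close>

lemma sum_geometric_le:
  fixes s :: real
  assumes "0 \<le> s" "s < 1"
  shows "(\<Sum>j<L. s ^ j) \<le> 1 / (1 - s)"
  using assms by (simp add: sum_gp_strict divide_right_mono)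

lemma sum_arith_geometric_le:
  fixes s :: real
  assumes "0 \<le> s" "s < 1"
  shows "(\<Sum>j<L. (real j + 1) * s ^ j) \<le> 1 / (1 - s)\<^sup>2"
proof -
  have "(1 - s) * (\<Sum>j<L. (real j + 1) * s ^ j) = (\<Sum>j<L. s ^ j) - L * s ^ L"
  proof (induction L)
    case (Suc L)
    show ?case unfolding sum.lessThan_Suc distrib_left Suc.IH by (simp add: algebra_simps)
  qed simp
  also have "\<dots> \<le> 1 / (1 - s)" 
  proof -
    have "0 \<le> real L * s ^ L" using assms by simp
    then show ?thesis using sum_geometric_le[OF assms, of L] by linarith
  qed
  finally have "(\<Sum>j<L. (real j + 1) * s ^ j) \<le> 1 / (1 - s) / (1 - s)"
    using assms by (subst pos_le_divide_eq) (auto simp: mult.commute)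
  then show ?thesis by (simp add: power2_eq_square)
qed

context density_class
begin

lemma radius2_le_2: "p \<in> P \<Longrightarrow> q \<in> P \<Longrightarrow> radius2 p q \<le> 2"
proof -
  assume pq: "p \<in> P" "q \<in> P"
  have "0 \<le> affinity p q"
    unfolding affinity_def using pq dens_nonneg by (intro integral_nonneg_AE AE_I2) (auto simp: rbar_def)
  then show ?thesis using affinity_eq[OF pq] by simp
qed

text \<open>The shell with squared radius between \<open>r\<^sup>2\<close> and
  \<open>4 * r\<^sup>2\<close> has drift below \<open>- n * r\<^sup>2 / 2\<close>. The constants are
  arranged so that four errors, namely \<open>s\<close>, the deviations, the second-order terms and
  the leaf term, are each at most \<open>n * r\<^sup>2 / 10\<close>.\<close>

lemma shell_rate:
  assumes p: "p \<in> P"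
  shows "\<exists>C0\<ge>2. \<forall>n\<ge>2. \<forall>r. C0 * sqrt (ln (real n) / real n) \<le> r \<longrightarrow> r \<le> 2 \<longrightarrow>
    (\<exists>E\<in>sets (sample p n). measure (sample p n) E \<le> 3 / real n ^ 3 \<and>
      (AE xs in sample p n. xs \<notin> E \<longrightarrow>
        (\<forall>q\<in>P. r\<^sup>2 < radius2 p q \<longrightarrow> radius2 p q \<le> 4 * r\<^sup>2 \<longrightarrow> log_ratio p n q xs < 0)))"
proof -
  \<comment> \<open>After \<open>m\<close> refinements \<open>sqrt V \<le> r / 2000\<close>. The
    2000 makes the second-order terms fit: with \<open>\<sigma> = 0.983\<close> they sum to at most
    \<open>3 / 2000 / (1 - \<sigma>) * r\<^sup>2\<close>, less than
    \<open>r\<^sup>2 / 10\<close>.\<close>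
  obtain m where m: "shrink ^ m < 1 / (207 * 2000\<^sup>2)"
    using real_arch_pow_inv[of "1 / (207 * 2000\<^sup>2)" shrink] by auto
  \<comment> \<open>All widths that are refined, and the initial one, are at least
    \<open>\<kappa> * r ^ 4\<close>: 1/100 serves the levels of the chain, and
    \<open>50 * shrink ^ m\<close> the preparatory levels, as
    \<open>r ^ 4 \<le> 4 * r\<^sup>2\<close>.\<close>
  define \<kappa> where "\<kappa> = min (1 / 100) (50 * shrink ^ m)"
  have \<kappa>: "0 < \<kappa>" "\<kappa> \<le> 1 / 100" "\<kappa> \<le> 50 * shrink ^ m" by (auto simp: \<kappa>_def)
  \<comment> \<open>The factor \<open>17 * A / \<kappa>\<close> is absorbed into
    \<open>n ^ K'\<close>, using \<open>n \<ge> 2\<close>, so that the count of one refinement is at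
    most \<open>n\<close> to the power \<open>K\<close>.\<close>
  obtain K' where K': "17 * A / \<kappa> < 2 ^ K'" using real_arch_pow[of 2 "17 * A / \<kappa>"] by auto
  define K where "K = A * (real K' + 2)"
  have K0: "0 \<le> K" using A_ge by (simp add: K_def)
  \<comment> \<open>Chosen for \<open>K * (m + 1) + K * (j + 1) \<le> (j + 1) * (Q - 3)\<close>:
    after all counts are paid, level \<open>j\<close> still has probability at most \<open>n\<close>
    to the power \<open>-3 * (j + 1)\<close>.\<close>
  define Q where "Q = K * (real m + 2) + 3"
  have Q: "3 \<le> Q" using K0 by (simp add: Q_def)
  \<comment> \<open>Here 18 is \<open>10 * 3600 / 2000\<close>, where 3600 bounds
    \<open>1 / (1 - \<sigma>)\<^sup>2\<close>; this is what brings the summed deviations below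
    \<open>n * r\<^sup>2 / 10\<close>.\<close>
  define C0 where "C0 = 18 * sqrt (2 * Q)"
  have "1 \<le> sqrt (2 * Q)" using Q by simp
  then have C0: "18 \<le> C0" by (simp add: C0_def)
  \<comment> \<open>A rational number slightly above \<open>sqrt 0.965\<close>, the ratio of the
    widths of successive levels.\<close>
  define \<sigma> :: real where "\<sigma> = 983 / 1000"
  have sqrt_shrink: "sqrt (shrink ^ j) \<le> \<sigma> ^ j" for j
  proof -
    have "sqrt shrink \<le> \<sigma>" by (rule real_le_lsqrt) (auto simp: \<sigma>_def power2_eq_square)
    then have "sqrt shrink ^ j \<le> \<sigma> ^ j" by (intro power_mono) auto
    then show ?thesis by (simp only: real_sqrt_power)
  qed
  show ?thesis
  proof (rule exI[of _ C0], intro conjI allI impI)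
    show "2 \<le> C0" using C0 by simp
    fix n :: nat and r :: real
    assume n: "2 \<le> n" and r0: "C0 * sqrt (ln (real n) / real n) \<le> r" and r2: "r \<le> 2"
    define l where "l = ln (real n)"
    have l: "0 < l" using n by (simp add: l_def)
    have ln2: "1 / 2 \<le> ln (2::real)" using ln_le_minus_one[of "1 / 2"] by (simp add: ln_div)
    have "ln 2 \<le> l" unfolding l_def using n by (intro ln_mono) auto
    then have l2: "1 / 2 \<le> l" using ln2 by linarith
    have n0: "0 < n" "(0::real) < n" using n by auto
    have q0: "0 < sqrt (l / n)" using l n0 by simp
    have r: "0 < r"
    proof -
      have "0 < C0 * sqrt (l / n)" using q0 C0 by (intro mult_pos_pos) auto
      then show ?thesis using r0 by (simp add: l_def)
    qed
    have nr: "C0\<^sup>2 * l \<le> n * r\<^sup>2"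
    proof -
      have "(C0 * sqrt (l / n))\<^sup>2 \<le> r\<^sup>2"
        using r0 C0 q0 by (intro power_mono) (auto simp: l_def)
      then show ?thesis using l n0 by (simp add: power_mult_distrib field_simps)
    qed
    \<comment> \<open>Hence \<open>r ^ 4\<close> is at least \<open>1 / n\<^sup>2\<close>, which
      makes every count polynomial in \<open>n\<close>.\<close>
    have r_ge: "1 / n \<le> r\<^sup>2"
    proof -
      have "1 \<le> 18\<^sup>2 * (1 / 2 :: real)" by simp
      also have "\<dots> \<le> C0\<^sup>2 * l" using C0 l2 by (intro mult_mono power_mono) auto
      also have "\<dots> \<le> n * r\<^sup>2" by (rule nr)
      finally show ?thesis using n0 by (simp add: field_simps)
    qed
    have rr: "r\<^sup>2 \<le> 4" using power_mono[OF r2, of 2] r by simp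
    define V where "V = 207 * r\<^sup>2 * shrink ^ m"
    have V: "0 < V" using r by (simp add: V_def)
    have Vr: "sqrt V \<le> r / 2000"
    proof (rule real_le_lsqrt)
      have "V \<le> 207 * r\<^sup>2 * (1 / (207 * 2000\<^sup>2))"
        unfolding V_def using m by (intro mult_left_mono) auto
      then show "V \<le> (r / 2000)\<^sup>2" by (simp add: power_divide)
    qed (use r in auto)
    have sqrtV: "sqrt (V * shrink ^ j) \<le> r / 2000 * \<sigma> ^ j" for j
      unfolding real_sqrt_mult using Vr sqrt_shrink[of j] r by (intro mult_mono) auto
    have "\<exists>L. V * shrink ^ L \<le> r ^ 4 / 100"
    proof -
      obtain L where "shrink ^ L < r ^ 4 / 100 / V"
        using real_arch_pow_inv[of "r ^ 4 / 100 / V" shrink] r V by auto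
      then show ?thesis using V by (intro exI[of _ L]) (simp add: field_simps)
    qed
    \<comment> \<open>The leaf error \<open>n * sqrt (V * shrink ^ L)\<close> has to be of order
      \<open>n * r\<^sup>2\<close>, so widths go down to order \<open>r ^ 4\<close>. Taking the
      least such level keeps all earlier widths above that order.\<close>
    then have "\<exists>L. V * shrink ^ L \<le> r ^ 4 / 100 \<and> (\<forall>j<L. \<not> V * shrink ^ j \<le> r ^ 4 / 100)"
      by (rule exists_least_iff[THEN iffD1])
    then obtain L where L: "V * shrink ^ L \<le> r ^ 4 / 100" "\<And>j. j < L \<Longrightarrow> r ^ 4 / 100 < V * shrink ^ j"
      by (auto simp: not_le)
    define N where "N = exp (K * l)"
    have r4: "r ^ 4 \<le> 4 * r\<^sup>2"
      using mult_right_mono[OF rr, of "r\<^sup>2"] by (simp add: power2_eq_square power4_eq_xxxx)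
    have Npart: "parts v \<le> N" if v: "\<kappa> * r ^ 4 \<le> v" for v
    proof -
      have "(1 / n)\<^sup>2 \<le> (r\<^sup>2)\<^sup>2" using r_ge n0 by (intro power_mono) auto
      then have "\<kappa> * (1 / n)\<^sup>2 \<le> \<kappa> * r ^ 4" using \<kappa> by (intro mult_left_mono) (auto simp: power_mult[symmetric])
      then have v': "\<kappa> * (1 / n)\<^sup>2 \<le> v" using v by simp
      have "parts v \<le> parts (\<kappa> * (1 / n)\<^sup>2)" using \<kappa> n0 v' by (intro parts_antimono) auto
      also have "\<dots> = (17 * A / \<kappa> * (real n)\<^sup>2) powr A" by (simp add: parts_def power_divide)
      also have "\<dots> \<le> (real n ^ (K' + 2)) powr A"
      proof (rule powr_mono2)
        have "17 * A / \<kappa> \<le> 2 ^ K'" using K' by simp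
        also have "\<dots> \<le> real n ^ K'" using n by (intro power_mono) auto
        finally have "17 * A / \<kappa> * (real n)\<^sup>2 \<le> real n ^ K' * (real n)\<^sup>2" by (intro mult_right_mono) auto
        then show "17 * A / \<kappa> * (real n)\<^sup>2 \<le> real n ^ (K' + 2)" by (simp only: power_add)
      qed (use A_ge \<kappa> in auto)
      also have "\<dots> = N"
      proof -
        have "(real n ^ (K' + 2)) powr A = exp (A * ln (real n ^ (K' + 2)))" using n0 by (simp add: powr_def)
        also have "ln (real n ^ (K' + 2)) = real (K' + 2) * l" unfolding l_def by (rule ln_realpow)
        finally show ?thesis by (simp add: N_def K_def mult_ac)
      qed
      finally show ?thesis .
    qed
    have r2pos: "0 < r\<^sup>2" using r by simp
    have N1: "parts (68 * r\<^sup>2) \<le> N"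
    proof (rule Npart)
      have "\<kappa> * r ^ 4 \<le> 1 / 100 * (4 * r\<^sup>2)" using \<kappa> r4 by (intro mult_mono) auto
      then show "\<kappa> * r ^ 4 \<le> 68 * r\<^sup>2" using r2pos by linarith
    qed
    have N2: "parts (207 * r\<^sup>2 * shrink ^ j) \<le> N" if j: "j < m + L" for j
    proof (rule Npart)
      show "\<kappa> * r ^ 4 \<le> 207 * r\<^sup>2 * shrink ^ j"
      proof (cases "j < m")
        case True
        have "\<kappa> * r ^ 4 \<le> 50 * shrink ^ m * (4 * r\<^sup>2)" using \<kappa> r4 by (intro mult_mono) auto
        also have "\<dots> \<le> 207 * r\<^sup>2 * shrink ^ m" using r2pos by simp
        also have "\<dots> \<le> 207 * r\<^sup>2 * shrink ^ j" using True r2pos by (intro mult_left_mono power_decreasing) auto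
        finally show ?thesis .
      next
        case False
        then have "shrink ^ j = shrink ^ m * shrink ^ (j - m)" by (simp add: power_add[symmetric])
        then have "207 * r\<^sup>2 * shrink ^ j = V * shrink ^ (j - m)" by (simp add: V_def)
        moreover have "r ^ 4 / 100 < V * shrink ^ (j - m)" using False j by (intro L(2)) auto
        moreover have "\<kappa> * r ^ 4 \<le> 1 / 100 * r ^ 4" using \<kappa> by (intro mult_right_mono) auto
        ultimately show ?thesis by simp
      qed
    qed
    \<comment> \<open>Inverse choice of the deviations: \<open>\<tau> j\<close> is the exponent
      wanted at level \<open>j\<close>, growing linearly to pay for the counts, and
      \<open>t j\<close> is the deviation with exactly this exponent.\<close>
    define \<tau> where "\<tau> = (\<lambda>j. (real j + 1) * (Q * l))"
    define t where "t = (\<lambda>j. sqrt (2 * n * (V * shrink ^ j) * \<tau> j))"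
    have \<tau>: "0 \<le> \<tau> j" for j using Q l by (simp add: \<tau>_def)
    have t: "0 \<le> t j" for j using \<tau>[of j] V by (simp add: t_def)
    have t2: "- ((t j)\<^sup>2) / (2 * real n * (V * shrink ^ j)) = - \<tau> j" for j
    proof -
      have "(t j)\<^sup>2 = 2 * n * (V * shrink ^ j) * \<tau> j" unfolding t_def using \<tau>[of j] V by simp
      then show ?thesis using V n0 by simp
    qed
    define s where "s = n * r\<^sup>2 / 10"
    obtain E where E: "E \<in> sets (sample p n)"
      "measure (sample p n) E \<le> N ^ (m + 1) * (exp (- s) +
        (\<Sum>j<L. N ^ (j + 1) * exp (- ((t j)\<^sup>2) / (2 * real n * (V * shrink ^ j)))))"
      "AE xs in sample p n. xs \<notin> E \<longrightarrow> (\<forall>q\<in>P. radius2 p q \<le> 4 * r\<^sup>2 \<longrightarrow>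
         log_ratio p n q xs \<le> n * (affinity p q - 1) + s
           + (\<Sum>j<L. t j + n * (sqrt (V * shrink ^ j) * (sqrt (V * shrink ^ j) + 2 * r)))
           + n * sqrt (V * shrink ^ L))"
      by (rule bexE[OF shell_bound[where s = s and L = L and t = t and m = m and N = N,
            OF p r r2 t n0(1) N1 N2 V_def]], assumption, elim conjE, rule that)
    have prob: "measure (sample p n) E \<le> 3 / real n ^ 3"
    proof -
      have x: "exp (- 3 * l) = 1 / real n ^ 3"
        using n0 exp_of_nat_mult[of 3 l] by (simp add: l_def exp_minus inverse_eq_divide)
      have "N ^ (m + 1) * exp (- s) = exp ((K * (m + 1)) * l - s)"
        by (simp add: N_def exp_of_nat_mult[symmetric] exp_add[symmetric] algebra_simps)
      also have "\<dots> \<le> exp (- 3 * l)"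
      proof -
        have "Q * l \<le> C0\<^sup>2 / 10 * l" using l Q unfolding C0_def by (intro mult_right_mono) (auto simp: power_mult_distrib)
        also have "\<dots> \<le> s" using nr by (simp add: s_def)
        finally have "Q * l \<le> s" .
        moreover have "K * (m + 1) * l + 3 * l \<le> Q * l"
          using K0 l by (simp add: Q_def algebra_simps)
        ultimately show ?thesis by simp
      qed
      finally have 1: "N ^ (m + 1) * exp (- s) \<le> 1 / real n ^ 3" unfolding x .
      have "N ^ (m + 1) * (N ^ (j + 1) * exp (- \<tau> j)) \<le> 1 / real n ^ 3 * (1 / 8) ^ j" for j
      proof -
        have "N ^ (m + 1) * (N ^ (j + 1) * exp (- \<tau> j)) = exp ((K * (m + 1) + K * (j + 1)) * l - \<tau> j)"
          by (simp add: N_def exp_of_nat_mult[symmetric] exp_add[symmetric] algebra_simps)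
        also have "\<dots> \<le> exp ((real j + 1) * (- 3 * l))"
        proof -
          have "K * (m + 1) * 1 \<le> K * (m + 1) * (real j + 1)" using K0 by (intro mult_left_mono) auto
          then have "(K * (m + 1) + K * (j + 1)) * l \<le> ((real j + 1) * (Q - 3)) * l"
            using l by (intro mult_right_mono) (auto simp: Q_def algebra_simps)
          then show ?thesis by (simp add: \<tau>_def algebra_simps)
        qed
        also have "\<dots> = exp (- 3 * l) ^ (j + 1)"
          unfolding exp_of_nat_mult[symmetric] by (simp add: add.commute)
        also have "\<dots> = 1 / real n ^ 3 * (1 / real n ^ 3) ^ j" unfolding x by simp
        also have "\<dots> \<le> 1 / real n ^ 3 * (1 / 8) ^ j"
        proof (intro mult_left_mono power_mono)
          have "2 ^ 3 \<le> real n ^ 3" using n by (intro power_mono) auto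
          then have "1 / real n ^ 3 \<le> 1 / 2 ^ 3" by (intro divide_left_mono) (use n0 in auto)
          then show "1 / real n ^ 3 \<le> 1 / 8" by simp
        qed auto
        finally show ?thesis .
      qed
      then have "(\<Sum>j<L. N ^ (m + 1) * (N ^ (j + 1) * exp (- \<tau> j))) \<le> (\<Sum>j<L. 1 / real n ^ 3 * (1 / 8) ^ j)"
        by (intro sum_mono)
      also have "\<dots> = 1 / real n ^ 3 * (\<Sum>j<L. (1 / 8) ^ j)" by (simp add: sum_distrib_left)
      also have "\<dots> \<le> 1 / real n ^ 3 * 2"
        using sum_geometric_le[of "1 / 8" L] by (intro mult_left_mono) auto
      finally have 2: "(\<Sum>j<L. N ^ (m + 1) * (N ^ (j + 1) * exp (- \<tau> j))) \<le> 2 / real n ^ 3" by simp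
      have "N ^ (m + 1) * (exp (- s) + (\<Sum>j<L. N ^ (j + 1) * exp (- \<tau> j)))
          = N ^ (m + 1) * exp (- s) + (\<Sum>j<L. N ^ (m + 1) * (N ^ (j + 1) * exp (- \<tau> j)))"
        by (simp add: distrib_left sum_distrib_left)
      then show ?thesis using E(2) 1 2 unfolding t2 by linarith
    qed
    have leaf: "sqrt (V * shrink ^ L) \<le> r\<^sup>2 / 10"
    proof (rule real_le_lsqrt)
      show "V * shrink ^ L \<le> (r\<^sup>2 / 10)\<^sup>2" using L(1) by (simp add: power_divide power_mult[symmetric])
    qed auto
    have cross: "(\<Sum>j<L. sqrt (V * shrink ^ j) * (sqrt (V * shrink ^ j) + 2 * r)) \<le> r\<^sup>2 / 10"
    proof -
      have "sqrt (V * shrink ^ j) * (sqrt (V * shrink ^ j) + 2 * r) \<le> (r / 2000 * \<sigma> ^ j) * (3 * r)" for j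
      proof (intro mult_mono sqrtV)
        have "\<sigma> ^ j \<le> 1" by (intro power_le_one) (auto simp: \<sigma>_def)
        then have "r / 2000 * \<sigma> ^ j \<le> r / 2000 * 1" using r by (intro mult_left_mono) auto
        then show "sqrt (V * shrink ^ j) + 2 * r \<le> 3 * r" using sqrtV[of j] r by linarith
      qed (use r V in \<open>auto simp: \<sigma>_def\<close>)
      then have "(\<Sum>j<L. sqrt (V * shrink ^ j) * (sqrt (V * shrink ^ j) + 2 * r)) \<le> (\<Sum>j<L. (r / 2000 * \<sigma> ^ j) * (3 * r))"
        by (intro sum_mono)
      also have "\<dots> = 3 / 2000 * r\<^sup>2 * (\<Sum>j<L. \<sigma> ^ j)"
        unfolding sum_distrib_left by (intro sum.cong refl) (simp add: power2_eq_square)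
      also have "\<dots> \<le> 3 / 2000 * r\<^sup>2 * (1 / (1 - \<sigma>))"
        by (intro mult_left_mono sum_geometric_le) (auto simp: \<sigma>_def)
      also have "\<dots> \<le> r\<^sup>2 / 10" using r2pos by (simp add: \<sigma>_def)
      finally show ?thesis .
    qed
    have tsum: "(\<Sum>j<L. t j) \<le> n * r\<^sup>2 / 10"
    proof -
      have tj: "t j \<le> sqrt (2 * Q) * sqrt (n * l) * (r / 2000) * ((real j + 1) * \<sigma> ^ j)" for j
      proof -
        have "t j = sqrt (2 * Q * (n * l) * (V * shrink ^ j) * (real j + 1))"
          by (simp add: t_def \<tau>_def mult_ac)
        also have "\<dots> = sqrt (2 * Q) * sqrt (n * l) * sqrt (V * shrink ^ j) * sqrt (real j + 1)"
          by (simp only: real_sqrt_mult)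
        also have "\<dots> \<le> sqrt (2 * Q) * sqrt (n * l) * (r / 2000 * \<sigma> ^ j) * (real j + 1)"
        proof (intro mult_mono order_refl sqrtV)
          show "sqrt (real j + 1) \<le> real j + 1" by (rule real_le_lsqrt) (auto simp: power2_eq_square algebra_simps)
        qed (use r l Q n0 V in \<open>auto simp: \<sigma>_def\<close>)
        finally show ?thesis by (simp add: mult_ac)
      qed
      have "(\<Sum>j<L. t j) \<le> (\<Sum>j<L. sqrt (2 * Q) * sqrt (n * l) * (r / 2000) * ((real j + 1) * \<sigma> ^ j))"
        by (intro sum_mono tj)
      also have "\<dots> = sqrt (2 * Q) * sqrt (n * l) * (r / 2000) * (\<Sum>j<L. (real j + 1) * \<sigma> ^ j)"
        by (simp add: sum_distrib_left)
      also have "\<dots> \<le> sqrt (2 * Q) * sqrt (n * l) * (r / 2000) * (1 / (1 - \<sigma>)\<^sup>2)"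
        using r l Q by (intro mult_left_mono sum_arith_geometric_le) (auto simp: \<sigma>_def)
      also have "\<dots> \<le> sqrt (2 * Q) * sqrt (n * l) * (r / 2000) * 3600"
        using r l Q by (intro mult_left_mono) (auto simp: \<sigma>_def power2_eq_square)
      also have "\<dots> = (C0 * sqrt (l / n)) * (n * r / 10)"
      proof -
        have "sqrt (n * l) = sqrt (l / n) * n"
          using n0 by (simp add: real_sqrt_mult real_sqrt_divide field_simps)
        then show ?thesis by (simp add: C0_def)
      qed
      also have "\<dots> \<le> r * (n * r / 10)" using r0 r by (intro mult_right_mono) (auto simp: l_def)
      finally show ?thesis by (simp add: power2_eq_square mult_ac)
    qed
    have "AE xs in sample p n. xs \<notin> E \<longrightarrow>
        (\<forall>q\<in>P. r\<^sup>2 < radius2 p q \<longrightarrow> radius2 p q \<le> 4 * r\<^sup>2 \<longrightarrow> log_ratio p n q xs < 0)"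
      using E(3)
    proof eventually_elim
      case (elim xs)
      show ?case
      proof (intro impI ballI)
        fix q assume xs: "xs \<notin> E" and q: "q \<in> P" "r\<^sup>2 < radius2 p q" "radius2 p q \<le> 4 * r\<^sup>2"
        have "log_ratio p n q xs \<le> n * (affinity p q - 1) + s
           + (\<Sum>j<L. t j + n * (sqrt (V * shrink ^ j) * (sqrt (V * shrink ^ j) + 2 * r)))
           + n * sqrt (V * shrink ^ L)" using elim xs q by blast
        also have "(\<Sum>j<L. t j + n * (sqrt (V * shrink ^ j) * (sqrt (V * shrink ^ j) + 2 * r)))
           = (\<Sum>j<L. t j) + n * (\<Sum>j<L. sqrt (V * shrink ^ j) * (sqrt (V * shrink ^ j) + 2 * r))"
          by (simp add: sum.distrib sum_distrib_left)
        \<comment> \<open>The balance is \<open>- 1 / 2 + 4 / 10 < 0\<close>, in units of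
          \<open>n * r\<^sup>2\<close>.\<close>
        also have "n * (affinity p q - 1) + s
           + ((\<Sum>j<L. t j) + n * (\<Sum>j<L. sqrt (V * shrink ^ j) * (sqrt (V * shrink ^ j) + 2 * r)))
           + n * sqrt (V * shrink ^ L) \<le> n * (- (r\<^sup>2 / 2)) + n * r\<^sup>2 / 10 + (n * r\<^sup>2 / 10 + n * (r\<^sup>2 / 10)) + n * (r\<^sup>2 / 10)"
          using tsum cross leaf affinity_eq[OF p q(1)] q(2) by (intro add_mono mult_left_mono) (auto simp: s_def)
        also have "\<dots> < 0" using n0 r2pos by simp
        finally show "log_ratio p n q xs < 0" .
      qed
    qed
    then show "\<exists>E\<in>sets (sample p n). measure (sample p n) E \<le> 3 / real n ^ 3 \<and>
      (AE xs in sample p n. xs \<notin> E \<longrightarrow>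
        (\<forall>q\<in>P. r\<^sup>2 < radius2 p q \<longrightarrow> radius2 p q \<le> 4 * r\<^sup>2 \<longrightarrow> log_ratio p n q xs < 0))"
      using E(1) prob by blast
  qed
qed

text \<open>Peeling: the densities outside the ball of radius \<open>r0\<close> are split into
  shells of doubling radius. At most \<open>n\<close> shells occur, so the total failure probability
  is at most \<open>n * 3 / n ^ 3\<close>, below \<open>2 / n\<close>.\<close>

theorem likelihood_rate:
  assumes p: "p \<in> P"
  shows "\<exists>C>0. \<forall>n\<ge>2. \<exists>E\<in>sets (sample p n). measure (sample p n) E \<le> 2 / real n \<and>
    (AE xs in sample p n. xs \<notin> E \<longrightarrow>
      (\<forall>q\<in>P. 0 \<le> log_ratio p n q xs \<longrightarrow> radius2 p q \<le> C * (ln (real n) / real n)))"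
proof -
  obtain C0 where C0: "2 \<le> C0" and C: "\<forall>n\<ge>2. \<forall>r. C0 * sqrt (ln (real n) / real n) \<le> r \<longrightarrow> r \<le> 2 \<longrightarrow>
    (\<exists>E\<in>sets (sample p n). measure (sample p n) E \<le> 3 / real n ^ 3 \<and>
      (AE xs in sample p n. xs \<notin> E \<longrightarrow>
        (\<forall>q\<in>P. r\<^sup>2 < radius2 p q \<longrightarrow> radius2 p q \<le> 4 * r\<^sup>2 \<longrightarrow> log_ratio p n q xs < 0)))"
    using shell_rate[OF p] by (elim exE conjE) (rule that)
  show ?thesis
  proof (rule exI[of _ "C0\<^sup>2"], intro conjI allI impI)
    show "0 < C0\<^sup>2" using C0 by simp
    fix n :: nat assume n: "2 \<le> n"
    interpret S: prob_space "sample p n" by (rule prob_space_sample[OF p])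
    define r0 where "r0 = C0 * sqrt (ln (real n) / real n)"
    define R where "R = (\<lambda>i::nat. 2 ^ i * r0)"
    have ln2: "1 / 2 \<le> ln (2::real)" using ln_le_minus_one[of "1 / 2"] by (simp add: ln_div)
    have "ln 2 \<le> ln (real n)" using n by (intro ln_mono) auto
    then have l2: "1 / 2 \<le> ln (real n)" using ln2 by linarith
    have q0: "0 \<le> sqrt (ln (real n) / real n)" using l2 n by simp
    \<comment> \<open>The crude lower bound on the smallest radius limits the number of shells; it
      uses \<open>ln n \<ge> 1 / 2\<close> and \<open>C0 \<ge> 2\<close>.\<close>
    have r0: "1 / n < r0"
    proof -
      have "1 / n \<le> sqrt (1 / n)" using n by (intro real_le_rsqrt) (auto simp: power2_eq_square field_simps)
      also have "\<dots> < 2 * sqrt (1 / 2 / n)"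
      proof -
        have "sqrt (1 / n) < sqrt (4 * (1 / 2 / n))" using n by (intro real_sqrt_less_mono) (simp add: field_simps)
        also have "\<dots> = 2 * sqrt (1 / 2 / n)" by (simp only: real_sqrt_mult real_sqrt_four)
        finally show ?thesis .
      qed
      also have "\<dots> \<le> C0 * sqrt (ln (real n) / real n)"
        using C0 l2 n by (intro mult_mono real_sqrt_le_mono divide_right_mono) auto
      finally show ?thesis by (simp add: r0_def)
    qed
    have "0 < 1 / real n" using n by simp
    then have r0p: "0 < r0" using r0 by linarith
    have R_ge: "r0 \<le> R i" for i using r0p by (simp add: R_def)
    have "\<forall>i. \<exists>E. E \<in> sets (sample p n) \<and> S.prob E \<le> 3 / real n ^ 3 \<and> (R i \<le> 2 \<longrightarrow>
      (AE xs in sample p n. xs \<notin> E \<longrightarrow>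
        (\<forall>q\<in>P. (R i)\<^sup>2 < radius2 p q \<longrightarrow> radius2 p q \<le> 4 * (R i)\<^sup>2 \<longrightarrow> log_ratio p n q xs < 0)))"
    proof
      fix i
      show "\<exists>E. E \<in> sets (sample p n) \<and> S.prob E \<le> 3 / real n ^ 3 \<and> (R i \<le> 2 \<longrightarrow>
      (AE xs in sample p n. xs \<notin> E \<longrightarrow>
        (\<forall>q\<in>P. (R i)\<^sup>2 < radius2 p q \<longrightarrow> radius2 p q \<le> 4 * (R i)\<^sup>2 \<longrightarrow> log_ratio p n q xs < 0)))"
      proof (cases "R i \<le> 2")
        case True
        then show ?thesis using C[rule_format, OF n R_ge[of i, unfolded r0_def] True] by blast
      next
        case False
        \<comment> \<open>Radii above 2 carry no claim, so the empty event will do.\<close>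
        then show ?thesis by (intro exI[of _ "{}"]) auto
      qed
    qed
    from choice[OF this] obtain E where E0: "\<forall>i. E i \<in> sets (sample p n) \<and> S.prob (E i) \<le> 3 / real n ^ 3 \<and> (R i \<le> 2 \<longrightarrow>
      (AE xs in sample p n. xs \<notin> E i \<longrightarrow>
        (\<forall>q\<in>P. (R i)\<^sup>2 < radius2 p q \<longrightarrow> radius2 p q \<le> 4 * (R i)\<^sup>2 \<longrightarrow> log_ratio p n q xs < 0)))"
      by (rule exE)
    have "AE xs in sample p n. \<forall>i\<in>{..<n}. R i \<le> 2 \<longrightarrow> xs \<notin> E i \<longrightarrow>
        (\<forall>q\<in>P. (R i)\<^sup>2 < radius2 p q \<longrightarrow> radius2 p q \<le> 4 * (R i)\<^sup>2 \<longrightarrow> log_ratio p n q xs < 0)"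
      by (rule AE_finite_allI) (use E0 in auto)
    then have "AE xs in sample p n. xs \<notin> (\<Union>i<n. E i) \<longrightarrow>
      (\<forall>q\<in>P. 0 \<le> log_ratio p n q xs \<longrightarrow> radius2 p q \<le> C0\<^sup>2 * (ln (real n) / real n))"
    proof eventually_elim
      case (elim xs)
      show ?case
      proof (intro impI ballI, rule ccontr)
        fix q assume xs: "xs \<notin> (\<Union>i<n. E i)" and q: "q \<in> P" "0 \<le> log_ratio p n q xs"
          and "\<not> radius2 p q \<le> C0\<^sup>2 * (ln (real n) / real n)"
        then have gt: "r0\<^sup>2 < radius2 p q" using l2 n by (simp add: r0_def power_mult_distrib)
        have le2: "radius2 p q \<le> 2" by (rule radius2_le_2[OF p q(1)])
        define \<rho> where "\<rho> = sqrt (radius2 p q)"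
        have "0 \<le> r0\<^sup>2" by simp
        then have "0 < radius2 p q" using gt by linarith
        then have \<rho>: "\<rho>\<^sup>2 = radius2 p q" "0 < \<rho>" by (auto simp: \<rho>_def)
        have "\<exists>k. \<rho> \<le> R k"
        proof -
          obtain k where "\<rho> / r0 < 2 ^ k" using real_arch_pow[of 2 "\<rho> / r0"] by auto
          then show ?thesis using r0p by (intro exI[of _ k]) (simp add: R_def field_simps)
        qed
        then have "\<exists>k. \<rho> \<le> R k \<and> (\<forall>j<k. \<not> \<rho> \<le> R j)" by (rule exists_least_iff[THEN iffD1])
        then obtain k where k: "\<rho> \<le> R k" "\<And>j. j < k \<Longrightarrow> R j < \<rho>" by (auto simp: not_le)
        have "k \<noteq> 0"
        proof
          assume "k = 0"
          then have "\<rho>\<^sup>2 \<le> r0\<^sup>2" using k(1) \<rho>(2) by (intro power_mono) (auto simp: R_def)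
          then show False using gt \<rho>(1) by simp
        qed
        then obtain i where i: "k = Suc i" using not0_implies_Suc by blast
        have Ri: "R i < \<rho>" "\<rho> \<le> 2 * R i" using k i by (auto simp: R_def)
        have "\<rho>\<^sup>2 \<le> 2\<^sup>2" using \<rho>(1) le2 by simp
        then have \<rho>2: "\<rho> \<le> 2" by (rule power2_le_imp_le) simp
        have Ri0: "0 < R i" using r0p by (simp add: R_def)
        \<comment> \<open>The shell of a density starts below \<open>3 / 2\<close> because
          \<open>radius2 \<le> 2\<close>, and its inner radius exceeds \<open>2 ^ i / n\<close>;
          thus \<open>2 * 2 ^ i < 3 * n\<close>, which fails for
          \<open>i \<ge> n \<ge> 2\<close>.\<close>
        have "i < n"
        proof -
          have "\<rho>\<^sup>2 \<le> (3/2)\<^sup>2" using \<rho>(1) le2 by (simp add: power2_eq_square)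
          then have "\<rho> \<le> 3 / 2" by (rule power2_le_imp_le) simp
          then have "2 ^ i * r0 < 3 / 2" using Ri(1) by (simp add: R_def)
          moreover have "2 ^ i * (1 / n) \<le> 2 ^ i * r0" using r0 by (intro mult_left_mono) auto
          ultimately have "2 ^ i * (1 / n) < 3 / 2" by linarith
          then have "2 ^ i * 2 < 3 * real n" using n by (simp add: field_simps)
          then have "real (2 ^ i * 2) < real (3 * n)" by simp
          then have i2: "2 ^ i * 2 < 3 * n" by (simp only: of_nat_less_iff)
          have "i + 1 \<le> (2::nat) ^ i" by (induction i) auto
          then have i1: "2 * i + 2 < 3 * n" using i2 by linarith
          show "i < n"
          proof (rule ccontr)
            assume "\<not> i < n"
            then have "n \<le> i" by simp
            then have "(2::nat) ^ n \<le> 2 ^ i" by (intro power_increasing) auto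
            moreover have "3 * n \<le> 2 ^ n * 2"
              using n by (induction n rule: dec_induct) auto
            ultimately show False using i2 by linarith
          qed
        qed
        moreover have "R i \<le> 2" using Ri \<rho>2 by linarith
        moreover have "(R i)\<^sup>2 < radius2 p q" using Ri Ri0 unfolding \<rho>(1)[symmetric] by (intro power_strict_mono) auto
        moreover have "radius2 p q \<le> 4 * (R i)\<^sup>2"
        proof -
          have "\<rho>\<^sup>2 \<le> (2 * R i)\<^sup>2" using Ri \<rho>(2) by (intro power_mono) auto
          then show ?thesis using \<rho>(1) by (simp add: power_mult_distrib)
        qed
        ultimately have "log_ratio p n q xs < 0" using elim xs q(1) by blast
        then show False using q(2) by simp
      qed
    qed
    moreover have "S.prob (\<Union>i<n. E i) \<le> 2 / real n"
    proof -
      have "S.prob (\<Union>i\<in>{..<n}. E i) \<le> real n * (3 / real n ^ 3)"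
        by (rule S.prob_UN_le) (use E0 in auto)
      also have "\<dots> = 3 / n / n" using n by (simp add: power3_eq_cube)
      also have "\<dots> \<le> 2 / n" using n by (simp add: field_simps)
      finally show ?thesis .
    qed
    moreover have "(\<Union>i<n. E i) \<in> sets (sample p n)" using E0 by auto
    ultimately show "\<exists>E\<in>sets (sample p n). S.prob E \<le> 2 / real n \<and>
      (AE xs in sample p n. xs \<notin> E \<longrightarrow>
        (\<forall>q\<in>P. 0 \<le> log_ratio p n q xs \<longrightarrow> radius2 p q \<le> C0\<^sup>2 * (ln (real n) / real n)))"
      by blast
  qed
qed

end

section \<open>Local brackets of mixtures\<close>

lemma bracketing_number_attained:
  assumes "bracketing_number \<nu> \<epsilon> P = enat m"
  obtains B where "finite B" "card B = m" "\<And>b. b \<in> B \<Longrightarrow> bracket \<nu> \<epsilon> b"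
    "\<And>g. g \<in> P \<Longrightarrow> \<exists>(l, u)\<in>B. AE x in \<nu>. l x \<le> g x \<and> g x \<le> u x"
proof -
  let ?S = "{enat (card B) | B. finite B \<and> (\<forall>b\<in>B. bracket \<nu> \<epsilon> b) \<and>
     (\<forall>g\<in>P. \<exists>(l, u)\<in>B. AE x in \<nu>. l x \<le> g x \<and> g x \<le> u x)}"
  have eq: "Inf ?S = enat m" using assms by (simp add: bracketing_number_def)
  then have ne: "?S \<noteq> {}" by (auto simp: Inf_enat_def simp del: Collect_empty_eq split: if_splits)
  have "Inf ?S \<in> ?S"
    unfolding Inf_enat_def if_not_P[OF ne] using ne by (metis (mono_tags, lifting) LeastI ex_in_conv)
  then have "enat m \<in> ?S" using eq by simp
  then obtain B where B: "enat m = enat (card B)" "finite B" "\<forall>b\<in>B. bracket \<nu> \<epsilon> b"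
    "\<forall>g\<in>P. \<exists>(l, u)\<in>B. AE x in \<nu>. l x \<le> g x \<and> g x \<le> u x"
    by (elim CollectE exE conjE) (rule that)
  show thesis by (rule that[of B]) (use B in blast)+
qed

lemma bracketing_entropy_le:
  assumes "ennreal_sqrt (bracketing_entropy \<nu> \<epsilon> P) \<le> ennreal c" "0 \<le> c"
  obtains B where "finite B" "real (card B) \<le> exp (c\<^sup>2)" "\<And>b. b \<in> B \<Longrightarrow> bracket \<nu> \<epsilon> b"
    "\<And>g. g \<in> P \<Longrightarrow> \<exists>(l, u)\<in>B. AE x in \<nu>. l x \<le> g x \<and> g x \<le> u x"
proof -
  have fin: "bracketing_entropy \<nu> \<epsilon> P \<noteq> \<infinity>"
    using assms by (auto simp: ennreal_sqrt_def top_unique)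
  then obtain m where m: "bracketing_number \<nu> \<epsilon> P = enat m"
    by (cases "bracketing_number \<nu> \<epsilon> P") (auto simp: bracketing_entropy_def)
  have "real m \<le> exp (c\<^sup>2)"
  \<comment> \<open>An empty cover is separated because the logarithm of 0 is 0 here: its entropy is
    0 as well, and the bound on the cardinality is trivial.\<close>
  proof (cases "m = 0")
    case False
    then have l: "0 \<le> ln (real m)" by simp
    have "ennreal (sqrt (ln (real m))) \<le> ennreal c"
      using assms fin l by (simp add: ennreal_sqrt_def bracketing_entropy_def m)
    then have "sqrt (ln (real m)) \<le> c" using assms(2) by simp
    then have "ln (real m) \<le> c\<^sup>2" using assms(2) l by (simp add: sqrt_le_D)
    then show ?thesis using False by (metis exp_le_cancel_iff exp_ln of_nat_0_less_iff neq0_conv)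
  qed simp
  obtain B where "finite B" "card B = m" "\<And>b. b \<in> B \<Longrightarrow> bracket \<nu> \<epsilon> b"
    "\<And>g. g \<in> P \<Longrightarrow> \<exists>(l, u)\<in>B. AE x in \<nu>. l x \<le> g x \<and> g x \<le> u x"
    by (rule bracketing_number_attained[OF m]) (rule that; assumption)
  with \<open>real m \<le> exp (c\<^sup>2)\<close> show thesis by (intro that[of B]) auto
qed


text \<open>Entropy at radius \<open>u\<close> need not be monotone in \<open>u\<close>, since the
  class grows along with the brackets, so a good \<open>u\<close> is found by averaging: if the
  integrand reached \<open>12 * c / \<epsilon>\<close> on an interval of length
  \<open>\<epsilon> / 6\<close>, the integral would be at least \<open>2 * c\<close>.\<close>

lemma bracketing_integral_entropy:
  assumes "bracketing_integral \<nu> \<Theta> f k G0 \<epsilon> \<le> ennreal c" "0 < c" "0 < \<epsilon>"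
  shows "\<exists>u. 5 / 6 * \<epsilon> \<le> u \<and> u \<le> \<epsilon> \<and>
    ennreal_sqrt (bracketing_entropy \<nu> u (sqrt_class \<nu> \<Theta> f k G0 u)) \<le> ennreal (12 * c / \<epsilon>)"
proof (rule ccontr)
  assume "\<not> ?thesis"
  then have gt: "ennreal (12 * c / \<epsilon>) \<le> ennreal_sqrt (bracketing_entropy \<nu> u (sqrt_class \<nu> \<Theta> f k G0 u))"
    if "5 / 6 * \<epsilon> \<le> u" "u \<le> \<epsilon>" for u
    using that by (meson linear)
  have "ennreal (2 * c) = ennreal (12 * c / \<epsilon>) * ennreal (\<epsilon> - 5 / 6 * \<epsilon>)"
    using assms by (simp add: ennreal_mult[symmetric] field_simps)
  also have "\<dots> = (\<integral>\<^sup>+u. ennreal (12 * c / \<epsilon>) * indicator {5 / 6 * \<epsilon>..\<epsilon>} u \<partial>lborel)"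
    using assms by (subst nn_integral_cmult_indicator) auto
  also have "\<dots> \<le> (\<integral>\<^sup>+u\<in>{0<..\<epsilon>}. ennreal_sqrt (bracketing_entropy \<nu> u (sqrt_class \<nu> \<Theta> f k G0 u)) \<partial>lborel)"
  proof (rule nn_integral_mono)
    fix u :: real
    show "ennreal (12 * c / \<epsilon>) * indicator {5 / 6 * \<epsilon>..\<epsilon>} u
      \<le> ennreal_sqrt (bracketing_entropy \<nu> u (sqrt_class \<nu> \<Theta> f k G0 u)) * indicator {0<..\<epsilon>} u"
      using gt[of u] assms by (auto simp: indicator_def)
  qed
  also have "\<dots> \<le> ennreal c"
    using assms(1) by (simp add: bracketing_integral_def)
  finally show False using assms by simp
qed

text \<open>Solves \<open>n / ln n\<close> of order \<open>y\<close> up to constants, by rounding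
  \<open>y * ln y\<close> up.\<close>

lemma sample_size_exists:
  assumes "10 \<le> (y::real)"
  obtains n :: nat where "2 \<le> n" "y * ln y \<le> n" "n \<le> 2 * (y * ln y)" "ln (real n) \<le> 2 * ln y"
proof -
  have "exp 1 \<le> y" using exp_le assms by linarith
  then have l1: "1 \<le> ln y" using assms by (subst ln_ge_iff) auto
  define n where "n = nat \<lceil>y * ln y\<rceil>"
  have big: "10 \<le> y * ln y" using mult_mono[of 10 y 1 "ln y"] l1 assms by simp
  have n: "y * ln y \<le> n" "n \<le> y * ln y + 1" using big unfolding n_def by linarith+
  have "ln y \<le> y - 1" using assms by (intro ln_le_minus_one) simp
  then have "y * ln y \<le> y * (y - 1)" using assms by (intro mult_left_mono) auto
  then have "real n \<le> y\<^sup>2" using n assms by (simp add: power2_eq_square algebra_simps)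
  then have "ln (real n) \<le> ln (y\<^sup>2)" using n big by (intro ln_mono) auto
  also have "\<dots> = 2 * ln y" using assms by (simp add: ln_realpow)
  finally show thesis using n big by (intro that[of n]) linarith+
qed

text \<open>For a given squared radius \<open>v\<close> the sample size is about the smallest that
  admits the scale \<open>sqrt v\<close> in condition B. The entropy bound
  \<open>144 * J\<^sup>2 * n * \<epsilon>\<^sup>2\<close> is then a multiple of
  \<open>ln (1 / v)\<close>, and its exponential a power of \<open>1 / v\<close>.\<close>

lemma condition_B_local_brackets:
  assumes B: "condition_B k J \<nu> \<Theta> f" and J: "0 < J"
  shows "\<exists>A\<ge>1000. \<forall>G0\<in>mixing_le \<Theta> k. \<forall>v. 0 < v \<longrightarrow> v \<le> 1000 \<longrightarrow>
    (\<exists>B. finite B \<and> real (card B) \<le> (A / v) powr A \<and>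
      (\<forall>(l, u)\<in>B. l \<in> borel_measurable \<nu> \<and> u \<in> borel_measurable \<nu> \<and>
         (\<integral>\<^sup>+x. ennreal ((u x - l x)\<^sup>2) \<partial>\<nu>) \<le> ennreal (72 / 100 * v)) \<and>
      (\<forall>G\<in>mixing_le \<Theta> k. (\<integral>x. (sqrt (bar_mixture f G0 G x) - sqrt (mixture f G0 x))\<^sup>2 \<partial>\<nu>) \<le> v \<longrightarrow>
         (\<exists>(l, u)\<in>B. AE x in \<nu>. l x \<le> sqrt (bar_mixture f G0 G x) \<and> sqrt (bar_mixture f G0 G x) \<le> u x)))"
proof -
  obtain L where L: "0 < L" and LB: "\<And>n G0 \<epsilon>. 2 \<le> n \<Longrightarrow> G0 \<in> mixing_le \<Theta> k \<Longrightarrow>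
      L * sqrt (ln (real n) / real n) < \<epsilon> \<Longrightarrow>
      bracketing_integral \<nu> \<Theta> f k G0 \<epsilon> \<le> ennreal (J * sqrt (real n) * \<epsilon>\<^sup>2)"
    using B unfolding condition_B_def by blast
  \<comment> \<open>The 5000 gives \<open>y \<ge> 10\<close>, as \<open>w\<^sup>2 \<le> 500\<close>;
    the second part makes \<open>L\<^sup>2 * ln n\<close> at most \<open>w\<^sup>2 * n\<close>, so
    that \<open>\<epsilon>\<close> is admissible in condition B.\<close>
  define K where "K = max 5000 (2 * L\<^sup>2)"
  have K: "5000 \<le> K" "2 * L\<^sup>2 \<le> K" by (auto simp: K_def)
  \<comment> \<open>The second entry compares the bases, \<open>y = 2 * K / v\<close>, and the third
    the exponents; 415 rounds up \<open>144 * 2.88\<close>.\<close>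
  define A where "A = max 1000 (max (2 * K) (415 * J\<^sup>2 * K))"
  have A: "1000 \<le> A" "2 * K \<le> A" "415 * J\<^sup>2 * K \<le> A" by (auto simp: A_def)
  show ?thesis
  proof (rule exI[of _ A], intro conjI ballI allI impI A(1))
    fix G0 :: "rvec pmf" and v :: real
    assume G0: "G0 \<in> mixing_le \<Theta> k" and v: "0 < v" "v \<le> 1000"
    define w where "w = sqrt (v / 2)"
    have w: "0 < w" "w\<^sup>2 = v / 2" using v by (auto simp: w_def)
    define y where "y = K / w\<^sup>2"
    have y: "10 \<le> y" using K v w by (simp add: y_def field_simps)
    obtain n :: nat where n: "2 \<le> n" "y * ln y \<le> n" "n \<le> 2 * (y * ln y)" "ln (real n) \<le> 2 * ln y"
      using sample_size_exists[OF y] by blast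
    have ly: "0 < ln y" using y by simp
    \<comment> \<open>The radius \<open>u\<close> found in
      \<open>[5/6 * \<epsilon>, \<epsilon>]\<close> is then at least \<open>w\<close>, so the ball
      in question belongs to the class of radius \<open>u\<close>, while the brackets have squared
      size at most \<open>\<epsilon>\<^sup>2 = 0.72 * v\<close>.\<close>
    define \<epsilon> where "\<epsilon> = 6 / 5 * w"
    have eps: "0 < \<epsilon>" "\<epsilon>\<^sup>2 = 72 / 100 * v" using w by (auto simp: \<epsilon>_def power_mult_distrib power_divide)
    have "L\<^sup>2 * ln (real n) \<le> L\<^sup>2 * (2 * ln y)" using n by (intro mult_left_mono) auto
    also have "\<dots> \<le> K * ln y" using K ly by simp
    also have "\<dots> = w\<^sup>2 * (y * ln y)" using w by (simp add: y_def)
    also have "\<dots> \<le> w\<^sup>2 * n" using n by (intro mult_left_mono) auto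
    also have "\<dots> < \<epsilon>\<^sup>2 * n" using n w v eps by simp
    finally have "L\<^sup>2 * (ln (real n) / n) < \<epsilon>\<^sup>2" using n by (simp add: field_simps)
    then have "sqrt (L\<^sup>2 * (ln (real n) / n)) < sqrt (\<epsilon>\<^sup>2)" by (rule real_sqrt_less_mono)
    then have "L * sqrt (ln (real n) / n) < \<epsilon>" using L eps(1) by (simp only: real_sqrt_mult real_sqrt_abs abs_of_pos)
    note int = LB[OF n(1) G0 this]
    have "0 < J * sqrt (real n) * \<epsilon>\<^sup>2" using J n(1) eps(1) by simp
    from bracketing_integral_entropy[OF int this eps(1)] obtain u where u: "5 / 6 * \<epsilon> \<le> u" "u \<le> \<epsilon>"
      and ent: "ennreal_sqrt (bracketing_entropy \<nu> u (sqrt_class \<nu> \<Theta> f k G0 u))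
        \<le> ennreal (12 * (J * sqrt (real n) * \<epsilon>\<^sup>2) / \<epsilon>)"
      by (elim exE conjE) (rule that)
    define c where "c = 12 * (J * sqrt (real n) * \<epsilon>\<^sup>2) / \<epsilon>"
    have c: "0 \<le> c" using J eps by (simp add: c_def)
    have wu: "w \<le> u" "0 < u" using u w by (auto simp: \<epsilon>_def)
    obtain B where fB: "finite B" and cB: "real (card B) \<le> exp (c\<^sup>2)" and bB: "\<And>b. b \<in> B \<Longrightarrow> bracket \<nu> u b"
      and B: "\<And>g. g \<in> sqrt_class \<nu> \<Theta> f k G0 u \<Longrightarrow> \<exists>(l, u)\<in>B. AE x in \<nu>. l x \<le> g x \<and> g x \<le> u x"
      by (rule bracketing_entropy_le[OF ent[folded c_def] c]) (rule that; assumption)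
    have "c = 12 * J * sqrt (real n) * \<epsilon>" using eps by (simp add: c_def power2_eq_square)
    then have "c\<^sup>2 = 144 * J\<^sup>2 * n * \<epsilon>\<^sup>2" by (simp add: power_mult_distrib)
    also have "\<dots> = 144 * J\<^sup>2 * (144 / 100) * (w\<^sup>2 * n)" using eps w by simp
    also have "\<dots> \<le> 144 * J\<^sup>2 * (144 / 100) * (w\<^sup>2 * (2 * (y * ln y)))"
      using n by (intro mult_left_mono) auto
    also have "\<dots> = 144 * J\<^sup>2 * (288 / 100) * K * ln y" using w by (simp add: y_def)
    also have "\<dots> \<le> 415 * J\<^sup>2 * K * ln y"
      using K ly by (intro mult_right_mono) auto
    finally have "exp (c\<^sup>2) \<le> exp (415 * J\<^sup>2 * K * ln y)" by simp
    also have "\<dots> = y powr (415 * J\<^sup>2 * K)" using y by (simp add: powr_def)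
    also have "\<dots> \<le> y powr A" using A y by (intro powr_mono) auto
    also have "\<dots> \<le> (A / v) powr A"
    proof (rule powr_mono2)
      have "y = 2 * K / v" using w v by (simp add: y_def field_simps)
      then show "y \<le> A / v" using A v by (simp add: divide_right_mono)
    qed (use A y in auto)
    finally have card: "real (card B) \<le> (A / v) powr A" using cB by simp
    have br: "\<forall>(l, u)\<in>B. l \<in> borel_measurable \<nu> \<and> u \<in> borel_measurable \<nu> \<and>
         (\<integral>\<^sup>+x. ennreal ((u x - l x)\<^sup>2) \<partial>\<nu>) \<le> ennreal (72 / 100 * v)"
    proof (safe)
      fix l u' assume b: "(l, u') \<in> B"
      have "bracket \<nu> u (l, u')" by (rule bB[OF b])
      then have "l \<in> borel_measurable \<nu>" "u' \<in> borel_measurable \<nu>"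
        and le: "(\<integral>\<^sup>+x. ennreal ((u' x - l x)\<^sup>2) \<partial>\<nu>) \<le> ennreal (u\<^sup>2)"
        by (auto simp: bracket_def)
      then show "l \<in> borel_measurable \<nu>" "u' \<in> borel_measurable \<nu>" by auto
      have "u\<^sup>2 \<le> \<epsilon>\<^sup>2" using u wu by (intro power_mono) auto
      then have "ennreal (u\<^sup>2) \<le> ennreal (72 / 100 * v)" unfolding eps by (rule ennreal_leI)
      with le show "(\<integral>\<^sup>+x. ennreal ((u' x - l x)\<^sup>2) \<partial>\<nu>) \<le> ennreal (72 / 100 * v)" by (rule order_trans)
    qed
    have cov: "\<forall>G\<in>mixing_le \<Theta> k. (\<integral>x. (sqrt (bar_mixture f G0 G x) - sqrt (mixture f G0 x))\<^sup>2 \<partial>\<nu>) \<le> v \<longrightarrow>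
         (\<exists>(l, u)\<in>B. AE x in \<nu>. l x \<le> sqrt (bar_mixture f G0 G x) \<and> sqrt (bar_mixture f G0 G x) \<le> u x)"
    proof (intro ballI impI)
      fix G assume G: "G \<in> mixing_le \<Theta> k"
        and le: "(\<integral>x. (sqrt (bar_mixture f G0 G x) - sqrt (mixture f G0 x))\<^sup>2 \<partial>\<nu>) \<le> v"
      have "hellinger \<nu> (bar_mixture f G0 G) (mixture f G0) \<le> w"
        unfolding hellinger_def w_def using le by (intro real_sqrt_le_mono) simp
      then have "hellinger \<nu> (bar_mixture f G0 G) (mixture f G0) \<le> u" using wu by simp
      then have "(\<lambda>x. sqrt (bar_mixture f G0 G x)) \<in> sqrt_class \<nu> \<Theta> f k G0 u"
        using G by (auto simp: sqrt_class_def)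
      from B[OF this] show "\<exists>(l, u)\<in>B. AE x in \<nu>. l x \<le> sqrt (bar_mixture f G0 G x) \<and> sqrt (bar_mixture f G0 G x) \<le> u x" .
    qed
    show "\<exists>B. finite B \<and> real (card B) \<le> (A / v) powr A \<and>
      (\<forall>(l, u)\<in>B. l \<in> borel_measurable \<nu> \<and> u \<in> borel_measurable \<nu> \<and>
         (\<integral>\<^sup>+x. ennreal ((u x - l x)\<^sup>2) \<partial>\<nu>) \<le> ennreal (72 / 100 * v)) \<and>
      (\<forall>G\<in>mixing_le \<Theta> k. (\<integral>x. (sqrt (bar_mixture f G0 G x) - sqrt (mixture f G0 x))\<^sup>2 \<partial>\<nu>) \<le> v \<longrightarrow>
         (\<exists>(l, u)\<in>B. AE x in \<nu>. l x \<le> sqrt (bar_mixture f G0 G x) \<and> sqrt (bar_mixture f G0 G x) \<le> u x))"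
      using fB card br cov by (intro exI[of _ B] conjI)
  qed
qed

section \<open>Finite mixtures as a class of densities\<close>

lemma mixture_eq_sum:
  assumes "finite (set_pmf G)"
  shows "mixture f G x = (\<Sum>\<theta>\<in>set_pmf G. pmf G \<theta> * f x \<theta>)"
  unfolding mixture_def using assms
  by (subst integral_measure_pmf_real[of "set_pmf G"]) (auto simp: mult.commute)

lemma mixing_leD:
  assumes "G \<in> mixing_le \<Theta> k"
  shows "finite (set_pmf G)" "set_pmf G \<subseteq> \<Theta>" "card (set_pmf G) \<le> k"
  using assms by (auto simp: mixing_le_def)

lemma mixture_density:
  assumes d: "density_family N \<nu> \<Theta> f" and G: "G \<in> mixing_le \<Theta> k"
  shows "mixture f G \<in> borel_measurable \<nu>" "x \<in> space \<nu> \<Longrightarrow> 0 \<le> mixture f G x"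
    "(\<integral>\<^sup>+x. ennreal (mixture f G x) \<partial>\<nu>) = 1"
proof -
  note fin = mixing_leD[OF G]
  have eq: "mixture f G = (\<lambda>x. \<Sum>\<theta>\<in>set_pmf G. pmf G \<theta> * f x \<theta>)"
    by (rule ext) (rule mixture_eq_sum[OF fin(1)])
  have f: "(\<lambda>x. f x \<theta>) \<in> borel_measurable \<nu>" "\<And>x. x \<in> space \<nu> \<Longrightarrow> 0 \<le> f x \<theta>"
    "(\<integral>\<^sup>+x. ennreal (f x \<theta>) \<partial>\<nu>) = 1" if "\<theta> \<in> set_pmf G" for \<theta>
    using d fin(2) that by (auto simp: density_family_def)
  show "mixture f G \<in> borel_measurable \<nu>"
    unfolding eq using f(1) by (intro borel_measurable_sum borel_measurable_times) auto
  show "0 \<le> mixture f G x" if "x \<in> space \<nu>" for x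
    unfolding eq using f(2) that by (intro sum_nonneg mult_nonneg_nonneg) auto
  have "(\<integral>\<^sup>+x. ennreal (mixture f G x) \<partial>\<nu>) = (\<integral>\<^sup>+x. (\<Sum>\<theta>\<in>set_pmf G. ennreal (pmf G \<theta>) * ennreal (f x \<theta>)) \<partial>\<nu>)"
    unfolding eq using f(2)
    by (intro nn_integral_cong) (simp add: sum_ennreal[symmetric] ennreal_mult'')
  also have "\<dots> = (\<Sum>\<theta>\<in>set_pmf G. \<integral>\<^sup>+x. ennreal (pmf G \<theta>) * ennreal (f x \<theta>) \<partial>\<nu>)"
    using f(1) by (intro nn_integral_sum) auto
  also have "\<dots> = (\<Sum>\<theta>\<in>set_pmf G. ennreal (pmf G \<theta>))"
    using f(1,3) by (intro sum.cong refl) (subst nn_integral_cmult, auto)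
  also have "\<dots> = ennreal (\<Sum>\<theta>\<in>set_pmf G. pmf G \<theta>)" by simp
  also have "(\<Sum>\<theta>\<in>set_pmf G. pmf G \<theta>) = 1" using fin(1) by (intro sum_pmf_eq_1) auto
  finally show "(\<integral>\<^sup>+x. ennreal (mixture f G x) \<partial>\<nu>) = 1" by simp
qed

text \<open>Every subset of a second countable space is separable: one point is picked from each
  basic open set that meets it.\<close>

lemma countable_dense_subset:
  fixes S :: "'a::second_countable_topology set"
  obtains D where "countable D" "D \<subseteq> S" "\<And>U. open U \<Longrightarrow> U \<inter> S \<noteq> {} \<Longrightarrow> U \<inter> D \<noteq> {}"
proof -
  obtain B :: "'a set set" where B: "countable B" "topological_basis B"
    using ex_countable_basis by blast
  define D where "D = (\<lambda>b. SOME y. y \<in> b \<inter> S) ` {b \<in> B. b \<inter> S \<noteq> {}}"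
  have pick: "(SOME y. y \<in> b \<inter> S) \<in> b \<inter> S" if "b \<inter> S \<noteq> {}" for b
    using that by (metis ex_in_conv someI_ex)
  show thesis
  proof
    show "countable D" using B(1) by (simp add: D_def)
    show "D \<subseteq> S" using pick by (auto simp: D_def)
    fix U :: "'a set" assume "open U" "U \<inter> S \<noteq> {}"
    then obtain s where s: "s \<in> U" "s \<in> S" by blast
    then obtain b where b: "b \<in> B" "s \<in> b" "b \<subseteq> U"
      using B(2) \<open>open U\<close> topological_basisE by blast
    then have "b \<inter> S \<noteq> {}" using s by blast
    then have "(SOME y. y \<in> b \<inter> S) \<in> U \<inter> D" using pick b by (auto simp: D_def)
    then show "U \<inter> D \<noteq> {}" by blast
  qed
qed

text \<open>Since \<open>f x\<close> is continuous on \<open>\<Theta>\<close> and the parameters of the mixtures form a separable space,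
  uncountably many almost sure upper bounds hold simultaneously.\<close>

lemma AE_mixture_le:
  assumes cont: "AE x in \<nu>. continuous_on \<Theta> (f x)" and GG: "GG \<subseteq> mixing_le \<Theta> k"
    and le: "\<And>G. G \<in> GG \<Longrightarrow> AE x in \<nu>. mixture f G x \<le> b x"
  shows "AE x in \<nu>. \<forall>G\<in>GG. mixture f G x \<le> b x"
proof -
  \<comment> \<open>A mixture with \<open>m\<close> atoms is coded by a sequence of atoms and a
    sequence of weights, of which the first \<open>m\<close> entries count. The codes live in a
    second countable product space, on which the value at a fixed \<open>x\<close> is
    continuous.\<close>
  define val where "val = (\<lambda>m x (s :: (nat \<Rightarrow> rvec) \<times> (nat \<Rightarrow> real)). \<Sum>i<m. snd s i * f x (fst s i))"
  define par where "par = (\<lambda>m G (s :: (nat \<Rightarrow> rvec) \<times> (nat \<Rightarrow> real)).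
    bij_betw (fst s) {..<m} (set_pmf G) \<and> snd s = (\<lambda>i. pmf G (fst s i)))"
  have val: "mixture f G x = val m x s" if "G \<in> GG" "par m G s" for m G s x
  proof -
    have "finite (set_pmf G)" using that GG mixing_leD by blast
    then show ?thesis using that(2)
      by (auto simp: mixture_eq_sum val_def par_def intro!: sum.reindex_bij_betw[symmetric, where g = "\<lambda>\<theta>. pmf G \<theta> * f x \<theta>", THEN trans])
  qed
  define S where "S = (\<lambda>m. {s. \<exists>G\<in>GG. par m G s})"
  have "AE x in \<nu>. \<forall>s\<in>S m. val m x s \<le> b x" for m
  proof -
    obtain D where D: "countable D" "D \<subseteq> S m" "\<And>U. open U \<Longrightarrow> U \<inter> S m \<noteq> {} \<Longrightarrow> U \<inter> D \<noteq> {}"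
      using countable_dense_subset[of "S m"] by blast
    have "AE x in \<nu>. \<forall>s\<in>D. val m x s \<le> b x"
      unfolding AE_ball_countable[OF D(1)]
    proof
      fix s assume "s \<in> D"
      then obtain G where G: "G \<in> GG" "par m G s" using D(2) by (auto simp: S_def)
      show "AE x in \<nu>. val m x s \<le> b x" using le[OF G(1)] val[OF G] by simp
    qed
    with cont show ?thesis
    proof eventually_elim
      case (elim x)
      show ?case
      proof (rule ballI, rule ccontr)
        fix s assume s: "s \<in> S m" and "\<not> val m x s \<le> b x"
        have Th: "fst s i \<in> \<Theta>" if si: "s \<in> S m" "i < m" for s i
        proof -
          obtain G where G: "G \<in> GG" "par m G s" using si by (auto simp: S_def)
          then have "fst s i \<in> set_pmf G" using si by (auto simp: par_def bij_betw_def)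
          then show ?thesis using G GG mixing_leD(2) by blast
        qed
        have "continuous_on (S m) (val m x)"
          unfolding val_def
        proof (intro continuous_on_sum continuous_on_mult)
          fix i assume i: "i \<in> {..<m}"
          have "continuous_on (S m) snd" by (rule continuous_on_snd[OF continuous_on_id])
          note co1 = continuous_on_product_then_coordinatewise[OF this, of i]
          have "continuous_on (S m) fst" by (rule continuous_on_fst[OF continuous_on_id])
          note co2 = continuous_on_product_then_coordinatewise[OF this, of i]
          show "continuous_on (S m) (\<lambda>s. snd s i)" by (rule co1)
          show "continuous_on (S m) (\<lambda>s. f x (fst s i))"
            by (rule continuous_on_compose2[OF elim(1) co2]) (use Th i in auto)
        qed
        moreover have "open {b x<..}" by simp
        \<comment> \<open>The codes violating the bound at \<open>x\<close> form a relatively open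
          set; if nonempty, it would contain a point of the countable dense set.\<close>
        ultimately obtain U where U: "open U" "U \<inter> S m = val m x -` {b x<..} \<inter> S m"
          unfolding continuous_on_open_invariant by metis
        have "s \<in> U \<inter> S m" unfolding U(2) using s \<open>\<not> val m x s \<le> b x\<close> by simp
        then obtain y where "y \<in> U" "y \<in> D" using D(3)[OF U(1)] by blast
        then have "y \<in> val m x -` {b x<..} \<inter> S m" using D(2) U(2) by blast
        then show False using elim(2) \<open>y \<in> D\<close> by force
      qed
    qed
  qed
  then have "AE x in \<nu>. \<forall>m. \<forall>s\<in>S m. val m x s \<le> b x" by (simp add: AE_all_countable)
  then show ?thesis
  proof eventually_elim
    case (elim x)
    show ?case
    proof
      fix G assume G: "G \<in> GG"
      then have "finite (set_pmf G)" using GG mixing_leD by blast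
      then obtain t where t: "bij_betw t {0..<card (set_pmf G)} (set_pmf G)"
        using ex_bij_betw_nat_finite by blast
      define s where "s = (t, \<lambda>i. pmf G (t i))"
      have p: "par (card (set_pmf G)) G s" using t by (simp add: par_def s_def atLeast0LessThan)
      then have "s \<in> S (card (set_pmf G))" using G by (auto simp: S_def)
      then show "mixture f G x \<le> b x" using elim val[OF G p] by auto
    qed
  qed
qed

lemma Cr_extension_continuous:
  assumes "Cr_extension d r \<Theta> g h"
  shows "continuous_on \<Theta> g"
proof -
  obtain U where "\<Theta> \<subseteq> U" "Cr_on d r U h" "\<forall>\<theta>\<in>\<Theta>. h \<theta> = g \<theta>"
    using assms by (auto simp: Cr_extension_def)
  moreover from this have "continuous_on U h" by (cases r) auto
  ultimately have "continuous_on \<Theta> h" by (blast intro: continuous_on_subset)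
  then show ?thesis using \<open>\<forall>\<theta>\<in>\<Theta>. h \<theta> = g \<theta>\<close> by (subst continuous_on_cong[OF refl, of _ _ h]) auto
qed

lemma strongly_identifiable_continuous:
  assumes "strongly_identifiable d r \<nu> \<Theta> f"
  shows "AE x in \<nu>. continuous_on \<Theta> (f x)"
proof -
  obtain F where "AE x in \<nu>. Cr_extension d r \<Theta> (f x) (F x)"
    using assms unfolding strongly_identifiable_def by (elim exE conjE) (rule that)
  then show ?thesis by eventually_elim (rule Cr_extension_continuous)
qed

lemma mixtures_density_class:
  assumes d: "density_family N \<nu> \<Theta> f" and si: "strongly_identifiable d r \<nu> \<Theta> f"
    and B: "condition_B k J \<nu> \<Theta> f" "0 < J"
  shows "\<exists>A. density_class \<nu> (mixture f ` mixing_le \<Theta> k) A"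
proof -
  obtain A where A: "1000 \<le> A" "\<forall>G0\<in>mixing_le \<Theta> k. \<forall>v. 0 < v \<longrightarrow> v \<le> 1000 \<longrightarrow>
    (\<exists>B. finite B \<and> real (card B) \<le> (A / v) powr A \<and>
      (\<forall>(l, u)\<in>B. l \<in> borel_measurable \<nu> \<and> u \<in> borel_measurable \<nu> \<and>
         (\<integral>\<^sup>+x. ennreal ((u x - l x)\<^sup>2) \<partial>\<nu>) \<le> ennreal (72 / 100 * v)) \<and>
      (\<forall>G\<in>mixing_le \<Theta> k. (\<integral>x. (sqrt (bar_mixture f G0 G x) - sqrt (mixture f G0 x))\<^sup>2 \<partial>\<nu>) \<le> v \<longrightarrow>
         (\<exists>(l, u)\<in>B. AE x in \<nu>. l x \<le> sqrt (bar_mixture f G0 G x) \<and> sqrt (bar_mixture f G0 G x) \<le> u x)))"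
    using condition_B_local_brackets[OF B] by (elim exE conjE) (rule that)
  have "density_class \<nu> (mixture f ` mixing_le \<Theta> k) A"
  proof
    fix p assume "p \<in> mixture f ` mixing_le \<Theta> k"
    then obtain G where G: "G \<in> mixing_le \<Theta> k" "p = mixture f G" by blast
    show "p \<in> borel_measurable \<nu>" "\<And>x. x \<in> space \<nu> \<Longrightarrow> 0 \<le> p x" "(\<integral>\<^sup>+x. ennreal (p x) \<partial>\<nu>) = 1"
      using mixture_density[OF d G(1)] by (auto simp: G(2))
  next
    show "1000 \<le> A" by (rule A(1))
  next
    fix c and v :: real assume "c \<in> mixture f ` mixing_le \<Theta> k" and v: "0 < v" "v \<le> 1000"
    then obtain G0 where G0: "G0 \<in> mixing_le \<Theta> k" "c = mixture f G0" by blast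
    show "\<exists>B. finite B \<and> real (card B) \<le> (A / v) powr A \<and>
        (\<forall>(l, u)\<in>B. l \<in> borel_measurable \<nu> \<and> u \<in> borel_measurable \<nu> \<and>
           (\<integral>\<^sup>+x. ennreal ((u x - l x)\<^sup>2) \<partial>\<nu>) \<le> ennreal (72 / 100 * v)) \<and>
        (\<forall>p\<in>mixture f ` mixing_le \<Theta> k. (\<integral>x. (sqrt ((p x + c x) / 2) - sqrt (c x))\<^sup>2 \<partial>\<nu>) \<le> v \<longrightarrow>
           (\<exists>(l, u)\<in>B. AE x in \<nu>. l x \<le> sqrt ((p x + c x) / 2) \<and> sqrt ((p x + c x) / 2) \<le> u x))"
      using A(2)[rule_format, OF G0(1) v] unfolding bar_mixture_def G0(2) Set.ball_simps(9) .
  next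
    fix Q and b :: "rvec \<Rightarrow> real"
    assume Q: "Q \<subseteq> mixture f ` mixing_le \<Theta> k" and le: "\<And>p. p \<in> Q \<Longrightarrow> AE x in \<nu>. p x \<le> b x"
    have "AE x in \<nu>. \<forall>G\<in>{G \<in> mixing_le \<Theta> k. mixture f G \<in> Q}. mixture f G x \<le> b x"
      by (rule AE_mixture_le[OF strongly_identifiable_continuous[OF si]]) (auto intro: le)
    then show "AE x in \<nu>. \<forall>p\<in>Q. p x \<le> b x"
      by eventually_elim (use Q in auto)
  qed
  then show ?thesis by blast
qed

section \<open>Second-order Taylor expansion in coordinates\<close>

definition unit1 :: "nat \<Rightarrow> nat \<Rightarrow> nat" where
  "unit1 a = (\<lambda>i. if i = a then 1 else 0)"

definition unit2 :: "nat \<Rightarrow> nat \<Rightarrow> nat \<Rightarrow> nat" where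
  "unit2 a b = (\<lambda>i. unit1 a i + unit1 b i)"

lemma fold_partial_deriv_id:
  "(\<And>i. i \<in> set is \<Longrightarrow> \<eta> i = 0) \<Longrightarrow> fold (\<lambda>i. partial_deriv i ^^ \<eta> i) is g = g"
  by (induction "is" arbitrary: g) auto

lemma upt_split: "a < d \<Longrightarrow> m \<le> a \<Longrightarrow> [m..<d] = [m..<a] @ a # [Suc a..<d]"
  by (metis less_imp_le upt_add_eq_append le_add_diff_inverse upt_conv_Cons)

lemma mi_deriv_0: "mi_deriv d (\<lambda>_. 0) g = g"
  unfolding mi_deriv_def by (rule fold_partial_deriv_id) simp

lemma mi_deriv_unit1: "a < d \<Longrightarrow> mi_deriv d (unit1 a) g = partial_deriv a g"
proof -
  assume "a < d"
  then have "[0..<d] = [0..<a] @ a # [Suc a..<d]" by (simp add: upt_split)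
  moreover have "fold (\<lambda>i. partial_deriv i ^^ unit1 a i) [0..<a] h = h" for h
    by (rule fold_partial_deriv_id) (auto simp: unit1_def)
  moreover have "fold (\<lambda>i. partial_deriv i ^^ unit1 a i) [Suc a..<d] h = h" for h
    by (rule fold_partial_deriv_id) (auto simp: unit1_def)
  moreover have "unit1 a a = 1" by (simp add: unit1_def)
  ultimately show ?thesis by (simp add: mi_deriv_def)
qed

text \<open>The fold in \<open>mi_deriv\<close> runs through the coordinates in increasing order, so
  the derivative in the smaller coordinate is taken first.\<close>

lemma mi_deriv_unit2: "a \<le> b \<Longrightarrow> b < d \<Longrightarrow> mi_deriv d (unit2 a b) g = partial_deriv b (partial_deriv a g)"
proof -
  assume ab: "a \<le> b" "b < d"
  have 1: "fold (\<lambda>i. partial_deriv i ^^ unit2 a b i) [0..<a] h = h" for h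
    by (rule fold_partial_deriv_id) (use ab in \<open>auto simp: unit2_def unit1_def\<close>)
  have 2: "fold (\<lambda>i. partial_deriv i ^^ unit2 a b i) [Suc a..<b] h = h" for h
    by (rule fold_partial_deriv_id) (auto simp: unit2_def unit1_def)
  have 3: "fold (\<lambda>i. partial_deriv i ^^ unit2 a b i) [Suc b..<d] h = h" for h
    by (rule fold_partial_deriv_id) (use ab in \<open>auto simp: unit2_def unit1_def\<close>)
  show ?thesis
  proof (cases "a = b")
    case True
    have "[0..<d] = [0..<b] @ b # [Suc b..<d]" by (rule upt_split) (use ab in auto)
    moreover have "unit2 a b b = Suc (Suc 0)" using True by (simp add: unit2_def unit1_def)
    ultimately show ?thesis using 1 3 True by (simp add: mi_deriv_def)
  next
    case False
    have "[0..<d] = [0..<a] @ a # [Suc a..<d]" by (rule upt_split) (use ab in auto)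
    also have "[Suc a..<d] = [Suc a..<b] @ b # [Suc b..<d]" by (rule upt_split) (use ab False in auto)
    finally have "[0..<d] = [0..<a] @ a # [Suc a..<b] @ b # [Suc b..<d]" .
    moreover have "unit2 a b a = 1" "unit2 a b b = 1" using False by (auto simp: unit2_def unit1_def)
    ultimately show ?thesis using 1 2 3 by (simp add: mi_deriv_def)
  qed
qed

lemma unit_multi_indices:
  "(\<lambda>_. 0) \<in> multi_indices d 2"
  "a < d \<Longrightarrow> unit1 a \<in> multi_indices d 2"
  "a < d \<Longrightarrow> b < d \<Longrightarrow> unit2 a b \<in> multi_indices d 2"
  by (auto simp: multi_indices_def mi_order_def unit1_def unit2_def sum.distrib)

lemma unit1_eq_0: "unit1 a \<noteq> (\<lambda>_. 0)"
  by (auto simp: unit1_def fun_eq_iff)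

lemma unit2_eq_0: "unit2 a b \<noteq> (\<lambda>_. 0)"
  by (auto simp: unit2_def unit1_def fun_eq_iff)

lemma unit1_inject: "unit1 a = unit1 b \<longleftrightarrow> a = b"
  by (auto simp: unit1_def fun_eq_iff split: if_splits)

lemma unit2_neq_unit1: "unit2 a b \<noteq> unit1 c"
proof
  assume "unit2 a b = unit1 c"
  then have "unit2 a b a = unit1 c a" "unit2 a b b = unit1 c b" "unit2 a b c = unit1 c c" by simp_all
  then show False by (auto simp: unit2_def unit1_def split: if_splits)
qed

lemma unit2_diag: "unit2 a a = unit2 b c \<longleftrightarrow> b = a \<and> c = a"
proof
  assume "unit2 a a = unit2 b c"
  then have "unit2 a a a = unit2 b c a" by simp
  then show "b = a \<and> c = a" by (auto simp: unit2_def unit1_def split: if_splits)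
qed auto

section \<open>Taylor formulas on the line and neighbourhoods described by coordinates\<close>

lemma Taylor_at_0:
  fixes \<phi> :: "real \<Rightarrow> real"
  assumes "\<And>s. \<bar>s - x\<bar> \<le> \<bar>y - x\<bar> \<Longrightarrow> (\<phi> has_real_derivative \<phi>' s) (at s)"
  obtains \<xi> where "\<bar>\<xi> - x\<bar> \<le> \<bar>y - x\<bar>" "\<phi> y - \<phi> x = (y - x) * \<phi>' \<xi>"
proof (cases "y = x")
  case True then show ?thesis by (intro that[of x]) auto
next
  case False
  define D where "D = (\<lambda>m::nat. if m = 0 then \<phi> else \<phi>')"
  have "\<exists>t. (if y < x then y < t \<and> t < x else x < t \<and> t < y) \<and>
      \<phi> y = (\<Sum>m<1. (D m x / fact m) * (y - x) ^ m) + (D 1 t / fact 1) * (y - x) ^ 1"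
  proof (rule Taylor[where a = "min x y" and b = "max x y"])
    show "\<forall>m t. m < 1 \<and> min x y \<le> t \<and> t \<le> max x y \<longrightarrow> (D m has_real_derivative D (Suc m) t) (at t)"
      using assms by (auto simp: D_def min_def max_def split: if_splits)
  qed (use False in \<open>auto simp: D_def\<close>)
  then obtain t where "if y < x then y < t \<and> t < x else x < t \<and> t < y" "\<phi> y = \<phi> x + \<phi>' t * (y - x)"
    by (auto simp: D_def)
  then show ?thesis by (intro that[of t]) (auto simp: mult.commute split: if_splits)
qed

lemma Taylor_at_1:
  fixes \<phi> :: "real \<Rightarrow> real"
  assumes "\<And>s. \<bar>s - x\<bar> \<le> \<bar>y - x\<bar> \<Longrightarrow> (\<phi> has_real_derivative \<phi>' s) (at s)"
    and "\<And>s. \<bar>s - x\<bar> \<le> \<bar>y - x\<bar> \<Longrightarrow> (\<phi>' has_real_derivative \<phi>'' s) (at s)"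
  obtains \<xi> where "\<bar>\<xi> - x\<bar> \<le> \<bar>y - x\<bar>" "\<phi> y - \<phi> x = (y - x) * \<phi>' x + (y - x)\<^sup>2 / 2 * \<phi>'' \<xi>"
proof (cases "y = x")
  case True then show ?thesis by (intro that[of x]) auto
next
  case False
  define D where "D = (\<lambda>m::nat. if m = 0 then \<phi> else if m = 1 then \<phi>' else \<phi>'')"
  have "\<exists>t. (if y < x then y < t \<and> t < x else x < t \<and> t < y) \<and>
      \<phi> y = (\<Sum>m<2. (D m x / fact m) * (y - x) ^ m) + (D 2 t / fact 2) * (y - x) ^ 2"
  proof (rule Taylor[where a = "min x y" and b = "max x y"])
    show "\<forall>m t. m < 2 \<and> min x y \<le> t \<and> t \<le> max x y \<longrightarrow> (D m has_real_derivative D (Suc m) t) (at t)"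
      using assms by (auto simp: D_def less_2_cases_iff min_def max_def split: if_splits)
  qed (use False in \<open>auto simp: D_def\<close>)
  then obtain t where "if y < x then y < t \<and> t < x else x < t \<and> t < y"
    "\<phi> y = \<phi> x + \<phi>' x * (y - x) + \<phi>'' t / 2 * (y - x)\<^sup>2"
    by (auto simp: D_def numeral_2_eq_2)
  then show ?thesis by (intro that[of t]) (auto simp: mult.commute split: if_splits)
qed

text \<open>The neighbourhoods of \<open>\<tau>\<close> in \<open>R^d\<close>, generated by
  coordinate boxes; the box form suits a Taylor expansion that changes one coordinate at a
  time.\<close>

definition near :: "nat \<Rightarrow> rvec \<Rightarrow> (rvec \<Rightarrow> bool) \<Rightarrow> bool" where
  "near d \<tau> Q \<longleftrightarrow> (\<exists>\<rho>>0. \<forall>\<theta>\<in>topspace (Euclidean_space d). (\<forall>i<d. \<bar>\<theta> i - \<tau> i\<bar> < \<rho>) \<longrightarrow> Q \<theta>)"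

lemma near_conj: "near d \<tau> Q \<Longrightarrow> near d \<tau> R \<Longrightarrow> near d \<tau> (\<lambda>\<theta>. Q \<theta> \<and> R \<theta>)"
proof -
  assume "near d \<tau> Q" "near d \<tau> R"
  then obtain \<rho> \<rho>' where "\<rho> > 0" "\<forall>\<theta>\<in>topspace (Euclidean_space d). (\<forall>i<d. \<bar>\<theta> i - \<tau> i\<bar> < \<rho>) \<longrightarrow> Q \<theta>"
    "\<rho>' > 0" "\<forall>\<theta>\<in>topspace (Euclidean_space d). (\<forall>i<d. \<bar>\<theta> i - \<tau> i\<bar> < \<rho>') \<longrightarrow> R \<theta>"
    unfolding near_def by blast
  then show ?thesis unfolding near_def by (intro exI[of _ "min \<rho> \<rho>'"]) auto
qed

lemma near_mono: "near d \<tau> Q \<Longrightarrow> (\<And>\<theta>. Q \<theta> \<Longrightarrow> R \<theta>) \<Longrightarrow> near d \<tau> R"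
  unfolding near_def by blast

lemma near_ball: "finite I \<Longrightarrow> (\<And>i. i \<in> I \<Longrightarrow> near d \<tau> (Q i)) \<Longrightarrow> near d \<tau> (\<lambda>\<theta>. \<forall>i\<in>I. Q i \<theta>)"
proof (induction I rule: finite_induct)
  case empty
  then show ?case by (auto simp: near_def intro: exI[of _ 1])
next
  case (insert i I)
  then have "near d \<tau> (\<lambda>\<theta>. Q i \<theta> \<and> (\<forall>i\<in>I. Q i \<theta>))" by (intro near_conj) auto
  then show ?case by simp
qed

text \<open>An open set of the product topology contains a basic box. Only its first
  \<open>d\<close> sides matter, since all later coordinates of points of \<open>R^d\<close>
  vanish.\<close>

lemma near_openin:
  assumes "openin (Euclidean_space d) U" "\<tau> \<in> U"
  shows "near d \<tau> (\<lambda>\<theta>. \<theta> \<in> U)"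
proof -
  obtain T where T: "openin (powertop_real UNIV) T" "U = T \<inter> {x. \<forall>i\<ge>d. x i = 0}"
    using assms(1) by (auto simp: Euclidean_space_def openin_subtopology)
  then have "\<tau> \<in> T" using assms(2) by simp
  then obtain X where X: "\<tau> \<in> (\<Pi>\<^sub>E i\<in>UNIV. X i)" "\<And>i. open (X i)" "(\<Pi>\<^sub>E i\<in>UNIV. X i) \<subseteq> T"
    using product_topology_open_contains_basis[OF T(1) \<open>\<tau> \<in> T\<close>] by auto
  have "\<exists>\<rho>>0. \<forall>y. \<bar>y - \<tau> i\<bar> < \<rho> \<longrightarrow> y \<in> X i" for i
  proof -
    have "\<tau> i \<in> X i" using X(1) by auto
    then obtain \<epsilon> where \<epsilon>: "0 < \<epsilon>" "ball (\<tau> i) \<epsilon> \<subseteq> X i" using openE[OF X(2)] by metis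
    have "y \<in> X i" if "\<bar>y - \<tau> i\<bar> < \<epsilon>" for y
      using \<epsilon>(2) that by (auto simp: subset_iff dist_real_def abs_minus_commute)
    then show ?thesis using \<epsilon>(1) by blast
  qed
  then obtain \<rho> where \<rho>: "\<And>i. 0 < \<rho> i" "\<And>i y. \<bar>y - \<tau> i\<bar> < \<rho> i \<Longrightarrow> y \<in> X i" by metis
  define r where "r = Min (insert 1 (\<rho> ` {..<d}))"
  have r: "0 < r" "\<And>i. i < d \<Longrightarrow> r \<le> \<rho> i" using \<rho>(1) by (auto simp: r_def)
  have "\<theta> \<in> U" if "\<theta> \<in> topspace (Euclidean_space d)" "\<forall>i<d. \<bar>\<theta> i - \<tau> i\<bar> < r" for \<theta>
  proof -
    have "\<theta> i \<in> X i" for i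
    proof (cases "i < d")
      case True then show ?thesis using that r \<rho>(2) by (meson order_less_le_trans)
    next
      case False
      then have "\<theta> i = \<tau> i" using that assms(2) T(2) by (simp add: topspace_Euclidean_space)
      then show ?thesis using X(1) by auto
    qed
    then have "\<theta> \<in> T" using X(3) by auto
    then show ?thesis using that T(2) by (simp add: topspace_Euclidean_space)
  qed
  then show ?thesis unfolding near_def using r(1) by blast
qed

lemma near_continuous:
  assumes U: "openin (Euclidean_space d) U" "\<tau> \<in> U" and F: "continuous_on U F" and e: "0 < (e::real)"
  shows "near d \<tau> (\<lambda>\<theta>. \<bar>F \<theta> - F \<tau>\<bar> < e)"
proof -
  have "open {F \<tau> - e<..<F \<tau> + e}" by simp
  then obtain V where V: "open V" "V \<inter> U = F -` {F \<tau> - e<..<F \<tau> + e} \<inter> U"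
    using F unfolding continuous_on_open_invariant by metis
  have "openin (Euclidean_space d) (V \<inter> U)"
  proof -
    obtain T where T: "openin (powertop_real UNIV) T" "U = T \<inter> {x. \<forall>i\<ge>d. x i = 0}"
      using U(1) by (auto simp: Euclidean_space_def openin_subtopology)
    have "openin (powertop_real UNIV) V" using V(1) by (simp add: euclidean_product_topology)
    then have "openin (powertop_real UNIV) (V \<inter> T)" using T(1) by (rule openin_Int)
    then show ?thesis unfolding Euclidean_space_def openin_subtopology T(2) by blast
  qed
  moreover have "\<tau> \<in> V \<inter> U" unfolding V(2) using U(2) e by simp
  ultimately have "near d \<tau> (\<lambda>\<theta>. \<theta> \<in> V \<inter> U)" by (rule near_openin)
  then show ?thesis unfolding V(2) by (rule near_mono) auto
qed

text \<open>The coordinates are changed one at a time, starting with the last one; this produces the mixed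
  derivatives in the order in which \<^const>\<open>mi_deriv\<close> takes them.\<close>

lemma second_order_Taylor:
  assumes U: "openin (Euclidean_space d) U" "\<tau> \<in> U" and g: "Cr_on d 2 U g" and e: "0 < e"
  shows "near d \<tau> (\<lambda>\<theta>. \<bar>g \<theta> - g \<tau> - (\<Sum>a<d. (\<theta> a - \<tau> a) * partial_deriv a g \<tau>)
    - (\<Sum>a<d. (\<theta> a - \<tau> a)\<^sup>2 / 2 * partial_deriv a (partial_deriv a g) \<tau>
        + (\<Sum>b=Suc a..<d. (\<theta> a - \<tau> a) * (\<theta> b - \<tau> b) * partial_deriv b (partial_deriv a g) \<tau>))\<bar>
    \<le> e * (\<Sum>a<d. \<bar>\<theta> a - \<tau> a\<bar>)\<^sup>2)"
proof -
  let ?p = "\<lambda>a. partial_deriv a g" and ?q = "\<lambda>a b. partial_deriv b (partial_deriv a g)"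
  have g1: "\<And>a \<theta>. a < d \<Longrightarrow> \<theta> \<in> U \<Longrightarrow> (\<lambda>t. g (\<theta>(a := t))) field_differentiable at (\<theta> a)"
    and g2: "\<And>a b \<theta>. a < d \<Longrightarrow> b < d \<Longrightarrow> \<theta> \<in> U \<Longrightarrow> (\<lambda>t. ?p a (\<theta>(b := t))) field_differentiable at (\<theta> b)"
    and g3: "\<And>a b. a < d \<Longrightarrow> b < d \<Longrightarrow> continuous_on U (?q a b)"
    using g by (simp_all add: numeral_2_eq_2)
  have d1: "((\<lambda>t. g (z(a := t))) has_real_derivative ?p a (z(a := s))) (at s)"
    if "a < d" "z(a := s) \<in> U" for a z s
    using g1[OF that] by (simp add: partial_deriv_def field_differentiable_derivI)
  have d2: "((\<lambda>t. ?p a (z(b := t))) has_real_derivative ?q a b (z(b := s))) (at s)"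
    if "a < d" "b < d" "z(b := s) \<in> U" for a b z s
    using g2[OF that] by (simp add: partial_deriv_def[of b] field_differentiable_derivI)
  have "near d \<tau> (\<lambda>\<theta>. \<forall>ab\<in>{..<d} \<times> {..<d}. \<bar>?q (fst ab) (snd ab) \<theta> - ?q (fst ab) (snd ab) \<tau>\<bar> < e)"
    by (intro near_ball near_continuous[OF U] e) (auto intro: g3)
  from near_conj[OF near_openin[OF U] this] obtain \<rho> where \<rho>: "0 < \<rho>"
    and box: "\<And>\<theta>. \<theta> \<in> topspace (Euclidean_space d) \<Longrightarrow> (\<And>i. i < d \<Longrightarrow> \<bar>\<theta> i - \<tau> i\<bar> < \<rho>) \<Longrightarrow>
      \<theta> \<in> U \<and> (\<forall>a<d. \<forall>b<d. \<bar>?q a b \<theta> - ?q a b \<tau>\<bar> < e)"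
    unfolding near_def by force
  have t0: "\<tau> i = 0" if "d \<le> i" for i
    using U that openin_subset[OF U(1)] by (auto simp: topspace_Euclidean_space subset_iff)
  show ?thesis
    unfolding near_def
  proof (intro exI[of _ \<rho>] conjI \<rho> ballI impI)
    fix \<theta> assume th: "\<theta> \<in> topspace (Euclidean_space d)" and r: "\<forall>i<d. \<bar>\<theta> i - \<tau> i\<bar> < \<rho>"
    \<comment> \<open>A path from \<open>z 0 = \<theta>\<close> to \<open>z d = \<tau>\<close>,
      whose step from \<open>z a\<close> to \<open>z (Suc a)\<close> resets coordinate
      \<open>a\<close>.\<close>
    define z where "z = (\<lambda>j i. if i < j then \<tau> i else \<theta> i)"
    define \<Delta> where "\<Delta> = (\<lambda>a. \<theta> a - \<tau> a)"
    have z0: "z 0 = \<theta>" by (auto simp: z_def)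
    have zd: "z d = \<tau>" using th t0 by (auto simp: z_def topspace_Euclidean_space fun_eq_iff)
    have zs: "z a = (z (Suc a))(a := \<theta> a)" "z (Suc a) = (z (Suc a))(a := \<tau> a)" for a
      by (auto simp: z_def fun_eq_iff less_Suc_eq)
    have inbox: "(z (Suc a))(a := s) \<in> U \<and> (\<forall>a'<d. \<forall>b<d. \<bar>?q a' b ((z (Suc a))(a := s)) - ?q a' b \<tau>\<bar> < e)"
      if "a < d" "\<bar>s - \<tau> a\<bar> \<le> \<bar>\<theta> a - \<tau> a\<bar>" for a s
    proof (rule box)
      show "(z (Suc a))(a := s) \<in> topspace (Euclidean_space d)"
        using that th t0 by (auto simp: z_def topspace_Euclidean_space)
      show "\<bar>((z (Suc a))(a := s)) i - \<tau> i\<bar> < \<rho>" if "i < d" for i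
        using that r \<rho> \<open>\<bar>s - \<tau> a\<bar> \<le> \<bar>\<theta> a - \<tau> a\<bar>\<close> \<open>a < d\<close> by (auto simp: z_def intro: le_less_trans)
    qed
    have first: "\<bar>?p a (z j) - ?p a (z (Suc j)) - \<Delta> j * ?q a j \<tau>\<bar> \<le> \<bar>\<Delta> j\<bar> * e" if "a < d" "j < d" for a j
    proof -
      have der: "((\<lambda>t. ?p a ((z (Suc j))(j := t))) has_real_derivative ?q a j ((z (Suc j))(j := s))) (at s)"
        if s: "\<bar>s - \<tau> j\<bar> \<le> \<bar>\<theta> j - \<tau> j\<bar>" for s
        using d2 inbox[OF _ s] \<open>a < d\<close> \<open>j < d\<close> by blast
      obtain \<xi> where \<xi>: "\<bar>\<xi> - \<tau> j\<bar> \<le> \<bar>\<theta> j - \<tau> j\<bar>"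
        "?p a ((z (Suc j))(j := \<theta> j)) - ?p a ((z (Suc j))(j := \<tau> j)) = (\<theta> j - \<tau> j) * ?q a j ((z (Suc j))(j := \<xi>))"
        by (rule Taylor_at_0[of "\<tau> j" "\<theta> j" "\<lambda>t. ?p a ((z (Suc j))(j := t))" "\<lambda>t. ?q a j ((z (Suc j))(j := t))"])
          (rule der, assumption)
      have "\<bar>?p a (z j) - ?p a (z (Suc j)) - \<Delta> j * ?q a j \<tau>\<bar> = \<bar>\<Delta> j * (?q a j ((z (Suc j))(j := \<xi>)) - ?q a j \<tau>)\<bar>"
        using \<xi>(2) unfolding zs(1)[symmetric] zs(2)[symmetric] \<Delta>_def by (simp add: algebra_simps)
      also have "\<dots> \<le> \<bar>\<Delta> j\<bar> * e"
        unfolding abs_mult using inbox[OF that(2) \<xi>(1)] that by (intro mult_left_mono) (auto intro: less_imp_le)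
      finally show ?thesis .
    qed
    \<comment> \<open>The point \<open>z (Suc a)\<close> differs from \<open>\<tau>\<close> only in
      coordinates above \<open>a\<close>, so moving the first derivative to \<open>\<tau>\<close>
      yields exactly the mixed terms with \<open>b > a\<close>.\<close>
    have grad: "\<bar>?p a (z (Suc a)) - ?p a \<tau> - (\<Sum>b=Suc a..<d. \<Delta> b * ?q a b \<tau>)\<bar> \<le> (\<Sum>b=Suc a..<d. \<bar>\<Delta> b\<bar>) * e" if a: "a < d" for a
    proof -
      have "(\<Sum>j=Suc a..<d. ?p a (z (Suc j)) - ?p a (z j)) = ?p a (z d) - ?p a (z (Suc a))"
        using a by (intro sum_Suc_diff') simp
      then have "?p a (z (Suc a)) - ?p a \<tau> = (\<Sum>j=Suc a..<d. ?p a (z j) - ?p a (z (Suc j)))"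
        by (simp add: zd sum_subtractf)
      then have "?p a (z (Suc a)) - ?p a \<tau> - (\<Sum>b=Suc a..<d. \<Delta> b * ?q a b \<tau>)
          = (\<Sum>j=Suc a..<d. ?p a (z j) - ?p a (z (Suc j)) - \<Delta> j * ?q a j \<tau>)"
        by (simp add: sum_subtractf)
      also have "\<bar>\<dots>\<bar> \<le> (\<Sum>j=Suc a..<d. \<bar>\<Delta> j\<bar> * e)"
        by (rule order_trans[OF sum_abs]) (intro sum_mono first a, auto)
      finally show ?thesis by (simp add: sum_distrib_right)
    qed
    define s where "s = (\<Sum>a<d. \<bar>\<Delta> a\<bar>)"
    have second: "\<bar>g (z a) - g (z (Suc a)) - \<Delta> a * ?p a \<tau> - ((\<Delta> a)\<^sup>2 / 2 * ?q a a \<tau> + (\<Sum>b=Suc a..<d. \<Delta> a * \<Delta> b * ?q a b \<tau>))\<bar>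
        \<le> \<bar>\<Delta> a\<bar> * (e * s)" if a: "a < d" for a
    proof -
      have der: "((\<lambda>t. g ((z (Suc a))(a := t))) has_real_derivative ?p a ((z (Suc a))(a := s))) (at s)"
        "((\<lambda>t. ?p a ((z (Suc a))(a := t))) has_real_derivative ?q a a ((z (Suc a))(a := s))) (at s)"
        if s: "\<bar>s - \<tau> a\<bar> \<le> \<bar>\<theta> a - \<tau> a\<bar>" for s
        using d1 d2 inbox[OF a s] a by blast+
      obtain \<xi> where \<xi>: "\<bar>\<xi> - \<tau> a\<bar> \<le> \<bar>\<theta> a - \<tau> a\<bar>"
        "g ((z (Suc a))(a := \<theta> a)) - g ((z (Suc a))(a := \<tau> a)) =
          (\<theta> a - \<tau> a) * ?p a ((z (Suc a))(a := \<tau> a)) + (\<theta> a - \<tau> a)\<^sup>2 / 2 * ?q a a ((z (Suc a))(a := \<xi>))"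
        by (rule Taylor_at_1[of "\<tau> a" "\<theta> a" "\<lambda>t. g ((z (Suc a))(a := t))" "\<lambda>t. ?p a ((z (Suc a))(a := t))" "\<lambda>t. ?q a a ((z (Suc a))(a := t))"])
          (rule der(1), assumption, rule der(2), assumption)
      then have eq: "g (z a) - g (z (Suc a)) = \<Delta> a * ?p a (z (Suc a)) + (\<Delta> a)\<^sup>2 / 2 * ?q a a ((z (Suc a))(a := \<xi>))"
        unfolding zs(1)[symmetric] zs(2)[symmetric] \<Delta>_def by simp
      define G where "G = ?p a (z (Suc a)) - ?p a \<tau> - (\<Sum>b=Suc a..<d. \<Delta> b * ?q a b \<tau>)"
      define H where "H = ?q a a ((z (Suc a))(a := \<xi>)) - ?q a a \<tau>"
      have eq2: "g (z a) - g (z (Suc a)) - \<Delta> a * ?p a \<tau> - ((\<Delta> a)\<^sup>2 / 2 * ?q a a \<tau> + (\<Sum>b=Suc a..<d. \<Delta> a * \<Delta> b * ?q a b \<tau>))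
        = \<Delta> a * G + (\<Delta> a)\<^sup>2 / 2 * H"
        unfolding eq G_def H_def by (simp add: algebra_simps sum_distrib_left)
      have "\<bar>\<Delta> a * G + (\<Delta> a)\<^sup>2 / 2 * H\<bar> \<le> \<bar>\<Delta> a\<bar> * \<bar>G\<bar> + (\<Delta> a)\<^sup>2 / 2 * \<bar>H\<bar>"
        by (rule order_trans[OF abs_triangle_ineq]) (simp add: abs_mult)
      also have "\<dots> \<le> \<bar>\<Delta> a\<bar> * ((\<Sum>b=Suc a..<d. \<bar>\<Delta> b\<bar>) * e) + (\<Delta> a)\<^sup>2 / 2 * e"
      proof -
        have "\<bar>H\<bar> \<le> e"
          unfolding H_def by (rule less_imp_le) (rule inbox[OF a \<xi>(1), THEN conjunct2, rule_format, OF a a])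
        then show ?thesis unfolding G_def by (intro add_mono mult_left_mono grad[OF a]) auto
      qed
      also have "\<dots> = \<bar>\<Delta> a\<bar> * (e * ((\<Sum>b=Suc a..<d. \<bar>\<Delta> b\<bar>) + \<bar>\<Delta> a\<bar> / 2))"
      proof -
        have "(\<Delta> a)\<^sup>2 = \<bar>\<Delta> a\<bar> * \<bar>\<Delta> a\<bar>" by (simp add: power2_eq_square)
        then show ?thesis by (simp add: distrib_left mult_ac)
      qed
      also have "\<dots> \<le> \<bar>\<Delta> a\<bar> * (e * s)"
      proof -
        have "(\<Sum>b=Suc a..<d. \<bar>\<Delta> b\<bar>) + \<bar>\<Delta> a\<bar> = (\<Sum>b=a..<d. \<bar>\<Delta> b\<bar>)"
          using a by (simp add: sum.atLeast_Suc_lessThan)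
        also have "\<dots> \<le> s" unfolding s_def by (intro sum_mono2) auto
        finally have "(\<Sum>b=Suc a..<d. \<bar>\<Delta> b\<bar>) + \<bar>\<Delta> a\<bar> / 2 \<le> s" using abs_ge_zero[of "\<Delta> a"] by linarith
        then show ?thesis using e by (intro mult_left_mono) auto
      qed
      finally show ?thesis unfolding eq2 .
    qed
    have "g \<theta> - g \<tau> = (\<Sum>a<d. g (z a) - g (z (Suc a)))"
      using sum_lessThan_telescope'[of "\<lambda>a. g (z a)" d] by (simp add: z0 zd)
    then have eq3: "g \<theta> - g \<tau> - (\<Sum>a<d. \<Delta> a * ?p a \<tau>) - (\<Sum>a<d. (\<Delta> a)\<^sup>2 / 2 * ?q a a \<tau> + (\<Sum>b=Suc a..<d. \<Delta> a * \<Delta> b * ?q a b \<tau>))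
      = (\<Sum>a<d. g (z a) - g (z (Suc a)) - \<Delta> a * ?p a \<tau> - ((\<Delta> a)\<^sup>2 / 2 * ?q a a \<tau> + (\<Sum>b=Suc a..<d. \<Delta> a * \<Delta> b * ?q a b \<tau>)))"
      by (simp add: sum_subtractf)
    have "\<bar>g \<theta> - g \<tau> - (\<Sum>a<d. \<Delta> a * ?p a \<tau>) - (\<Sum>a<d. (\<Delta> a)\<^sup>2 / 2 * ?q a a \<tau> + (\<Sum>b=Suc a..<d. \<Delta> a * \<Delta> b * ?q a b \<tau>))\<bar> \<le> (\<Sum>a<d. \<bar>\<Delta> a\<bar> * (e * s))"
      unfolding eq3 by (rule order_trans[OF sum_abs]) (intro sum_mono second, auto)
    also have "\<dots> = e * s\<^sup>2" by (simp add: sum_distrib_right[symmetric] s_def power2_eq_square)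
    finally show "\<bar>g \<theta> - g \<tau> - (\<Sum>a<d. (\<theta> a - \<tau> a) * partial_deriv a g \<tau>)
    - (\<Sum>a<d. (\<theta> a - \<tau> a)\<^sup>2 / 2 * partial_deriv a (partial_deriv a g) \<tau>
        + (\<Sum>b=Suc a..<d. (\<theta> a - \<tau> a) * (\<theta> b - \<tau> b) * partial_deriv b (partial_deriv a g) \<tau>))\<bar>
    \<le> e * (\<Sum>a<d. \<bar>\<theta> a - \<tau> a\<bar>)\<^sup>2"
      by (simp add: \<Delta>_def s_def)
  qed
qed

section \<open>The loss is bounded by the distance of the densities\<close>

lemma edist_nonneg: "0 \<le> edist d \<theta> \<tau>"
  by (simp add: edist_def L2_set_nonneg)

lemma edist_power2: "(edist d \<theta> \<tau>)\<^sup>2 = (\<Sum>a<d. (\<theta> a - \<tau> a)\<^sup>2)"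
  by (simp add: edist_def L2_set_def sum_nonneg)

lemma abs_coordinate_le_edist: "a < d \<Longrightarrow> \<bar>\<theta> a - \<tau> a\<bar> \<le> edist d \<theta> \<tau>"
proof -
  assume "a < d"
  then have "(\<theta> a - \<tau> a)\<^sup>2 \<le> (edist d \<theta> \<tau>)\<^sup>2"
    unfolding edist_power2 by (intro member_le_sum) auto
  then show ?thesis using edist_nonneg by (metis abs_le_square_iff abs_of_nonneg)
qed

lemma edist_le_sum_abs: "edist d \<theta> \<tau> \<le> (\<Sum>a<d. \<bar>\<theta> a - \<tau> a\<bar>)"
  unfolding edist_def by (rule L2_set_le_sum_abs)

lemma sum_abs_le_edist: "(\<Sum>a<d. \<bar>\<theta> a - \<tau> a\<bar>) \<le> real d * edist d \<theta> \<tau>"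
  using sum_mono[of "{..<d}" "\<lambda>a. \<bar>\<theta> a - \<tau> a\<bar>" "\<lambda>_. edist d \<theta> \<tau>"] abs_coordinate_le_edist by simp

lemma tendsto_coordinate:
  fixes X :: "'b \<Rightarrow> 'i \<Rightarrow> 'a::topological_space"
  assumes "(X \<longlongrightarrow> L) F"
  shows "((\<lambda>n. X n a) \<longlongrightarrow> L a) F"
  by (rule continuous_on_tendsto_compose[OF continuous_on_product_coordinates[of a] assms]) auto

lemma tendsto_edist:
  assumes "(X \<longlongrightarrow> L) F"
  shows "((\<lambda>n. edist d (X n) \<tau>) \<longlongrightarrow> edist d L \<tau>) F"
proof -
  have coord: "((\<lambda>n. X n a) \<longlongrightarrow> L a) F" for a by (rule tendsto_coordinate[OF assms])
  show ?thesis unfolding edist_def L2_set_def by (intro tendsto_intros coord)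
qed

lemma continuous_on_edist: "continuous_on S (\<lambda>\<theta>. edist d \<theta> \<tau>)"
proof -
  have coord: "continuous_on S (\<lambda>\<theta>. \<theta> a :: real)" for a
    by (rule continuous_on_subset[OF continuous_on_product_coordinates subset_UNIV])
  show ?thesis unfolding edist_def L2_set_def by (intro continuous_intros coord)
qed

lemma compactin_Euclidean_space:
  assumes "compactin (Euclidean_space d) \<Theta>"
  shows "compact \<Theta>" "\<Theta> \<subseteq> topspace (Euclidean_space d)"
  using assms by (auto simp: Euclidean_space_def compactin_subtopology euclidean_product_topology)

lemma edist_pos:
  assumes "\<theta> \<in> topspace (Euclidean_space d)" "\<tau> \<in> topspace (Euclidean_space d)" "\<theta> \<noteq> \<tau>"
  shows "0 < edist d \<theta> \<tau>"
proof (rule ccontr)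
  assume "\<not> 0 < edist d \<theta> \<tau>"
  then have 0: "edist d \<theta> \<tau> = 0" using edist_nonneg[of d \<theta> \<tau>] by simp
  have "\<theta> a = \<tau> a" for a
  proof (cases "a < d")
    case True then show ?thesis using abs_coordinate_le_edist[OF True, of \<theta> \<tau>] 0 by simp
  next
    case False then show ?thesis using assms by (simp add: topspace_Euclidean_space)
  qed
  then show False using assms(3) by blast
qed

lemma edist_bounded:
  assumes "compactin (Euclidean_space d) \<Theta>" "finite S"
  shows "\<exists>R\<ge>1. \<forall>\<theta>\<in>\<Theta>. \<forall>\<tau>\<in>S. edist d \<theta> \<tau> \<le> R"
proof -
  have "\<exists>R. \<forall>\<theta>\<in>\<Theta>. edist d \<theta> \<tau> \<le> R" for \<tau>
  proof -
    have "compact ((\<lambda>\<theta>. edist d \<theta> \<tau>) ` \<Theta>)"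
      by (intro compact_continuous_image continuous_on_edist compactin_Euclidean_space(1)[OF assms(1)])
    then have "bdd_above ((\<lambda>\<theta>. edist d \<theta> \<tau>) ` \<Theta>)" by (intro bounded_imp_bdd_above compact_imp_bounded)
    then show ?thesis by (auto simp: bdd_above_def)
  qed
  then obtain R where R: "\<And>\<tau> \<theta>. \<theta> \<in> \<Theta> \<Longrightarrow> edist d \<theta> \<tau> \<le> R \<tau>" by metis
  have "edist d \<theta> \<tau> \<le> Max (insert 1 (R ` S))" if "\<theta> \<in> \<Theta>" "\<tau> \<in> S" for \<theta> \<tau>
    using R[OF that(1), of \<tau>] that(2) assms(2) by (auto intro: order_trans Max_ge)
  moreover have "1 \<le> Max (insert 1 (R ` S))" using assms(2) by auto
  ultimately show ?thesis by blast
qed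

section \<open>Crude bounds, compactness and representations with a fixed number of atoms\<close>

lemma voronoi_cell_subset: "voronoi_cell d G G0 \<tau> \<subseteq> set_pmf G"
  by (auto simp: voronoi_cell_def)

lemma sum_pmf_le_1: "finite A \<Longrightarrow> (\<Sum>\<theta>\<in>A. pmf G \<theta>) \<le> 1"
  by (simp add: measure_measure_pmf_finite[symmetric])

lemma voronoi_loss_bounded:
  assumes "compactin (Euclidean_space d) \<Theta>" "finite (set_pmf G0)"
  shows "\<exists>D\<ge>0. \<forall>G\<in>mixing_le \<Theta> k. voronoi_loss d G G0 \<le> D"
proof -
  obtain R where R: "1 \<le> R" "\<And>\<theta> \<tau>. \<theta> \<in> \<Theta> \<Longrightarrow> \<tau> \<in> set_pmf G0 \<Longrightarrow> edist d \<theta> \<tau> \<le> R"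
    using edist_bounded[OF assms] by blast
  let ?K = "real (card (set_pmf G0))"
  have "voronoi_loss d G G0 \<le> ?K * R\<^sup>2 + ?K * R + ?K * 1" if G: "G \<in> mixing_le \<Theta> k" for G
  proof -
    note fin = mixing_leD[OF G]
    let ?c = "voronoi_cell d G G0"
    have fc: "finite (?c \<tau>)" for \<tau> using finite_subset[OF voronoi_cell_subset fin(1)] .
    have c\<Theta>: "\<theta> \<in> \<Theta>" if "\<theta> \<in> ?c \<tau>" for \<theta> \<tau> using that voronoi_cell_subset fin(2) by blast
    have gen: "(\<Sum>\<theta>\<in>?c \<tau>. pmf G \<theta> * h \<theta>) \<le> B" if "\<And>\<theta>. \<theta> \<in> ?c \<tau> \<Longrightarrow> h \<theta> \<le> B" "0 \<le> B" for \<tau> h and B :: real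
    proof -
      have "(\<Sum>\<theta>\<in>?c \<tau>. pmf G \<theta> * h \<theta>) \<le> (\<Sum>\<theta>\<in>?c \<tau>. pmf G \<theta> * B)"
        using that by (intro sum_mono mult_left_mono) auto
      also have "\<dots> = (\<Sum>\<theta>\<in>?c \<tau>. pmf G \<theta>) * B" by (simp add: sum_distrib_right)
      also have "\<dots> \<le> 1 * B" using that sum_pmf_le_1[OF fc] by (intro mult_right_mono) auto
      finally show ?thesis by simp
    qed
    have outer: "(\<Sum>\<tau>\<in>A. h \<tau>) \<le> ?K * B" if "A \<subseteq> set_pmf G0" "\<And>\<tau>. \<tau> \<in> A \<Longrightarrow> h \<tau> \<le> B" "0 \<le> B" for A h and B :: real
    proof -
      have "(\<Sum>\<tau>\<in>A. h \<tau>) \<le> real (card A) * B" using that by (intro sum_bounded_above) auto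
      also have "\<dots> \<le> ?K * B" using that assms(2) by (intro mult_right_mono) (auto intro: card_mono)
      finally show ?thesis .
    qed
    show ?thesis
      unfolding voronoi_loss_def
    proof (intro add_mono outer gen)
      fix \<tau> \<theta> assume "\<tau> \<in> {\<tau> \<in> set_pmf G0. 1 < card (?c \<tau>)}" "\<theta> \<in> ?c \<tau>"
      then show "(edist d \<theta> \<tau>)\<^sup>2 \<le> R\<^sup>2" using R(2) c\<Theta> edist_nonneg by (intro power_mono) auto
    next
      fix \<tau> \<theta> assume "\<tau> \<in> {\<tau> \<in> set_pmf G0. card (?c \<tau>) = 1}" "\<theta> \<in> ?c \<tau>"
      then show "edist d \<theta> \<tau> \<le> R" using R(2) c\<Theta> by auto
    next
      fix \<tau>
      have "0 \<le> (\<Sum>\<theta>\<in>?c \<tau>. pmf G \<theta>)" by (simp add: sum_nonneg)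
      then show "\<bar>(\<Sum>\<theta>\<in>?c \<tau>. pmf G \<theta>) - pmf G0 \<tau>\<bar> \<le> 1"
        using sum_pmf_le_1[OF fc, of G \<tau>] pmf_le_1[of G0 \<tau>] pmf_nonneg[of G0 \<tau>] by linarith
    qed (use R(1) in auto)
  qed
  then show ?thesis using R(1) by (intro exI[of _ "?K * R\<^sup>2 + ?K * R + ?K * 1"]) auto
qed

text \<open>Successive extraction of subsequences, one index at a time.\<close>

lemma finite_convergent_subsequence:
  fixes X :: "nat \<Rightarrow> 'i \<Rightarrow> 'a::first_countable_topology"
  assumes "finite I" "compact K" "\<And>n i. i \<in> I \<Longrightarrow> X n i \<in> K"
  shows "\<exists>r L. strict_mono (r :: nat \<Rightarrow> nat) \<and> (\<forall>i\<in>I. L i \<in> K \<and> (\<lambda>n. X (r n) i) \<longlonglongrightarrow> L i)"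
  using assms(1,3)
proof (induction I rule: finite_induct)
  case empty
  show ?case by (rule exI[of _ id]) (auto simp: strict_mono_def)
next
  case (insert i I)
  then obtain r L where r: "strict_mono (r :: nat \<Rightarrow> nat)" "\<And>i. i \<in> I \<Longrightarrow> L i \<in> K \<and> (\<lambda>n. X (r n) i) \<longlonglongrightarrow> L i"
    by blast
  have "seq_compact K" using assms(2) by (rule compact_imp_seq_compact)
  then obtain l s where s: "l \<in> K" "strict_mono (s :: nat \<Rightarrow> nat)" "((\<lambda>n. X (r n) i) \<circ> s) \<longlonglongrightarrow> l"
    using insert.prems unfolding seq_compact_def by (metis insertI1)
  have "(\<lambda>n. X ((r \<circ> s) n) j) \<longlonglongrightarrow> (L(i := l)) j" if "j \<in> insert i I" for j
  proof (cases "j = i")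
    case True then show ?thesis using s(3) by (simp add: o_def)
  next
    case False
    then have "(\<lambda>n. X (r n) j) \<longlonglongrightarrow> L j" using r that by blast
    from LIMSEQ_subseq_LIMSEQ[OF this s(2)] show ?thesis using False by (simp add: o_def)
  qed
  moreover have "(L(i := l)) j \<in> K" if "j \<in> insert i I" for j using r(2) s(1) that by auto
  ultimately have "\<forall>j\<in>insert i I. (L(i := l)) j \<in> K \<and> (\<lambda>n. X ((r \<circ> s) n) j) \<longlonglongrightarrow> (L(i := l)) j"
    by blast
  then show ?case using strict_mono_o[OF r(1) s(2)] by blast
qed

text \<open>Pads a mixing measure of order at most \<open>k\<close> to \<open>k\<close> slots, the
  extra ones carrying weight 0, so that sequences of measures become sequences in a fixed compact
  space. Distinctness of atoms survives only among slots of positive weight.\<close>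

lemma mixing_representation:
  assumes G: "G \<in> mixing_le \<Theta> k"
  obtains t w where "\<And>i. t i \<in> \<Theta>" "\<And>i. 0 \<le> w i \<and> w i \<le> (1::real)"
    "\<And>h :: rvec \<Rightarrow> real. (\<Sum>\<theta>\<in>set_pmf G. pmf G \<theta> * h \<theta>) = (\<Sum>i<k. w i * h (t i))"
    "\<And>i. i < k \<Longrightarrow> 0 < w i \<Longrightarrow> t i \<in> set_pmf G"
    "\<And>i j. i < k \<Longrightarrow> j < k \<Longrightarrow> 0 < w i \<Longrightarrow> 0 < w j \<Longrightarrow> t i = t j \<Longrightarrow> i = j"
proof -
  note fin = mixing_leD[OF G]
  define m where "m = card (set_pmf G)"
  obtain e where e: "bij_betw e {0..<m} (set_pmf G)"
    using ex_bij_betw_nat_finite[OF fin(1)] unfolding m_def by blast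
  obtain \<theta>0 where \<theta>0: "\<theta>0 \<in> set_pmf G" using set_pmf_not_empty by fast
  define t where "t = (\<lambda>i. if i < m then e i else \<theta>0)"
  define w where "w = (\<lambda>i. if i < m then pmf G (e i) else 0)"
  have et: "e i \<in> set_pmf G" if "i < m" for i using e that by (auto simp: bij_betw_def)
  show thesis
  proof (rule that[of t w])
    show "t i \<in> \<Theta>" for i using et[of i] \<theta>0 fin(2) by (auto simp: t_def)
    show "0 \<le> w i \<and> w i \<le> 1" for i by (auto simp: w_def pmf_le_1)
    show "(\<Sum>\<theta>\<in>set_pmf G. pmf G \<theta> * h \<theta>) = (\<Sum>i<k. w i * h (t i))" for h :: "rvec \<Rightarrow> real"
    proof -
      have "(\<Sum>\<theta>\<in>set_pmf G. pmf G \<theta> * h \<theta>) = (\<Sum>i\<in>{0..<m}. pmf G (e i) * h (e i))"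
        by (rule sum.reindex_bij_betw[OF e, symmetric])
      also have "\<dots> = (\<Sum>i\<in>{0..<m}. w i * h (t i))" by (intro sum.cong) (auto simp: w_def t_def)
      also have "\<dots> = (\<Sum>i<k. w i * h (t i))"
        using fin(3) by (intro sum.mono_neutral_left) (auto simp: w_def m_def)
      finally show ?thesis .
    qed
    show "t i \<in> set_pmf G" if "i < k" "0 < w i" for i using that et by (auto simp: t_def w_def split: if_splits)
    show "i = j" if "i < k" "j < k" "0 < w i" "0 < w j" "t i = t j" for i j
      using that e by (auto simp: t_def w_def bij_betw_def inj_on_def split: if_splits)
  qed
qed

text \<open>Fatou's lemma: the absolute value of the limit has integral 0.\<close>

lemma AE_zero_of_limit:
  fixes g :: "nat \<Rightarrow> 'a \<Rightarrow> real"
  assumes meas: "\<And>n. g n \<in> borel_measurable M"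
    and lim: "AE x in M. (\<lambda>n. g n x) \<longlonglongrightarrow> h x"
    and int: "\<And>n. (\<integral>\<^sup>+x. ennreal \<bar>g n x\<bar> \<partial>M) \<le> ennreal (e n)" and e: "e \<longlonglongrightarrow> 0"
  shows "AE x in M. h x = 0"
proof -
  note meas[measurable]
  have "(\<integral>\<^sup>+x. liminf (\<lambda>n. ennreal \<bar>g n x\<bar>) \<partial>M) \<le> liminf (\<lambda>n. \<integral>\<^sup>+x. ennreal \<bar>g n x\<bar> \<partial>M)"
    by (rule nn_integral_liminf) measurable
  also have "\<dots> \<le> liminf (\<lambda>n. ennreal (e n))" using int by (intro Liminf_mono) auto
  also have "\<dots> = 0"
    using tendsto_ennrealI[OF e] by (intro lim_imp_Liminf) auto
  finally have "(\<integral>\<^sup>+x. liminf (\<lambda>n. ennreal \<bar>g n x\<bar>) \<partial>M) = 0" by simp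
  then have "AE x in M. liminf (\<lambda>n. ennreal \<bar>g n x\<bar>) = 0"
    by (subst (asm) nn_integral_0_iff_AE) measurable
  with lim show ?thesis
  proof eventually_elim
    case (elim x)
    have "(\<lambda>n. ennreal \<bar>g n x\<bar>) \<longlonglongrightarrow> ennreal \<bar>h x\<bar>"
      using elim(1) by (intro tendsto_ennrealI tendsto_rabs)
    then have "liminf (\<lambda>n. ennreal \<bar>g n x\<bar>) = ennreal \<bar>h x\<bar>" by (intro lim_imp_Liminf) auto
    then show "h x = 0" using elim(2) by (simp add: ennreal_eq_0_iff)
  qed
qed

section \<open>Second-order identifiability in terms of partial derivatives\<close>

lemma ess_sup_zero:
  assumes "AE x in M. u x = 0"
  shows "ess_sup M u = 0"
proof -
  have "0 \<in> {c. AE x in M. u x \<le> c}" using assms by (auto elim: eventually_mono)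
  then have "Inf {c. AE x in M. u x \<le> c} \<le> 0" by (rule Inf_lower)
  then show ?thesis by (simp add: ess_sup_def)
qed

text \<open>Transfers coefficients attached to an indexed family of multi-indices to a coefficient
  function on all multi-indices; coinciding indices would have their coefficients added.\<close>

lemma sum_delta_family:
  fixes c :: "'j \<Rightarrow> real"
  assumes "finite M" "finite J" "\<And>j. j \<in> J \<Longrightarrow> e j \<in> M"
  shows "(\<Sum>\<eta>\<in>M. (\<Sum>j\<in>J. if \<eta> = e j then c j else 0) * D \<eta>) = (\<Sum>j\<in>J. c j * D (e j))"
proof -
  have "(\<Sum>\<eta>\<in>M. (\<Sum>j\<in>J. if \<eta> = e j then c j else 0) * D \<eta>)
      = (\<Sum>j\<in>J. \<Sum>\<eta>\<in>M. (if \<eta> = e j then c j else 0) * D \<eta>)"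
    unfolding sum_distrib_right by (rule sum.swap)
  also have "\<dots> = (\<Sum>j\<in>J. \<Sum>\<eta>\<in>M. if \<eta> = e j then c j * D \<eta> else 0)"
    by (intro sum.cong) auto
  also have "\<dots> = (\<Sum>j\<in>J. c j * D (e j))"
    using assms by (intro sum.cong) (auto simp: sum.delta')
  finally show ?thesis .
qed

text \<open>Each pair of coordinates occurs once, as \<open>a \<le> b\<close>, because a multi-index
  records no order. The second-order conclusion concerns the diagonal, whose coefficients will add
  up to the weighted squared distances.\<close>

lemma strongly_identifiable_order2:
  assumes si: "strongly_identifiable d 2 \<nu> \<Theta> f"
  obtains F where "AE x in \<nu>. Cr_extension d 2 \<Theta> (f x) (F x)"
    "\<And>S A B C \<theta>. finite S \<Longrightarrow> S \<subseteq> \<Theta> \<Longrightarrow>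
      (AE x in \<nu>. (\<Sum>\<theta>\<in>S. A \<theta> * F x \<theta> + (\<Sum>a<d. B \<theta> a * partial_deriv a (F x) \<theta>)
         + (\<Sum>a<d. \<Sum>b=a..<d. C \<theta> a b * partial_deriv b (partial_deriv a (F x)) \<theta>)) = 0) \<Longrightarrow>
      \<theta> \<in> S \<Longrightarrow> A \<theta> = 0 \<and> (\<forall>a<d. B \<theta> a = 0 \<and> C \<theta> a a = 0)"
proof -
  obtain F where ext: "AE x in \<nu>. Cr_extension d 2 \<Theta> (f x) (F x)"
    and id: "\<forall>S (a :: (nat \<Rightarrow> nat) \<Rightarrow> rvec \<Rightarrow> real). finite S \<longrightarrow> S \<noteq> {} \<longrightarrow> S \<subseteq> \<Theta> \<longrightarrow>
        ess_sup \<nu> (\<lambda>x. ennreal \<bar>\<Sum>\<eta>\<in>multi_indices d 2. \<Sum>\<theta>\<in>S. a \<eta> \<theta> * mi_deriv d \<eta> (F x) \<theta>\<bar>) = 0 \<longrightarrow>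
        (\<forall>\<eta>\<in>multi_indices d 2. \<forall>\<theta>\<in>S. a \<eta> \<theta> = 0)"
    using si unfolding strongly_identifiable_def by (elim exE conjE) (rule that)
  show thesis
  proof (rule that[OF ext])
    fix S A B C \<theta>
    assume S: "finite S" "S \<subseteq> \<Theta>" and th: "\<theta> \<in> S"
      and ae: "AE x in \<nu>. (\<Sum>\<theta>\<in>S. A \<theta> * F x \<theta> + (\<Sum>a<d. B \<theta> a * partial_deriv a (F x) \<theta>)
         + (\<Sum>a<d. \<Sum>b=a..<d. C \<theta> a b * partial_deriv b (partial_deriv a (F x)) \<theta>)) = 0"
    let ?M = "multi_indices d 2"
    let ?J = "Sigma {..<d} (\<lambda>a. {a..<d})"
    \<comment> \<open>The coefficient function on multi-indices assembled from the three families;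
      orders 0, 1 and 2 do not interfere.\<close>
    define c where "c = (\<lambda>\<eta> \<theta>. (\<Sum>j\<in>{0::nat}. if \<eta> = (\<lambda>_::nat. 0::nat) then A \<theta> else 0)
      + (\<Sum>a<d. if \<eta> = unit1 a then B \<theta> a else 0)
      + (\<Sum>j\<in>?J. if \<eta> = (\<lambda>(a, b). unit2 a b) j then (\<lambda>(a, b). C \<theta> a b) j else 0))"
    have sum: "(\<Sum>\<eta>\<in>?M. \<Sum>\<theta>\<in>S. c \<eta> \<theta> * mi_deriv d \<eta> g \<theta>)
      = (\<Sum>\<theta>\<in>S. A \<theta> * g \<theta> + (\<Sum>a<d. B \<theta> a * partial_deriv a g \<theta>)
         + (\<Sum>a<d. \<Sum>b=a..<d. C \<theta> a b * partial_deriv b (partial_deriv a g) \<theta>))" for g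
    proof -
      have "(\<Sum>\<eta>\<in>?M. \<Sum>\<theta>\<in>S. c \<eta> \<theta> * mi_deriv d \<eta> g \<theta>) = (\<Sum>\<theta>\<in>S. \<Sum>\<eta>\<in>?M. c \<eta> \<theta> * mi_deriv d \<eta> g \<theta>)"
        by (rule sum.swap)
      also have "\<dots> = (\<Sum>\<theta>\<in>S. A \<theta> * g \<theta> + (\<Sum>a<d. B \<theta> a * partial_deriv a g \<theta>)
         + (\<Sum>a<d. \<Sum>b=a..<d. C \<theta> a b * partial_deriv b (partial_deriv a g) \<theta>))"
      proof (rule sum.cong[OF refl])
        fix \<theta>
        have 1: "(\<Sum>\<eta>\<in>?M. (\<Sum>j\<in>{0::nat}. if \<eta> = (\<lambda>_::nat. 0::nat) then A \<theta> else 0) * mi_deriv d \<eta> g \<theta>) = A \<theta> * g \<theta>"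
          by (subst sum_delta_family) (auto simp: finite_multi_indices unit_multi_indices mi_deriv_0)
        have 2: "(\<Sum>\<eta>\<in>?M. (\<Sum>a<d. if \<eta> = unit1 a then B \<theta> a else 0) * mi_deriv d \<eta> g \<theta>) = (\<Sum>a<d. B \<theta> a * partial_deriv a g \<theta>)"
          by (subst sum_delta_family) (auto simp: finite_multi_indices unit_multi_indices mi_deriv_unit1)
        have "(\<Sum>\<eta>\<in>?M. (\<Sum>j\<in>?J. if \<eta> = (\<lambda>(a, b). unit2 a b) j then (\<lambda>(a, b). C \<theta> a b) j else 0) * mi_deriv d \<eta> g \<theta>)
          = (\<Sum>j\<in>?J. (\<lambda>(a, b). C \<theta> a b) j * mi_deriv d ((\<lambda>(a, b). unit2 a b) j) g \<theta>)"
          by (rule sum_delta_family) (auto simp: finite_multi_indices unit_multi_indices)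
        also have "\<dots> = (\<Sum>j\<in>?J. (\<lambda>(a, b). C \<theta> a b * partial_deriv b (partial_deriv a g) \<theta>) j)"
          by (intro sum.cong) (auto simp: mi_deriv_unit2)
        also have "\<dots> = (\<Sum>a<d. \<Sum>b=a..<d. C \<theta> a b * partial_deriv b (partial_deriv a g) \<theta>)"
          by (subst sum.Sigma) (auto simp: case_prod_beta')
        finally show "(\<Sum>\<eta>\<in>?M. c \<eta> \<theta> * mi_deriv d \<eta> g \<theta>) = A \<theta> * g \<theta> + (\<Sum>a<d. B \<theta> a * partial_deriv a g \<theta>)
           + (\<Sum>a<d. \<Sum>b=a..<d. C \<theta> a b * partial_deriv b (partial_deriv a g) \<theta>)"
          unfolding c_def distrib_right sum.distrib 1 2 by simp
      qed
      finally show ?thesis .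
    qed
    have "ess_sup \<nu> (\<lambda>x. ennreal \<bar>\<Sum>\<eta>\<in>?M. \<Sum>\<theta>\<in>S. c \<eta> \<theta> * mi_deriv d \<eta> (F x) \<theta>\<bar>) = 0"
      unfolding sum by (rule ess_sup_zero) (use ae in eventually_elim, simp)
    then have z: "\<And>\<eta>. \<eta> \<in> ?M \<Longrightarrow> c \<eta> \<theta> = 0" using id S th by blast
    have "c (\<lambda>_. 0) \<theta> = A \<theta>"
      unfolding c_def by (simp add: unit1_eq_0[symmetric] unit2_eq_0[symmetric] case_prod_beta')
    moreover have "c (unit1 a) \<theta> = B \<theta> a" if "a < d" for a
      unfolding c_def using that
      by (simp add: unit1_eq_0 unit1_inject unit2_neq_unit1[symmetric] case_prod_beta')
    moreover have "c (unit2 a a) \<theta> = C \<theta> a a" if "a < d" for a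
    proof -
      have "(\<Sum>j\<in>?J. if unit2 a a = (\<lambda>(a, b). unit2 a b) j then (\<lambda>(a, b). C \<theta> a b) j else 0)
        = (\<Sum>j\<in>?J. if j = (a, a) then C \<theta> a a else 0)"
        by (intro sum.cong) (auto simp: unit2_diag)
      also have "\<dots> = C \<theta> a a" using that by (simp add: sum.delta')
      finally show ?thesis unfolding c_def by (simp add: unit2_eq_0 unit2_neq_unit1)
    qed
    ultimately show "A \<theta> = 0 \<and> (\<forall>a<d. B \<theta> a = 0 \<and> C \<theta> a a = 0)"
      using z unit_multi_indices by metis
  qed
qed

text \<open>A sequence of mixing measures along which the loss exceeds any fixed multiple of the
  \<open>L\<^sup>1\<close> distance, in padded form and already thinned out so that all atoms and
  weights converge. The locale is shown to be inconsistent.\<close>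

locale mixture_sequence =
  fixes d N :: nat and \<nu> :: "rvec measure" and \<Theta> :: "rvec set" and f :: "rvec \<Rightarrow> rvec \<Rightarrow> real"
    and k :: nat and G0 :: "rvec pmf" and G :: "nat \<Rightarrow> rvec pmf"
    and t :: "nat \<Rightarrow> nat \<Rightarrow> rvec" and w :: "nat \<Rightarrow> nat \<Rightarrow> real" and T :: "nat \<Rightarrow> rvec" and W :: "nat \<Rightarrow> real"
  assumes dens: "density_family N \<nu> \<Theta> f"
    and comp: "compactin (Euclidean_space d) \<Theta>"
    and si: "strongly_identifiable d 2 \<nu> \<Theta> f"
    and G0: "G0 \<in> mixing_le \<Theta> k" and G: "\<And>n. G n \<in> mixing_le \<Theta> k"
    and t: "\<And>n i. t n i \<in> \<Theta>" and w: "\<And>n i. 0 \<le> w n i \<and> w n i \<le> 1"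
    and rep: "\<And>n h. (\<Sum>\<theta>\<in>set_pmf (G n). pmf (G n) \<theta> * h \<theta>) = (\<Sum>i<k. w n i * h (t n i))"
    and supp: "\<And>n i. i < k \<Longrightarrow> 0 < w n i \<Longrightarrow> t n i \<in> set_pmf (G n)"
    and inj: "\<And>n i j. i < k \<Longrightarrow> j < k \<Longrightarrow> 0 < w n i \<Longrightarrow> 0 < w n j \<Longrightarrow> t n i = t n j \<Longrightarrow> i = j"
    and T: "\<And>i. i < k \<Longrightarrow> T i \<in> \<Theta>" and t_lim: "\<And>i. i < k \<Longrightarrow> (\<lambda>n. t n i) \<longlonglongrightarrow> T i"
    and w_lim: "\<And>i. i < k \<Longrightarrow> (\<lambda>n. w n i) \<longlonglongrightarrow> W i"
    and small: "\<And>n. (real n + 1) * (\<integral>x. \<bar>mixture f (G n) x - mixture f G0 x\<bar> \<partial>\<nu>) < voronoi_loss d (G n) G0"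
begin

abbreviation S0 where "S0 \<equiv> set_pmf G0"

definition far where "far = {i. i < k \<and> T i \<notin> S0}"

definition close where "close = {i. i < k \<and> T i \<in> S0}"

definition at_atom where "at_atom \<tau> = {i. i < k \<and> T i = \<tau>}"

definition gap where "gap n x = mixture f (G n) x - mixture f G0 x"

definition V where "V n = (\<integral>x. \<bar>gap n x\<bar> \<partial>\<nu>)"

lemma fin: "finite S0" "S0 \<subseteq> \<Theta>" "finite far" "finite close" "finite (at_atom \<tau>)"
  using mixing_leD[OF G0] by (auto simp: far_def close_def at_atom_def)

lemma sum_close: "(\<Sum>\<tau>\<in>S0. \<Sum>i\<in>at_atom \<tau>. h i) = (\<Sum>i\<in>close. h i)" for h :: "nat \<Rightarrow> real"
proof -
  have "(\<Sum>\<tau>\<in>S0. \<Sum>i\<in>{i \<in> close. T i = \<tau>}. h i) = (\<Sum>i\<in>close. h i)"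
    using fin by (intro sum.group) (auto simp: close_def)
  moreover have "{i \<in> close. T i = \<tau>} = at_atom \<tau>" if "\<tau> \<in> S0" for \<tau>
    using that by (auto simp: close_def at_atom_def)
  ultimately show ?thesis by simp
qed

lemma sum_split: "(\<Sum>i<k. h i) = (\<Sum>i\<in>far. h i) + (\<Sum>i\<in>close. h i)" for h :: "nat \<Rightarrow> real"
proof -
  have "{..<k} = far \<union> close" "far \<inter> close = {}" by (auto simp: far_def close_def)
  then show ?thesis using fin by (simp add: sum.union_disjoint)
qed

lemma mixture_G: "mixture f (G n) x = (\<Sum>i<k. w n i * f x (t n i))"
  using mixture_eq_sum[OF mixing_leD(1)[OF G[of n]], of f x] rep[of n "f x"] by simp

lemma mixture_G0: "mixture f G0 x = (\<Sum>\<tau>\<in>S0. pmf G0 \<tau> * f x \<tau>)"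
  by (rule mixture_eq_sum[OF fin(1)])

lemma integrable_mixture: "H \<in> mixing_le \<Theta> k \<Longrightarrow> integrable \<nu> (mixture f H)"
  using mixture_density[OF dens] by (intro integrableI_nonneg) auto

lemma gap_measurable: "gap n \<in> borel_measurable \<nu>"
  unfolding gap_def using mixture_density(1)[OF dens] G G0 by (intro borel_measurable_diff) auto

lemma V_eq: "(\<integral>\<^sup>+x. ennreal \<bar>gap n x\<bar> \<partial>\<nu>) = ennreal (V n)"
  unfolding V_def gap_def using integrable_mixture G G0 by (intro nn_integral_eq_integral) auto

lemma V_small: "0 \<le> V n" "(real n + 1) * V n < voronoi_loss d (G n) G0" "0 < voronoi_loss d (G n) G0"
proof -
  show V: "0 \<le> V n" by (simp add: V_def)
  show s: "(real n + 1) * V n < voronoi_loss d (G n) G0" using small[of n] by (simp add: V_def gap_def)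
  have "0 \<le> (real n + 1) * V n" using V by simp
  then show "0 < voronoi_loss d (G n) G0" using s by linarith
qed

text \<open>Zeroth-order identifiability: the loss is bounded, so the \<open>L\<^sup>1\<close>
  distance tends to 0 and the limiting mixture equals the true one almost everywhere. Comparing
  coefficients at the distinct limit points gives the weights.\<close>

lemma limit_weights:
  assumes "\<tau> \<in> S0"
  shows "(\<Sum>i\<in>at_atom \<tau>. W i) = pmf G0 \<tau>"
proof -
  obtain F where ext: "AE x in \<nu>. Cr_extension d 2 \<Theta> (f x) (F x)"
    and id: "\<And>S A B C \<theta>. finite S \<Longrightarrow> S \<subseteq> \<Theta> \<Longrightarrow>
      (AE x in \<nu>. (\<Sum>\<theta>\<in>S. A \<theta> * F x \<theta> + (\<Sum>a<d. B \<theta> a * partial_deriv a (F x) \<theta>)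
         + (\<Sum>a<d. \<Sum>b=a..<d. C \<theta> a b * partial_deriv b (partial_deriv a (F x)) \<theta>)) = 0) \<Longrightarrow>
      \<theta> \<in> S \<Longrightarrow> A \<theta> = 0 \<and> (\<forall>a<d. B \<theta> a = 0 \<and> C \<theta> a a = 0)"
    using strongly_identifiable_order2[OF si] by blast
  obtain Dm where Dm: "0 \<le> Dm" "\<And>H. H \<in> mixing_le \<Theta> k \<Longrightarrow> voronoi_loss d H G0 \<le> Dm"
    using voronoi_loss_bounded[OF comp fin(1)] by blast
  have V_le: "V n \<le> Dm / (real n + 1)" for n
    using V_small(2)[of n] Dm(2)[OF G[of n]] by (simp add: field_simps)
  have Dm0: "(\<lambda>n. Dm / (real n + 1)) \<longlonglongrightarrow> 0"
    using LIMSEQ_Suc[OF lim_const_over_n[of Dm]] by (simp add: add.commute)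
  define S where "S = S0 \<union> T ` {..<k}"
  have S: "finite S" "S \<subseteq> \<Theta>" using fin T by (auto simp: S_def)
  define A where "A = (\<lambda>\<theta>. (\<Sum>i\<in>at_atom \<theta>. W i) - pmf G0 \<theta>)"
  have lim: "AE x in \<nu>. (\<lambda>n. gap n x) \<longlonglongrightarrow> (\<Sum>i<k. W i * f x (T i)) - mixture f G0 x"
    using strongly_identifiable_continuous[OF si]
  proof eventually_elim
    case (elim x)
    have "(\<lambda>n. f x (t n i)) \<longlonglongrightarrow> f x (T i)" if "i < k" for i
      using continuous_on_tendsto_compose[OF elim t_lim[OF that] T[OF that]] t by simp
    then show ?case unfolding gap_def mixture_G
      by (intro tendsto_intros w_lim) auto
  qed
  have "AE x in \<nu>. (\<Sum>i<k. W i * f x (T i)) - mixture f G0 x = 0"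
    by (rule AE_zero_of_limit[OF gap_measurable lim _ Dm0]) (simp add: V_eq V_le ennreal_leI)
  then have "AE x in \<nu>. (\<Sum>\<theta>\<in>S. A \<theta> * F x \<theta> + (\<Sum>a<d. 0 * partial_deriv a (F x) \<theta>)
         + (\<Sum>a<d. \<Sum>b=a..<d. 0 * partial_deriv b (partial_deriv a (F x)) \<theta>)) = 0"
    using ext
  proof eventually_elim
    case (elim x)
    have F: "F x \<theta> = f x \<theta>" if "\<theta> \<in> S" for \<theta> using elim(2) that S by (auto simp: Cr_extension_def)
    have "(\<Sum>\<theta>\<in>S. \<Sum>i\<in>{i \<in> {..<k}. T i = \<theta>}. W i * f x (T i)) = (\<Sum>i<k. W i * f x (T i))"
      using S by (intro sum.group) (auto simp: S_def)
    moreover have "(\<Sum>i\<in>{i \<in> {..<k}. T i = \<theta>}. W i * f x (T i)) = (\<Sum>i\<in>at_atom \<theta>. W i) * f x \<theta>" for \<theta>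
      unfolding sum_distrib_right by (intro sum.cong) (auto simp: at_atom_def)
    ultimately have 1: "(\<Sum>\<theta>\<in>S. (\<Sum>i\<in>at_atom \<theta>. W i) * f x \<theta>) = (\<Sum>i<k. W i * f x (T i))" by simp
    have 2: "(\<Sum>\<theta>\<in>S. pmf G0 \<theta> * f x \<theta>) = mixture f G0 x"
      unfolding mixture_G0 using S by (intro sum.mono_neutral_right) (auto simp: S_def set_pmf_iff)
    have "(\<Sum>\<theta>\<in>S. A \<theta> * F x \<theta>) = (\<Sum>\<theta>\<in>S. (\<Sum>i\<in>at_atom \<theta>. W i) * f x \<theta> - pmf G0 \<theta> * f x \<theta>)"
      by (intro sum.cong) (auto simp: A_def F left_diff_distrib)
    also have "\<dots> = 0" unfolding sum_subtractf 1 2 using elim(1) by simp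
    finally show ?case by simp
  qed
  then have "A \<tau> = 0" using id[OF S, of A "\<lambda>_ _. 0" "\<lambda>_ _ _. 0" \<tau>] assms by (auto simp: S_def)
  then show ?thesis by (simp add: A_def)
qed

section \<open>The total size of the expansion coefficients controls the loss\<close>

definition dist_to where "dist_to n i = edist d (t n i) (T i)"

definition size1 where "size1 n = (\<Sum>i\<in>far. w n i)"
definition size2 where "size2 n = (\<Sum>\<tau>\<in>S0. \<bar>(\<Sum>i\<in>at_atom \<tau>. w n i) - pmf G0 \<tau>\<bar>)"
definition size3 where "size3 n = (\<Sum>i\<in>close. w n i * (dist_to n i)\<^sup>2)"
definition size4 where
  "size4 n = (\<Sum>\<tau>\<in>S0. \<Sum>a<d. \<bar>\<Sum>i\<in>at_atom \<tau>. w n i * (t n i a - \<tau> a)\<bar>)"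

text \<open>The aggregated first-order terms of \<open>size4\<close> are needed because the individual ones may cancel;
  they keep all coefficients of the Taylor expansion bounded after division by \<open>size\<close>.\<close>

definition size where "size n = size1 n + size2 n + size3 n + size4 n"

lemma size_nonneg: "0 \<le> size1 n" "0 \<le> size2 n" "0 \<le> size3 n" "0 \<le> size4 n"
  using w by (auto simp: size1_def size2_def size3_def size4_def intro!: sum_nonneg)

lemma size_ge: "size1 n \<le> size n" "size2 n \<le> size n" "size3 n \<le> size n" "size4 n \<le> size n" "0 \<le> size n"
  using size_nonneg[of n] by (auto simp: size_def)

text \<open>The atom of \<open>G0\<close> that a slot converges to is eventually strictly nearest,
  so ties between cells disappear for these slots.\<close>

lemma eventually_in_own_cell:
  "eventually (\<lambda>n. \<forall>i\<in>close. \<forall>\<tau>\<in>S0. T i = \<tau> \<longleftrightarrow> (\<forall>\<tau>'\<in>S0. edist d (t n i) \<tau> \<le> edist d (t n i) \<tau>')) sequentially"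
proof (intro eventually_ball_finite fin ballI)
  fix i \<tau> assume i: "i \<in> close" and \<tau>: "\<tau> \<in> S0"
  have ik: "i < k" "T i \<in> S0" using i by (auto simp: close_def)
  have top: "S0 \<subseteq> topspace (Euclidean_space d)" using fin compactin_Euclidean_space(2)[OF comp] by blast
  have self: "edist d (T i) (T i) = 0" by (simp add: edist_def L2_set_def)
  have "eventually (\<lambda>n. \<forall>\<sigma>\<in>S0 - {T i}. edist d (t n i) (T i) < edist d (t n i) \<sigma>) sequentially"
  proof (intro eventually_ball_finite ballI)
    fix \<sigma> assume \<sigma>: "\<sigma> \<in> S0 - {T i}"
    have "(\<lambda>n. edist d (t n i) \<sigma> - edist d (t n i) (T i)) \<longlonglongrightarrow> edist d (T i) \<sigma> - edist d (T i) (T i)"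
      by (intro tendsto_diff tendsto_edist t_lim ik)
    moreover have "0 < edist d (T i) \<sigma> - edist d (T i) (T i)"
      unfolding self using \<sigma> top ik by (auto intro!: edist_pos)
    ultimately have "eventually (\<lambda>n. 0 < edist d (t n i) \<sigma> - edist d (t n i) (T i)) sequentially"
      by (rule order_tendstoD(1))
    then show "eventually (\<lambda>n. edist d (t n i) (T i) < edist d (t n i) \<sigma>) sequentially"
      by eventually_elim simp
  qed (use fin in auto)
  then show "eventually (\<lambda>n. T i = \<tau> \<longleftrightarrow> (\<forall>\<tau>'\<in>S0. edist d (t n i) \<tau> \<le> edist d (t n i) \<tau>')) sequentially"
  proof eventually_elim
    case (elim n)
    show ?case
    proof
      assume eq: "T i = \<tau>"
      show "\<forall>\<tau>'\<in>S0. edist d (t n i) \<tau> \<le> edist d (t n i) \<tau>'"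
      proof
        fix \<tau>' assume "\<tau>' \<in> S0"
        then have "\<tau>' = T i \<or> edist d (t n i) (T i) < edist d (t n i) \<tau>'" using elim by blast
        then show "edist d (t n i) \<tau> \<le> edist d (t n i) \<tau>'" using eq by auto
      qed
    next
      assume le: "\<forall>\<tau>'\<in>S0. edist d (t n i) \<tau> \<le> edist d (t n i) \<tau>'"
      show "T i = \<tau>"
      proof (rule ccontr)
        assume "T i \<noteq> \<tau>"
        then have "edist d (t n i) (T i) < edist d (t n i) \<tau>" using elim \<tau> by auto
        then show False using le ik(2) by force
      qed
    qed
  qed
qed

text \<open>The limiting weight at every atom of \<open>G0\<close> is positive, so eventually some
  slot converging to it carries mass.\<close>

lemma eventually_occupied:
  "eventually (\<lambda>n. \<forall>\<tau>\<in>S0. \<exists>i\<in>at_atom \<tau>. 0 < w n i) sequentially"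
proof (intro eventually_ball_finite fin ballI)
  fix \<tau> assume \<tau>: "\<tau> \<in> S0"
  have "(\<lambda>n. \<Sum>i\<in>at_atom \<tau>. w n i) \<longlonglongrightarrow> (\<Sum>i\<in>at_atom \<tau>. W i)"
    by (intro tendsto_sum w_lim) (simp add: at_atom_def)
  moreover have "0 < (\<Sum>i\<in>at_atom \<tau>. W i)" using limit_weights[OF \<tau>] \<tau> by (simp add: pmf_positive)
  ultimately have "eventually (\<lambda>n. 0 < (\<Sum>i\<in>at_atom \<tau>. w n i)) sequentially" by (rule order_tendstoD(1))
  then show "eventually (\<lambda>n. \<exists>i\<in>at_atom \<tau>. 0 < w n i) sequentially"
  proof eventually_elim
    case (elim n)
    show ?case
    proof (rule ccontr)
      assume "\<not> ?thesis"
      then have "(\<Sum>i\<in>at_atom \<tau>. w n i) \<le> 0" by (intro sum_nonpos) (auto simp: not_less)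
      then show False using elim by simp
    qed
  qed
qed

lemma cell_sum:
  "(\<Sum>\<theta>\<in>voronoi_cell d (G n) G0 \<tau>. pmf (G n) \<theta> * h \<theta>)
    = (\<Sum>i<k. w n i * (if \<forall>\<tau>'\<in>S0. edist d (t n i) \<tau> \<le> edist d (t n i) \<tau>' then h (t n i) else 0))"
proof -
  have "(\<Sum>\<theta>\<in>voronoi_cell d (G n) G0 \<tau>. pmf (G n) \<theta> * h \<theta>)
    = (\<Sum>\<theta>\<in>set_pmf (G n). pmf (G n) \<theta> * (if \<forall>\<tau>'\<in>S0. edist d \<theta> \<tau> \<le> edist d \<theta> \<tau>' then h \<theta> else 0))"
    using mixing_leD(1)[OF G[of n]] by (intro sum.mono_neutral_cong_left) (auto simp: voronoi_cell_def)
  then show ?thesis unfolding rep .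
qed

text \<open>Slots with a limit outside \<open>S0\<close> contribute at most a constant times their
  weight, by compactness, and the other slots belong to the cell of their limit. A cell with several
  atoms is charged with squared distances, hence \<open>size3\<close>; a cell with one atom admits
  no cancellation, so \<open>size4\<close> controls its first-order term.\<close>

lemma loss_le_size: "\<exists>C>0. eventually (\<lambda>n. voronoi_loss d (G n) G0 \<le> C * size n) sequentially"
proof -
  obtain R where R: "1 \<le> R" "\<And>\<theta> \<tau>. \<theta> \<in> \<Theta> \<Longrightarrow> \<tau> \<in> S0 \<Longrightarrow> edist d \<theta> \<tau> \<le> R"
    using edist_bounded[OF comp fin(1)] by blast
  let ?K = "real (card S0)"
  have R2: "1 \<le> R\<^sup>2" using R(1) by simp
  have "eventually (\<lambda>n. voronoi_loss d (G n) G0 \<le> (3 * ?K + 1) * (1 + R\<^sup>2) * size n) sequentially"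
    using eventually_in_own_cell eventually_occupied
  proof eventually_elim
    case (elim n)
    let ?c = "voronoi_cell d (G n) G0"
    define own where "own = (\<lambda>i \<tau>. \<forall>\<tau>'\<in>S0. edist d (t n i) \<tau> \<le> edist d (t n i) \<tau>')"
    have own: "own i \<tau> \<longleftrightarrow> T i = \<tau>" if "i \<in> close" "\<tau> \<in> S0" for i \<tau>
      using elim(1) that by (simp add: own_def)
    have close_sum: "(\<Sum>i\<in>close. w n i * (if own i \<tau> then h i else 0)) = (\<Sum>i\<in>at_atom \<tau>. w n i * h i)"
      if "\<tau> \<in> S0" for \<tau> and h :: "nat \<Rightarrow> real"
      using fin that by (intro sum.mono_neutral_cong_right) (auto simp: own at_atom_def close_def)
    have cell: "(\<Sum>\<theta>\<in>?c \<tau>. pmf (G n) \<theta> * h \<theta>)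
      = (\<Sum>i\<in>far. w n i * (if own i \<tau> then h (t n i) else 0)) + (\<Sum>i\<in>at_atom \<tau>. w n i * h (t n i))"
      if "\<tau> \<in> S0" for \<tau> and h :: "rvec \<Rightarrow> real"
    proof -
      have "(\<forall>\<tau>'\<in>S0. edist d (t n i) \<tau> \<le> edist d (t n i) \<tau>') = own i \<tau>" for i by (simp add: own_def)
      then show ?thesis unfolding cell_sum sum_split using close_sum[OF that, of "\<lambda>i. h (t n i)"] by simp
    qed
    have far_le: "(\<Sum>i\<in>far. w n i * (if own i \<tau> then h (t n i) else 0)) \<le> B * size1 n"
      if "\<And>\<theta>. \<theta> \<in> \<Theta> \<Longrightarrow> h \<theta> \<le> B" "0 \<le> B" for \<tau> h and B :: real
      unfolding size1_def sum_distrib_left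
      using that w t by (intro sum_mono) (auto simp: mult.commute[of B] intro!: mult_left_mono)
    have bnd: "x \<le> (1 + R\<^sup>2) * size n" if "x \<le> R\<^sup>2 * size1 n + y" "y \<le> size n" for x y
    proof -
      have "R\<^sup>2 * size1 n \<le> R\<^sup>2 * size n" using size_ge by (intro mult_left_mono) auto
      then show ?thesis using that by (simp add: distrib_right)
    qed
    have outer: "(\<Sum>\<tau>\<in>A. h \<tau>) \<le> ?K * ((1 + R\<^sup>2) * size n)"
      if "A \<subseteq> S0" "\<And>\<tau>. \<tau> \<in> A \<Longrightarrow> h \<tau> \<le> (1 + R\<^sup>2) * size n" for A h
    proof -
      have "(\<Sum>\<tau>\<in>A. h \<tau>) \<le> real (card A) * ((1 + R\<^sup>2) * size n)" using that by (intro sum_bounded_above) auto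
      also have "\<dots> \<le> ?K * ((1 + R\<^sup>2) * size n)"
        using that fin size_ge by (intro mult_right_mono) (auto intro: card_mono)
      finally show ?thesis .
    qed
    have 1: "(\<Sum>\<theta>\<in>?c \<tau>. pmf (G n) \<theta> * (edist d \<theta> \<tau>)\<^sup>2) \<le> (1 + R\<^sup>2) * size n" if \<tau>: "\<tau> \<in> S0" for \<tau>
    proof (rule bnd)
      have "(\<Sum>i\<in>far. w n i * (if own i \<tau> then (edist d (t n i) \<tau>)\<^sup>2 else 0)) \<le> R\<^sup>2 * size1 n"
        using R \<tau> edist_nonneg by (intro far_le) (auto intro!: power_mono)
      then show "(\<Sum>\<theta>\<in>?c \<tau>. pmf (G n) \<theta> * (edist d \<theta> \<tau>)\<^sup>2) \<le> R\<^sup>2 * size1 n + (\<Sum>i\<in>at_atom \<tau>. w n i * (edist d (t n i) \<tau>)\<^sup>2)"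
        unfolding cell[OF \<tau>] by simp
      have "(\<Sum>i\<in>at_atom \<tau>. w n i * (edist d (t n i) \<tau>)\<^sup>2) = (\<Sum>i\<in>at_atom \<tau>. w n i * (dist_to n i)\<^sup>2)"
        by (intro sum.cong) (auto simp: dist_to_def at_atom_def)
      also have "\<dots> \<le> size3 n"
        unfolding size3_def using w fin \<tau> by (intro sum_mono2) (auto simp: at_atom_def close_def)
      finally show "(\<Sum>i\<in>at_atom \<tau>. w n i * (edist d (t n i) \<tau>)\<^sup>2) \<le> size n" using size_ge(3)[of n] by simp
    qed
    have 2: "(\<Sum>\<theta>\<in>?c \<tau>. pmf (G n) \<theta> * edist d \<theta> \<tau>) \<le> (1 + R\<^sup>2) * size n"
      if \<tau>: "\<tau> \<in> S0" and card: "card (?c \<tau>) = 1" for \<tau>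
    proof -
      \<comment> \<open>The only atom of the cell is the one in slot \<open>i0\<close>: every other
        slot with limit \<open>\<tau>\<close> has weight 0, and no slot of \<open>far\<close> with
        positive weight can share that atom.\<close>
      obtain i0 where i0: "i0 \<in> at_atom \<tau>" "0 < w n i0" using elim(2) \<tau> by blast
      have in_cell: "t n i \<in> ?c \<tau>" if "i \<in> at_atom \<tau>" "0 < w n i" for i
      proof -
        have "i \<in> close" "T i = \<tau>" using that \<tau> by (auto simp: at_atom_def close_def)
        then have "own i \<tau>" using own \<tau> by simp
        then show ?thesis using that supp[of i n] by (auto simp: voronoi_cell_def own_def at_atom_def)
      qed
      obtain \<theta>1 where \<theta>1: "?c \<tau> = {\<theta>1}" using card by (auto simp: card_1_singleton_iff)
      have cell1: "?c \<tau> = {t n i0}" using in_cell[OF i0] \<theta>1 by auto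
      have zero: "w n i = 0" if "i \<in> at_atom \<tau>" "i \<noteq> i0" for i
      proof (rule ccontr)
        assume "w n i \<noteq> 0"
        then have "0 < w n i" using w[of n i] by linarith
        then have "t n i = t n i0" using in_cell that(1) cell1 by blast
        then show False using inj[of i i0 n] that i0 \<open>0 < w n i\<close> by (auto simp: at_atom_def)
      qed
      have sum1: "(\<Sum>i\<in>at_atom \<tau>. w n i * h i) = w n i0 * h i0" for h :: "nat \<Rightarrow> real"
        using fin(5)[of \<tau>] i0(1) zero by (subst sum.remove[of _ i0]) (auto intro!: sum.neutral)
      have far0: "(\<Sum>i\<in>far. w n i * (if own i \<tau> then edist d (t n i) \<tau> else 0)) \<le> 0"
      proof (rule sum_nonpos)
        fix i assume i: "i \<in> far"
        show "w n i * (if own i \<tau> then edist d (t n i) \<tau> else 0) \<le> 0"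
        proof (cases "0 < w n i \<and> own i \<tau>")
          case True
          then have "t n i \<in> ?c \<tau>" using supp[of i n] i by (auto simp: voronoi_cell_def own_def far_def)
          then have "t n i = t n i0" using cell1 by blast
          then have "i = i0" using inj[of i i0 n] True i i0 by (auto simp: far_def at_atom_def)
          then show ?thesis using i i0 \<tau> by (auto simp: far_def at_atom_def)
        next
          case False
          then show ?thesis using w[of n i] by (cases "own i \<tau>") auto
        qed
      qed
      have "w n i0 * edist d (t n i0) \<tau> \<le> w n i0 * (\<Sum>a<d. \<bar>t n i0 a - \<tau> a\<bar>)"
        using w by (intro mult_left_mono edist_le_sum_abs) auto
      also have "\<dots> = (\<Sum>a<d. \<bar>\<Sum>i\<in>at_atom \<tau>. w n i * (t n i a - \<tau> a)\<bar>)"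
        unfolding sum1 sum_distrib_left using w[of n i0] by (intro sum.cong) (auto simp: abs_mult)
      also have "\<dots> \<le> size4 n"
        unfolding size4_def using \<tau> fin
        by (intro member_le_sum[of \<tau> S0 "\<lambda>\<tau>. \<Sum>a<d. \<bar>\<Sum>i\<in>at_atom \<tau>. w n i * (t n i a - \<tau> a)\<bar>"]) (auto intro!: sum_nonneg)
      finally have "(\<Sum>\<theta>\<in>?c \<tau>. pmf (G n) \<theta> * edist d \<theta> \<tau>) \<le> size n"
        unfolding cell[OF \<tau>] sum1 using far0 size_ge(4)[of n] by linarith
      moreover have "0 \<le> R\<^sup>2 * size n" using size_ge(5)[of n] by simp
      ultimately show ?thesis by (simp add: distrib_right)
    qed
    have 3: "\<bar>(\<Sum>\<theta>\<in>?c \<tau>. pmf (G n) \<theta>) - pmf G0 \<tau>\<bar> \<le> (1 + R\<^sup>2) * size n" if \<tau>: "\<tau> \<in> S0" for \<tau>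
    proof -
      have eq: "(\<Sum>\<theta>\<in>?c \<tau>. pmf (G n) \<theta>) = (\<Sum>i\<in>far. w n i * (if own i \<tau> then 1 else 0)) + (\<Sum>i\<in>at_atom \<tau>. w n i)"
        using cell[OF \<tau>, of "\<lambda>_. 1"] by simp
      have "(\<Sum>i\<in>far. w n i * (if own i \<tau> then 1 else 0)) \<le> 1 * size1 n" by (rule far_le) auto
      moreover have "0 \<le> (\<Sum>i\<in>far. w n i * (if own i \<tau> then 1 else 0))" using w by (intro sum_nonneg) auto
      moreover have "\<bar>(\<Sum>i\<in>at_atom \<tau>. w n i) - pmf G0 \<tau>\<bar> \<le> size2 n"
        unfolding size2_def using \<tau> fin by (intro member_le_sum[of \<tau> S0 "\<lambda>\<tau>. \<bar>(\<Sum>i\<in>at_atom \<tau>. w n i) - pmf G0 \<tau>\<bar>"]) auto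
      ultimately have "\<bar>(\<Sum>\<theta>\<in>?c \<tau>. pmf (G n) \<theta>) - pmf G0 \<tau>\<bar> \<le> size1 n + size2 n" unfolding eq by linarith
      also have "\<dots> \<le> 1 * size n" using size_nonneg[of n] by (simp add: size_def)
      also have "\<dots> \<le> (1 + R\<^sup>2) * size n" using size_ge(5)[of n] by (intro mult_right_mono) auto
      finally show ?thesis .
    qed
    have "voronoi_loss d (G n) G0 \<le> ?K * ((1 + R\<^sup>2) * size n) + ?K * ((1 + R\<^sup>2) * size n) + ?K * ((1 + R\<^sup>2) * size n)"
      unfolding voronoi_loss_def by (intro add_mono outer) (auto intro: 1 2 3)
    also have "\<dots> = 3 * ?K * ((1 + R\<^sup>2) * size n)" by simp
    also have "\<dots> \<le> (3 * ?K + 1) * ((1 + R\<^sup>2) * size n)" using size_ge(5)[of n] by (intro mult_right_mono) auto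
    finally show ?case by (simp add: mult.assoc)
  qed
  moreover have "0 < (3 * ?K + 1) * (1 + R\<^sup>2)" using R2 by (intro mult_pos_pos) auto
  ultimately show ?thesis by blast
qed

end

section \<open>The normalised expansion and its limit\<close>

lemma near_eventually:
  assumes "near d \<tau> Q" "X \<longlonglongrightarrow> \<tau>" "\<And>n. X n \<in> topspace (Euclidean_space d)"
  shows "eventually (\<lambda>n. Q (X n)) sequentially"
proof -
  obtain \<rho> where \<rho>: "0 < \<rho>" "\<And>\<theta>. \<theta> \<in> topspace (Euclidean_space d) \<Longrightarrow> (\<forall>i<d. \<bar>\<theta> i - \<tau> i\<bar> < \<rho>) \<Longrightarrow> Q \<theta>"
    using assms(1) unfolding near_def by blast
  have "eventually (\<lambda>n. \<forall>i\<in>{..<d}. \<bar>X n i - \<tau> i\<bar> < \<rho>) sequentially"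
  proof (intro eventually_ball_finite ballI)
    fix i
    have "(\<lambda>n. X n i) \<longlonglongrightarrow> \<tau> i" by (rule tendsto_coordinate[OF assms(2)])
    then show "eventually (\<lambda>n. \<bar>X n i - \<tau> i\<bar> < \<rho>) sequentially"
      using \<rho>(1) by (simp add: tendsto_iff dist_real_def)
  qed simp
  then show ?thesis by eventually_elim (use \<rho>(2) assms(3) in auto)
qed

text \<open>Summing over \<open>a \<le> b\<close> counts each mixed derivative once, which is why
  only the diagonal terms keep the factor 1/2.\<close>

definition taylor2 :: "nat \<Rightarrow> (rvec \<Rightarrow> real) \<Rightarrow> rvec \<Rightarrow> rvec \<Rightarrow> real" where
  "taylor2 d g \<tau> \<theta> = g \<tau> + (\<Sum>a<d. (\<theta> a - \<tau> a) * partial_deriv a g \<tau>)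
    + (\<Sum>a<d. \<Sum>b=a..<d. (if a = b then 1 / 2 else 1) * ((\<theta> a - \<tau> a) * (\<theta> b - \<tau> b)) *
         partial_deriv b (partial_deriv a g) \<tau>)"

lemma near_taylor2:
  assumes "Cr_extension d 2 \<Theta> h g" "\<tau> \<in> \<Theta>" "0 < e"
  shows "near d \<tau> (\<lambda>\<theta>. \<bar>g \<theta> - taylor2 d g \<tau> \<theta>\<bar> \<le> e * (\<Sum>a<d. \<bar>\<theta> a - \<tau> a\<bar>)\<^sup>2)"
proof -
  obtain U where U: "openin (Euclidean_space d) U" "\<Theta> \<subseteq> U" "Cr_on d 2 U g"
    using assms(1) by (auto simp: Cr_extension_def)
  show ?thesis
  proof (rule near_mono[OF second_order_Taylor[OF U(1) _ U(3) assms(3)]])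
    show "\<tau> \<in> U" using assms(2) U(2) by blast
    fix \<theta>
    have "(\<Sum>a<d. (\<theta> a - \<tau> a)\<^sup>2 / 2 * partial_deriv a (partial_deriv a g) \<tau>
        + (\<Sum>b=Suc a..<d. (\<theta> a - \<tau> a) * (\<theta> b - \<tau> b) * partial_deriv b (partial_deriv a g) \<tau>))
      = (\<Sum>a<d. \<Sum>b=a..<d. (if a = b then 1 / 2 else 1) * ((\<theta> a - \<tau> a) * (\<theta> b - \<tau> b)) *
         partial_deriv b (partial_deriv a g) \<tau>)"
    proof (intro sum.cong refl)
      fix a assume "a \<in> {..<d}"
      then have "(\<Sum>b=a..<d. (if a = b then 1 / 2 else 1) * ((\<theta> a - \<tau> a) * (\<theta> b - \<tau> b)) * partial_deriv b (partial_deriv a g) \<tau>)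
        = 1 / 2 * ((\<theta> a - \<tau> a) * (\<theta> a - \<tau> a)) * partial_deriv a (partial_deriv a g) \<tau>
          + (\<Sum>b=Suc a..<d. (if a = b then 1 / 2 else 1) * ((\<theta> a - \<tau> a) * (\<theta> b - \<tau> b)) * partial_deriv b (partial_deriv a g) \<tau>)"
        by (subst sum.atLeast_Suc_lessThan) auto
      also have "(\<Sum>b=Suc a..<d. (if a = b then 1 / 2 else 1) * ((\<theta> a - \<tau> a) * (\<theta> b - \<tau> b)) * partial_deriv b (partial_deriv a g) \<tau>)
        = (\<Sum>b=Suc a..<d. (\<theta> a - \<tau> a) * (\<theta> b - \<tau> b) * partial_deriv b (partial_deriv a g) \<tau>)"
        by (intro sum.cong) auto
      finally show "(\<theta> a - \<tau> a)\<^sup>2 / 2 * partial_deriv a (partial_deriv a g) \<tau>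
        + (\<Sum>b=Suc a..<d. (\<theta> a - \<tau> a) * (\<theta> b - \<tau> b) * partial_deriv b (partial_deriv a g) \<tau>)
        = (\<Sum>b=a..<d. (if a = b then 1 / 2 else 1) * ((\<theta> a - \<tau> a) * (\<theta> b - \<tau> b)) * partial_deriv b (partial_deriv a g) \<tau>)"
        by (simp add: power2_eq_square)
    qed
    then have eq: "g \<theta> - taylor2 d g \<tau> \<theta> = g \<theta> - g \<tau> - (\<Sum>a<d. (\<theta> a - \<tau> a) * partial_deriv a g \<tau>)
      - (\<Sum>a<d. (\<theta> a - \<tau> a)\<^sup>2 / 2 * partial_deriv a (partial_deriv a g) \<tau>
        + (\<Sum>b=Suc a..<d. (\<theta> a - \<tau> a) * (\<theta> b - \<tau> b) * partial_deriv b (partial_deriv a g) \<tau>))"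
      by (simp add: taylor2_def)
    show "\<bar>g \<theta> - taylor2 d g \<tau> \<theta>\<bar> \<le> e * (\<Sum>a<d. \<bar>\<theta> a - \<tau> a\<bar>)\<^sup>2"
      if "\<bar>g \<theta> - g \<tau> - (\<Sum>a<d. (\<theta> a - \<tau> a) * partial_deriv a g \<tau>)
      - (\<Sum>a<d. (\<theta> a - \<tau> a)\<^sup>2 / 2 * partial_deriv a (partial_deriv a g) \<tau>
        + (\<Sum>b=Suc a..<d. (\<theta> a - \<tau> a) * (\<theta> b - \<tau> b) * partial_deriv b (partial_deriv a g) \<tau>))\<bar> \<le> e * (\<Sum>a<d. \<bar>\<theta> a - \<tau> a\<bar>)\<^sup>2"
      using that unfolding eq .
  qed
qed

text \<open>Names for all coefficients of the expansion, so that a single extraction makes all of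
  them converge.\<close>

datatype coef = Far nat | Mass rvec | Grad rvec nat | Hess rvec nat nat

context mixture_sequence
begin

primrec scaled :: "coef \<Rightarrow> nat \<Rightarrow> real" where
  "scaled (Far i) n = w n i / size n"
| "scaled (Mass \<tau>) n = ((\<Sum>i\<in>at_atom \<tau>. w n i) - pmf G0 \<tau>) / size n"
| "scaled (Grad \<tau> a) n = (\<Sum>i\<in>at_atom \<tau>. w n i * (t n i a - \<tau> a)) / size n"
| "scaled (Hess \<tau> a b) n = (\<Sum>i\<in>at_atom \<tau>. w n i * ((t n i a - \<tau> a) * (t n i b - \<tau> b))) / size n"

definition coefs where
  "coefs = Far ` far \<union> Mass ` S0 \<union> (\<lambda>(\<tau>, a). Grad \<tau> a) ` (S0 \<times> {..<d})
     \<union> (\<lambda>(\<tau>, a, b). Hess \<tau> a b) ` (S0 \<times> {..<d} \<times> {..<d})"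

lemma finite_coefs: "finite coefs"
  using fin by (simp add: coefs_def)

lemma coefs_intros:
  "i \<in> far \<Longrightarrow> Far i \<in> coefs" "\<tau> \<in> S0 \<Longrightarrow> Mass \<tau> \<in> coefs" "\<tau> \<in> S0 \<Longrightarrow> a < d \<Longrightarrow> Grad \<tau> a \<in> coefs"
  "\<tau> \<in> S0 \<Longrightarrow> a < d \<Longrightarrow> b < d \<Longrightarrow> Hess \<tau> a b \<in> coefs"
proof -
  show "Hess \<tau> a b \<in> coefs" if "\<tau> \<in> S0" "a < d" "b < d"
    unfolding coefs_def by (rule UnI2, rule image_eqI[of _ _ "(\<tau>, a, b)"]) (use that in auto)
qed (auto simp: coefs_def)

lemma ratio_bounded: "\<bar>x\<bar> \<le> size n \<Longrightarrow> x / size n \<in> {-1..1}"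
  using size_ge(5)[of n] by (cases "size n = 0") (auto simp: field_simps abs_le_iff)

lemma weighted_dist_le_size:
  assumes "\<tau> \<in> S0"
  shows "(\<Sum>i\<in>at_atom \<tau>. w n i * (dist_to n i)\<^sup>2) \<le> size n"
proof -
  have "(\<Sum>i\<in>at_atom \<tau>. w n i * (dist_to n i)\<^sup>2) \<le> size3 n"
    unfolding size3_def using w fin assms by (intro sum_mono2) (auto simp: at_atom_def close_def)
  then show ?thesis using size_ge(3)[of n] by simp
qed

text \<open>Every numerator is dominated by one summand of \<open>size\<close>; for second-order
  ones a product of two coordinate differences is at most the squared distance.\<close>

lemma scaled_bounded: "c \<in> coefs \<Longrightarrow> scaled c n \<in> {-1..1}"
proof -
  assume "c \<in> coefs"
  then consider (1) i where "c = Far i" "i \<in> far" | (2) \<tau> where "c = Mass \<tau>" "\<tau> \<in> S0"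
    | (3) \<tau> a where "c = Grad \<tau> a" "\<tau> \<in> S0" "a < d" | (4) \<tau> a b where "c = Hess \<tau> a b" "\<tau> \<in> S0" "a < d" "b < d"
    unfolding coefs_def by auto
  then show ?thesis
  proof cases
    case 1
    have "w n i \<le> size1 n" unfolding size1_def using 1 w fin by (intro member_le_sum) auto
    then have "\<bar>w n i\<bar> \<le> size n" using w[of n i] size_ge(1)[of n] by simp
    then show ?thesis unfolding 1 scaled.simps by (rule ratio_bounded)
  next
    case 2
    have "\<bar>(\<Sum>i\<in>at_atom \<tau>. w n i) - pmf G0 \<tau>\<bar> \<le> size2 n"
      unfolding size2_def using 2 fin by (intro member_le_sum[of \<tau> S0 "\<lambda>\<tau>. \<bar>(\<Sum>i\<in>at_atom \<tau>. w n i) - pmf G0 \<tau>\<bar>"]) auto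
    then show ?thesis unfolding 2 scaled.simps using size_ge(2)[of n] by (intro ratio_bounded) simp
  next
    case 3
    have "\<bar>\<Sum>i\<in>at_atom \<tau>. w n i * (t n i a - \<tau> a)\<bar> \<le> (\<Sum>a<d. \<bar>\<Sum>i\<in>at_atom \<tau>. w n i * (t n i a - \<tau> a)\<bar>)"
      using 3 by (intro member_le_sum[of a "{..<d}" "\<lambda>a. \<bar>\<Sum>i\<in>at_atom \<tau>. w n i * (t n i a - \<tau> a)\<bar>"]) auto
    also have "\<dots> \<le> size4 n" unfolding size4_def using 3 fin
      by (intro member_le_sum[of \<tau> S0 "\<lambda>\<tau>. \<Sum>a<d. \<bar>\<Sum>i\<in>at_atom \<tau>. w n i * (t n i a - \<tau> a)\<bar>"]) (auto intro!: sum_nonneg)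
    finally show ?thesis unfolding 3 scaled.simps using size_ge(4)[of n] by (intro ratio_bounded) simp
  next
    case 4
    have "\<bar>\<Sum>i\<in>at_atom \<tau>. w n i * ((t n i a - \<tau> a) * (t n i b - \<tau> b))\<bar>
      \<le> (\<Sum>i\<in>at_atom \<tau>. w n i * (dist_to n i)\<^sup>2)"
    proof (rule order_trans[OF sum_abs], rule sum_mono)
      fix i assume i: "i \<in> at_atom \<tau>"
      have "\<bar>t n i a - \<tau> a\<bar> * \<bar>t n i b - \<tau> b\<bar> \<le> dist_to n i * dist_to n i"
        unfolding dist_to_def using i 4 edist_nonneg
        by (intro mult_mono) (auto simp: at_atom_def abs_coordinate_le_edist)
      then show "\<bar>w n i * ((t n i a - \<tau> a) * (t n i b - \<tau> b))\<bar> \<le> w n i * (dist_to n i)\<^sup>2"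
        using w[of n i] by (simp add: abs_mult power2_eq_square mult_left_mono)
    qed
    then show ?thesis unfolding 4 scaled.simps using weighted_dist_le_size[OF 4(2), of n] by (intro ratio_bounded) simp
  qed
qed

text \<open>The normalisation that survives in the limit and prevents all coefficients from
  vanishing. The diagonal second-order coefficients represent \<open>size3\<close>, because a
  squared distance is a sum of squared coordinates.\<close>

lemma scaled_total:
  assumes "0 < size n"
  shows "(\<Sum>i\<in>far. scaled (Far i) n) + (\<Sum>\<tau>\<in>S0. \<bar>scaled (Mass \<tau>) n\<bar>)
    + (\<Sum>\<tau>\<in>S0. \<Sum>a<d. scaled (Hess \<tau> a a) n) + (\<Sum>\<tau>\<in>S0. \<Sum>a<d. \<bar>scaled (Grad \<tau> a) n\<bar>) = 1"
proof -
  have sq: "(dist_to n i)\<^sup>2 = (\<Sum>a<d. (t n i a - \<tau> a) * (t n i a - \<tau> a))" if "i \<in> at_atom \<tau>" for i \<tau>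
    using that unfolding dist_to_def edist_power2 by (simp add: at_atom_def power2_eq_square)
  have "size3 n = (\<Sum>\<tau>\<in>S0. \<Sum>i\<in>at_atom \<tau>. w n i * (dist_to n i)\<^sup>2)"
    unfolding size3_def sum_close ..
  also have "\<dots> = (\<Sum>\<tau>\<in>S0. \<Sum>i\<in>at_atom \<tau>. \<Sum>a<d. w n i * ((t n i a - \<tau> a) * (t n i a - \<tau> a)))"
    by (intro sum.cong refl) (simp add: sq sum_distrib_left)
  also have "\<dots> = (\<Sum>\<tau>\<in>S0. \<Sum>a<d. \<Sum>i\<in>at_atom \<tau>. w n i * ((t n i a - \<tau> a) * (t n i a - \<tau> a)))"
    by (intro sum.cong refl sum.swap)
  finally have 3: "size3 n / size n = (\<Sum>\<tau>\<in>S0. \<Sum>a<d. scaled (Hess \<tau> a a) n)"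
    by (simp add: sum_divide_distrib)
  have 1: "size1 n / size n = (\<Sum>i\<in>far. scaled (Far i) n)" by (simp add: size1_def sum_divide_distrib)
  have 2: "size2 n / size n = (\<Sum>\<tau>\<in>S0. \<bar>scaled (Mass \<tau>) n\<bar>)"
    using assms by (simp add: size2_def sum_divide_distrib)
  have 4: "size4 n / size n = (\<Sum>\<tau>\<in>S0. \<Sum>a<d. \<bar>scaled (Grad \<tau> a) n\<bar>)"
    by (simp only: size4_def sum_divide_distrib[of _ S0] sum_divide_distrib[of _ "{..<d}"] scaled.simps
        abs_divide abs_of_pos[OF assms])
  have "size1 n / size n + size2 n / size n + size3 n / size n + size4 n / size n = size n / size n"
    unfolding add_divide_distrib[symmetric] by (simp only: size_def)
  then show ?thesis unfolding 1 2 3 4 using assms by simp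
qed

text \<open>The Taylor error is a small multiple of the squared distance, and the weight times the
  squared distance is at most \<open>size n\<close>. Only convergence for a fixed \<open>x\<close>
  is claimed, which is enough for Fatou's lemma.\<close>

lemma remainder_tendsto:
  assumes ext: "Cr_extension d 2 \<Theta> h g" and i: "i \<in> at_atom \<tau>" "\<tau> \<in> S0"
  shows "(\<lambda>n. w n i / size n * (g (t n i) - taylor2 d g \<tau> (t n i))) \<longlonglongrightarrow> 0"
proof (rule tendstoI)
  fix e :: real assume e: "0 < e"
  define e' where "e' = e / ((real d)\<^sup>2 + 1)"
  have d1: "0 < (real d)\<^sup>2 + 1" by (simp add: add_nonneg_pos)
  have e': "0 < e'" using e d1 by (simp add: e'_def)
  have ik: "i < k" "T i = \<tau>" using i by (auto simp: at_atom_def)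
  have top: "t n i \<in> topspace (Euclidean_space d)" for n
    using t compactin_Euclidean_space(2)[OF comp] by blast
  have "eventually (\<lambda>n. \<bar>g (t n i) - taylor2 d g \<tau> (t n i)\<bar> \<le> e' * (\<Sum>a<d. \<bar>t n i a - \<tau> a\<bar>)\<^sup>2) sequentially"
    using near_eventually[OF near_taylor2[OF ext _ e', of \<tau>] _ top] t_lim[OF ik(1)] ik(2) fin(2) i(2) by auto
  then show "eventually (\<lambda>n. dist (w n i / size n * (g (t n i) - taylor2 d g \<tau> (t n i))) 0 < e) sequentially"
  proof eventually_elim
    case (elim n)
    have wn: "0 \<le> w n i / size n" using w size_ge(5) by simp
    have "\<bar>w n i / size n * (g (t n i) - taylor2 d g \<tau> (t n i))\<bar> \<le> w n i / size n * (e' * (\<Sum>a<d. \<bar>t n i a - \<tau> a\<bar>)\<^sup>2)"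
      using elim wn by (simp only: abs_mult abs_of_nonneg mult_left_mono)
    also have "\<dots> \<le> w n i / size n * (e' * (real d * dist_to n i)\<^sup>2)"
      using wn e' sum_abs_le_edist[where d = d and \<theta> = "t n i" and \<tau> = \<tau>] ik(2) unfolding dist_to_def
      by (intro mult_left_mono power_mono) (auto intro: sum_nonneg)
    also have "\<dots> = e' * (real d)\<^sup>2 * (w n i * (dist_to n i)\<^sup>2 / size n)"
      by (simp add: power_mult_distrib)
    also have "\<dots> \<le> e' * (real d)\<^sup>2 * 1"
    proof (rule mult_left_mono)
      have "w n i * (dist_to n i)\<^sup>2 \<le> (\<Sum>i\<in>at_atom \<tau>. w n i * (dist_to n i)\<^sup>2)"
        using i fin w by (intro member_le_sum) auto
      then have "w n i * (dist_to n i)\<^sup>2 \<le> size n" using weighted_dist_le_size[OF i(2), of n] by simp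
      then have "\<bar>w n i * (dist_to n i)\<^sup>2\<bar> \<le> size n" using w[of n i] by simp
      then show "w n i * (dist_to n i)\<^sup>2 / size n \<le> 1" using ratio_bounded by fastforce
    qed (use e' in auto)
    also have "\<dots> < e' * ((real d)\<^sup>2 + 1)" using e' by simp
    also have "\<dots> = e" using d1 by (simp add: e'_def)
    finally show ?case by simp
  qed
qed

text \<open>Slots of \<open>far\<close> are left unexpanded; those with limit \<open>\<tau>\<close>
  are expanded around \<open>\<tau>\<close> and grouped, which produces the aggregated
  coefficients.\<close>

lemma gap_expansion:
  assumes ext: "Cr_extension d 2 \<Theta> (f x) g"
  shows "gap n x / size n = (\<Sum>i\<in>far. scaled (Far i) n * g (t n i))
    + (\<Sum>\<tau>\<in>S0. scaled (Mass \<tau>) n * g \<tau> + (\<Sum>a<d. scaled (Grad \<tau> a) n * partial_deriv a g \<tau>)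
        + (\<Sum>a<d. \<Sum>b=a..<d. (if a = b then 1 / 2 else 1) * scaled (Hess \<tau> a b) n * partial_deriv b (partial_deriv a g) \<tau>))
    + (\<Sum>\<tau>\<in>S0. \<Sum>i\<in>at_atom \<tau>. w n i / size n * (g (t n i) - taylor2 d g \<tau> (t n i)))"
proof -
  have gf: "f x \<theta> = g \<theta>" if "\<theta> \<in> \<Theta>" for \<theta> using ext that by (simp add: Cr_extension_def)
  have "gap n x = (\<Sum>i<k. w n i * g (t n i)) - (\<Sum>\<tau>\<in>S0. pmf G0 \<tau> * g \<tau>)"
    unfolding gap_def mixture_G mixture_G0 using gf t fin(2) by (simp add: subset_iff)
  also have "\<dots> = (\<Sum>i\<in>far. w n i * g (t n i)) + (\<Sum>\<tau>\<in>S0. (\<Sum>i\<in>at_atom \<tau>. w n i * g (t n i)) - pmf G0 \<tau> * g \<tau>)"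
    unfolding sum_split sum_close[symmetric] sum_subtractf by simp
  finally have 1: "gap n x / size n = (\<Sum>i\<in>far. scaled (Far i) n * g (t n i))
      + (\<Sum>\<tau>\<in>S0. ((\<Sum>i\<in>at_atom \<tau>. w n i * g (t n i)) - pmf G0 \<tau> * g \<tau>) / size n)"
    by (simp add: add_divide_distrib sum_divide_distrib)
  have 2: "((\<Sum>i\<in>at_atom \<tau>. w n i * g (t n i)) - pmf G0 \<tau> * g \<tau>) / size n
    = scaled (Mass \<tau>) n * g \<tau> + (\<Sum>a<d. scaled (Grad \<tau> a) n * partial_deriv a g \<tau>)
        + (\<Sum>a<d. \<Sum>b=a..<d. (if a = b then 1 / 2 else 1) * scaled (Hess \<tau> a b) n * partial_deriv b (partial_deriv a g) \<tau>)
      + (\<Sum>i\<in>at_atom \<tau>. w n i / size n * (g (t n i) - taylor2 d g \<tau> (t n i)))" for \<tau>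
  proof -
    have grad: "(\<Sum>i\<in>at_atom \<tau>. w n i * (\<Sum>a<d. (t n i a - \<tau> a) * partial_deriv a g \<tau>))
      = (\<Sum>a<d. (\<Sum>i\<in>at_atom \<tau>. w n i * (t n i a - \<tau> a)) * partial_deriv a g \<tau>)"
    proof -
      have "(\<Sum>i\<in>at_atom \<tau>. w n i * (\<Sum>a<d. (t n i a - \<tau> a) * partial_deriv a g \<tau>))
        = (\<Sum>i\<in>at_atom \<tau>. \<Sum>a<d. w n i * (t n i a - \<tau> a) * partial_deriv a g \<tau>)"
        by (simp add: sum_distrib_left mult.assoc)
      also have "\<dots> = (\<Sum>a<d. \<Sum>i\<in>at_atom \<tau>. w n i * (t n i a - \<tau> a) * partial_deriv a g \<tau>)" by (rule sum.swap)
      finally show ?thesis by (simp add: sum_distrib_right)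
    qed
    have hess: "(\<Sum>i\<in>at_atom \<tau>. w n i * (\<Sum>a<d. \<Sum>b=a..<d. (if a = b then 1 / 2 else 1) * ((t n i a - \<tau> a) * (t n i b - \<tau> b)) * partial_deriv b (partial_deriv a g) \<tau>))
      = (\<Sum>a<d. \<Sum>b=a..<d. (if a = b then 1 / 2 else 1) * (\<Sum>i\<in>at_atom \<tau>. w n i * ((t n i a - \<tau> a) * (t n i b - \<tau> b))) * partial_deriv b (partial_deriv a g) \<tau>)"
    proof -
      let ?q = "\<lambda>i a b. (if a = b then 1 / 2 else 1) * (w n i * ((t n i a - \<tau> a) * (t n i b - \<tau> b))) * partial_deriv b (partial_deriv a g) \<tau>"
      have "(\<Sum>i\<in>at_atom \<tau>. w n i * (\<Sum>a<d. \<Sum>b=a..<d. (if a = b then 1 / 2 else 1) * ((t n i a - \<tau> a) * (t n i b - \<tau> b)) * partial_deriv b (partial_deriv a g) \<tau>))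
        = (\<Sum>i\<in>at_atom \<tau>. \<Sum>a<d. \<Sum>b=a..<d. ?q i a b)"
        unfolding sum_distrib_left by (intro sum.cong refl) simp
      also have "\<dots> = (\<Sum>a<d. \<Sum>i\<in>at_atom \<tau>. \<Sum>b=a..<d. ?q i a b)" by (rule sum.swap)
      also have "\<dots> = (\<Sum>a<d. \<Sum>b=a..<d. \<Sum>i\<in>at_atom \<tau>. ?q i a b)" by (intro sum.cong refl sum.swap)
      finally show ?thesis unfolding sum_distrib_left sum_distrib_right .
    qed
    define Gr where "Gr = (\<Sum>a<d. (\<Sum>i\<in>at_atom \<tau>. w n i * (t n i a - \<tau> a)) * partial_deriv a g \<tau>)"
    define He where "He = (\<Sum>a<d. \<Sum>b=a..<d. (if a = b then 1 / 2 else 1) * (\<Sum>i\<in>at_atom \<tau>. w n i * ((t n i a - \<tau> a) * (t n i b - \<tau> b))) * partial_deriv b (partial_deriv a g) \<tau>)"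
    define Re where "Re = (\<Sum>i\<in>at_atom \<tau>. w n i * (g (t n i) - taylor2 d g \<tau> (t n i)))"
    have "(\<Sum>i\<in>at_atom \<tau>. w n i * taylor2 d g \<tau> (t n i)) = (\<Sum>i\<in>at_atom \<tau>. w n i) * g \<tau> + Gr + He"
      unfolding taylor2_def distrib_left sum.distrib grad hess Gr_def He_def by (simp add: sum_distrib_right)
    then have "(\<Sum>i\<in>at_atom \<tau>. w n i * g (t n i)) - pmf G0 \<tau> * g \<tau>
      = ((\<Sum>i\<in>at_atom \<tau>. w n i) - pmf G0 \<tau>) * g \<tau> + Gr + He + Re"
      unfolding Re_def right_diff_distrib sum_subtractf by (simp add: algebra_simps)
    then have "((\<Sum>i\<in>at_atom \<tau>. w n i * g (t n i)) - pmf G0 \<tau> * g \<tau>) / size n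
      = ((\<Sum>i\<in>at_atom \<tau>. w n i) - pmf G0 \<tau>) / size n * g \<tau> + Gr / size n + He / size n + Re / size n"
      by (simp add: add_divide_distrib)
    moreover have "Gr / size n = (\<Sum>a<d. scaled (Grad \<tau> a) n * partial_deriv a g \<tau>)"
      unfolding Gr_def sum_divide_distrib[of _ "{..<d}"] scaled.simps by (intro sum.cong) auto
    moreover have "He / size n = (\<Sum>a<d. \<Sum>b=a..<d. (if a = b then 1 / 2 else 1) * scaled (Hess \<tau> a b) n * partial_deriv b (partial_deriv a g) \<tau>)"
    proof -
      have "He / size n = (\<Sum>a<d. \<Sum>b=a..<d. (if a = b then 1 / 2 else 1) * (\<Sum>i\<in>at_atom \<tau>. w n i * ((t n i a - \<tau> a) * (t n i b - \<tau> b))) * partial_deriv b (partial_deriv a g) \<tau> / size n)"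
        unfolding He_def by (simp only: sum_divide_distrib[of _ "{..<d}"] sum_divide_distrib[of _ "{_..<d}"])
      then show ?thesis unfolding scaled.simps by (simp only: times_divide_eq_left times_divide_eq_right)
    qed
    moreover have "Re / size n = (\<Sum>i\<in>at_atom \<tau>. w n i / size n * (g (t n i) - taylor2 d g \<tau> (t n i)))"
      unfolding Re_def sum_divide_distrib by (intro sum.cong) auto
    ultimately show ?thesis by simp
  qed
  show ?thesis unfolding 1 2 sum.distrib by simp
qed

text \<open>The limit of the normalised gap vanishes almost everywhere by Fatou's lemma, because
  \<open>V n / size n\<close> tends to 0; identifiability then annihilates all coefficients counted
  by \<open>scaled_total\<close>, whose total is 1.\<close>

lemma contradiction: False
proof -
  obtain F where ext: "AE x in \<nu>. Cr_extension d 2 \<Theta> (f x) (F x)"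
    and id: "\<And>S A B C \<theta>. finite S \<Longrightarrow> S \<subseteq> \<Theta> \<Longrightarrow>
      (AE x in \<nu>. (\<Sum>\<theta>\<in>S. A \<theta> * F x \<theta> + (\<Sum>a<d. B \<theta> a * partial_deriv a (F x) \<theta>)
         + (\<Sum>a<d. \<Sum>b=a..<d. C \<theta> a b * partial_deriv b (partial_deriv a (F x)) \<theta>)) = 0) \<Longrightarrow>
      \<theta> \<in> S \<Longrightarrow> A \<theta> = 0 \<and> (\<forall>a<d. B \<theta> a = 0 \<and> C \<theta> a a = 0)"
    using strongly_identifiable_order2[OF si] by blast
  have "compact {-1..1::real}" by simp
  from finite_convergent_subsequence[OF finite_coefs this, of "\<lambda>n c. scaled c n"] scaled_bounded
  obtain r L where r: "strict_mono (r :: nat \<Rightarrow> nat)"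
    and L: "\<And>c. c \<in> coefs \<Longrightarrow> (\<lambda>n. scaled c (r n)) \<longlonglongrightarrow> L c" by blast
  obtain C where C: "0 < C" "eventually (\<lambda>n. voronoi_loss d (G n) G0 \<le> C * size n) sequentially"
    using loss_le_size by blast
  have size_pos: "eventually (\<lambda>n. 0 < size n \<and> V n / size n \<le> C / (real n + 1)) sequentially"
    using C(2)
  proof eventually_elim
    case (elim n)
    have "0 < C * size n" using V_small(3)[of n] elim by linarith
    then have s: "0 < size n" using C(1) by (simp add: zero_less_mult_iff)
    moreover have "(real n + 1) * V n \<le> C * size n" using V_small(2)[of n] elim by linarith
    ultimately show ?case by (simp add: field_simps)
  qed
  have lim0: "(\<lambda>n. V n / size n) \<longlonglongrightarrow> 0"
  proof (rule tendsto_sandwich)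
    show "eventually (\<lambda>n. 0 \<le> V n / size n) sequentially" using V_small(1) size_ge(5) by (intro always_eventually) simp
    show "eventually (\<lambda>n. V n / size n \<le> C / (real n + 1)) sequentially" using size_pos by eventually_elim simp
    show "(\<lambda>n. C / (real n + 1)) \<longlonglongrightarrow> 0"
      using LIMSEQ_Suc[OF lim_const_over_n[of C]] by (simp add: add.commute)
  qed simp
  have tot: "(\<Sum>i\<in>far. L (Far i)) + (\<Sum>\<tau>\<in>S0. \<bar>L (Mass \<tau>)\<bar>)
    + (\<Sum>\<tau>\<in>S0. \<Sum>a<d. L (Hess \<tau> a a)) + (\<Sum>\<tau>\<in>S0. \<Sum>a<d. \<bar>L (Grad \<tau> a)\<bar>) = 1"
  proof (rule LIMSEQ_unique)
    let ?X = "\<lambda>n. (\<Sum>i\<in>far. scaled (Far i) n) + (\<Sum>\<tau>\<in>S0. \<bar>scaled (Mass \<tau>) n\<bar>)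
      + (\<Sum>\<tau>\<in>S0. \<Sum>a<d. scaled (Hess \<tau> a a) n) + (\<Sum>\<tau>\<in>S0. \<Sum>a<d. \<bar>scaled (Grad \<tau> a) n\<bar>)"
    show "(\<lambda>n. ?X (r n)) \<longlonglongrightarrow> (\<Sum>i\<in>far. L (Far i)) + (\<Sum>\<tau>\<in>S0. \<bar>L (Mass \<tau>)\<bar>)
    + (\<Sum>\<tau>\<in>S0. \<Sum>a<d. L (Hess \<tau> a a)) + (\<Sum>\<tau>\<in>S0. \<Sum>a<d. \<bar>L (Grad \<tau> a)\<bar>)"
      by (intro tendsto_add tendsto_sum tendsto_rabs L coefs_intros) auto
    have "eventually (\<lambda>n. ?X n = 1) sequentially"
      using size_pos by eventually_elim (rule scaled_total, simp)
    then have "eventually (\<lambda>n. ?X (r n) = 1) sequentially" using r by (rule eventually_subseq[rotated])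
    then show "(\<lambda>n. ?X (r n)) \<longlonglongrightarrow> 1" by (rule tendsto_eventually)
  qed
  define H where "H = (\<lambda>x. (\<Sum>i\<in>far. L (Far i) * F x (T i))
    + (\<Sum>\<tau>\<in>S0. L (Mass \<tau>) * F x \<tau> + (\<Sum>a<d. L (Grad \<tau> a) * partial_deriv a (F x) \<tau>)
        + (\<Sum>a<d. \<Sum>b=a..<d. (if a = b then 1 / 2 else 1) * L (Hess \<tau> a b) * partial_deriv b (partial_deriv a (F x)) \<tau>)))"
  have lim: "AE x in \<nu>. (\<lambda>n. gap (r n) x / size (r n)) \<longlonglongrightarrow> H x"
    using ext
  proof eventually_elim
    case (elim x)
    have cont: "continuous_on \<Theta> (f x)" by (rule Cr_extension_continuous[OF elim])
    have gf: "f x \<theta> = F x \<theta>" if "\<theta> \<in> \<Theta>" for \<theta> using elim that by (simp add: Cr_extension_def)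
    have t_r: "(\<lambda>n. F x (t (r n) i)) \<longlonglongrightarrow> F x (T i)" if "i < k" for i
    proof -
      have "(\<lambda>n. f x (t n i)) \<longlonglongrightarrow> f x (T i)"
        using continuous_on_tendsto_compose[OF cont t_lim[OF that] T[OF that]] t by simp
      then have "(\<lambda>n. F x (t n i)) \<longlonglongrightarrow> F x (T i)" using gf t T[OF that] by simp
      from LIMSEQ_subseq_LIMSEQ[OF this r] show ?thesis by (simp add: o_def)
    qed
    have rem: "(\<lambda>n. w (r n) i / size (r n) * (F x (t (r n) i) - taylor2 d (F x) \<tau> (t (r n) i))) \<longlonglongrightarrow> 0"
      if "i \<in> at_atom \<tau>" "\<tau> \<in> S0" for i \<tau>
      using LIMSEQ_subseq_LIMSEQ[OF remainder_tendsto[OF elim that] r] by (simp add: o_def)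
    have "(\<lambda>n. \<Sum>\<tau>\<in>S0. \<Sum>i\<in>at_atom \<tau>. w (r n) i / size (r n) * (F x (t (r n) i) - taylor2 d (F x) \<tau> (t (r n) i)))
      \<longlonglongrightarrow> (\<Sum>\<tau>\<in>S0. \<Sum>i\<in>at_atom \<tau>. 0)"
      by (intro tendsto_sum rem)
    then have rem0: "(\<lambda>n. \<Sum>\<tau>\<in>S0. \<Sum>i\<in>at_atom \<tau>. w (r n) i / size (r n) * (F x (t (r n) i) - taylor2 d (F x) \<tau> (t (r n) i)))
      \<longlonglongrightarrow> 0" by simp
    have "(\<lambda>n. gap (r n) x / size (r n)) \<longlonglongrightarrow> H x + 0"
      unfolding gap_expansion[OF elim] H_def
      by (intro tendsto_add rem0 tendsto_sum tendsto_mult tendsto_const L t_r coefs_intros) (auto simp: far_def)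
    then show ?case by simp
  qed
  have "AE x in \<nu>. H x = 0"
  proof (rule AE_zero_of_limit[OF _ lim])
    show "(\<lambda>x. gap (r n) x / size (r n)) \<in> borel_measurable \<nu>" for n
      using gap_measurable by (intro borel_measurable_divide) auto
    show "(\<integral>\<^sup>+x. ennreal \<bar>gap (r n) x / size (r n)\<bar> \<partial>\<nu>) \<le> ennreal (V (r n) / size (r n))" for n
    proof -
      have "(\<integral>\<^sup>+x. ennreal \<bar>gap (r n) x / size (r n)\<bar> \<partial>\<nu>) = (\<integral>\<^sup>+x. ennreal (1 / size (r n)) * ennreal \<bar>gap (r n) x\<bar> \<partial>\<nu>)"
        using size_ge(5)[of "r n"] by (intro nn_integral_cong) (simp add: ennreal_mult[symmetric])
      also have "\<dots> = ennreal (1 / size (r n)) * ennreal (V (r n))"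
        using gap_measurable[of "r n"] by (subst nn_integral_cmult) (auto simp: V_eq)
      also have "\<dots> = ennreal (V (r n) / size (r n))"
        using size_ge(5)[of "r n"] V_small(1) by (simp add: ennreal_mult[symmetric])
      finally show ?thesis by simp
    qed
    show "(\<lambda>n. V (r n) / size (r n)) \<longlonglongrightarrow> 0"
      using LIMSEQ_subseq_LIMSEQ[OF lim0 r] by (simp add: o_def)
  qed
  define S where "S = S0 \<union> T ` far"
  have S: "finite S" "S \<subseteq> \<Theta>" using fin T by (auto simp: S_def far_def)
  \<comment> \<open>Several slots of \<open>far\<close> may have the same limit, so their
    coefficients are collected at each point of \<open>S\<close> before identifiability is
    applied.\<close>
  define A where "A = (\<lambda>\<theta>. (\<Sum>i\<in>{i \<in> far. T i = \<theta>}. L (Far i)) + (if \<theta> \<in> S0 then L (Mass \<theta>) else 0))"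
  define B where "B = (\<lambda>\<theta> a. if \<theta> \<in> S0 then L (Grad \<theta> a) else 0)"
  define Q where "Q = (\<lambda>\<theta> a b. if \<theta> \<in> S0 then (if a = b then 1 / 2 else 1) * L (Hess \<theta> a b) else 0)"
  have HS: "H x = (\<Sum>\<theta>\<in>S. A \<theta> * F x \<theta> + (\<Sum>a<d. B \<theta> a * partial_deriv a (F x) \<theta>)
         + (\<Sum>a<d. \<Sum>b=a..<d. Q \<theta> a b * partial_deriv b (partial_deriv a (F x)) \<theta>))" for x
  proof -
    define P where "P = (\<lambda>\<theta>. L (Mass \<theta>) * F x \<theta> + (\<Sum>a<d. L (Grad \<theta> a) * partial_deriv a (F x) \<theta>)
        + (\<Sum>a<d. \<Sum>b=a..<d. (if a = b then 1 / 2 else 1) * L (Hess \<theta> a b) * partial_deriv b (partial_deriv a (F x)) \<theta>))"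
    have "(\<Sum>\<theta>\<in>S. A \<theta> * F x \<theta> + (\<Sum>a<d. B \<theta> a * partial_deriv a (F x) \<theta>)
         + (\<Sum>a<d. \<Sum>b=a..<d. Q \<theta> a b * partial_deriv b (partial_deriv a (F x)) \<theta>))
      = (\<Sum>\<theta>\<in>S. (\<Sum>i\<in>{i \<in> far. T i = \<theta>}. L (Far i) * F x (T i)) + (if \<theta> \<in> S0 then P \<theta> else 0))"
      by (intro sum.cong refl) (simp add: A_def B_def Q_def P_def distrib_right sum_distrib_right)
    also have "\<dots> = (\<Sum>\<theta>\<in>S. \<Sum>i\<in>{i \<in> far. T i = \<theta>}. L (Far i) * F x (T i)) + (\<Sum>\<theta>\<in>S. if \<theta> \<in> S0 then P \<theta> else 0)"
      by (rule sum.distrib)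
    also have "(\<Sum>\<theta>\<in>S. \<Sum>i\<in>{i \<in> far. T i = \<theta>}. L (Far i) * F x (T i)) = (\<Sum>i\<in>far. L (Far i) * F x (T i))"
      using S fin by (intro sum.group) (auto simp: S_def)
    also have "(\<Sum>\<theta>\<in>S. if \<theta> \<in> S0 then P \<theta> else 0) = (\<Sum>\<theta>\<in>S0. P \<theta>)"
      using S by (intro sum.mono_neutral_cong_right) (auto simp: S_def)
    finally show ?thesis by (simp add: H_def P_def)
  qed
  have "AE x in \<nu>. (\<Sum>\<theta>\<in>S. A \<theta> * F x \<theta> + (\<Sum>a<d. B \<theta> a * partial_deriv a (F x) \<theta>)
         + (\<Sum>a<d. \<Sum>b=a..<d. Q \<theta> a b * partial_deriv b (partial_deriv a (F x)) \<theta>)) = 0"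
    using \<open>AE x in \<nu>. H x = 0\<close> unfolding HS .
  note zero = id[OF S this]
  \<comment> \<open>Identifiability kills only the collected sum; the summands vanish because they
    are limits of nonnegative weights.\<close>
  have far0: "L (Far i) = 0" if i: "i \<in> far" for i
  proof -
    have nn: "0 \<le> L (Far j)" if "j \<in> far" for j
      using L[OF coefs_intros(1)[OF that]] w size_ge(5) by (intro LIMSEQ_le_const) auto
    have "T i \<in> S" "T i \<notin> S0" using i by (auto simp: S_def far_def)
    then have "(\<Sum>j\<in>{j \<in> far. T j = T i}. L (Far j)) = 0" using zero[of "T i"] by (simp add: A_def)
    then have "\<forall>j\<in>{j \<in> far. T j = T i}. L (Far j) = 0"
      using fin nn by (subst (asm) sum_nonneg_eq_0_iff) auto
    then show ?thesis using i by blast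
  qed
  have atom0: "L (Mass \<tau>) = 0 \<and> (\<forall>a<d. L (Grad \<tau> a) = 0 \<and> L (Hess \<tau> a a) = 0)" if \<tau>: "\<tau> \<in> S0" for \<tau>
  proof -
    have e: "(\<Sum>i\<in>{i \<in> far. T i = \<tau>}. L (Far i)) = 0"
      by (rule sum.neutral) (use \<tau> in \<open>auto simp: far_def\<close>)
    have "\<tau> \<in> S" using \<tau> by (simp add: S_def)
    then show ?thesis using zero[of \<tau>] \<tau> unfolding A_def B_def Q_def e by simp
  qed
  show False using tot far0 atom0 by simp
qed

end

text \<open>By contradiction, with the constants \<open>n + 1\<close>: padded representatives are
  extracted twice, first for the atoms in \<open>\<Theta>\<close>, then for the weights in
  \<open>[0, 1]\<close>. Passing to a subsequence preserves the violated bound because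
  \<open>n \<le> r (s n)\<close>.\<close>

lemma voronoi_loss_le_L1:
  assumes dens: "density_family N \<nu> \<Theta> f" and comp: "compactin (Euclidean_space d) \<Theta>"
    and si: "strongly_identifiable d 2 \<nu> \<Theta> f" and G0: "G0 \<in> mixing_le \<Theta> k"
  shows "\<exists>C>0. \<forall>G\<in>mixing_le \<Theta> k.
    voronoi_loss d G G0 \<le> C * (\<integral>x. \<bar>mixture f G x - mixture f G0 x\<bar> \<partial>\<nu>)"
proof (rule ccontr)
  assume neg: "\<not> ?thesis"
  have "\<forall>n. \<exists>G. G \<in> mixing_le \<Theta> k \<and> (real n + 1) * (\<integral>x. \<bar>mixture f G x - mixture f G0 x\<bar> \<partial>\<nu>) < voronoi_loss d G G0"
  proof
    fix n :: nat
    have "\<not> (\<forall>G\<in>mixing_le \<Theta> k. voronoi_loss d G G0 \<le> (real n + 1) * (\<integral>x. \<bar>mixture f G x - mixture f G0 x\<bar> \<partial>\<nu>))"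
      using neg by (auto dest!: spec[of _ "real n + 1"])
    then show "\<exists>G. G \<in> mixing_le \<Theta> k \<and> (real n + 1) * (\<integral>x. \<bar>mixture f G x - mixture f G0 x\<bar> \<partial>\<nu>) < voronoi_loss d G G0"
      by (auto simp: not_le)
  qed
  from choice[OF this] obtain G where G: "\<And>n. G n \<in> mixing_le \<Theta> k"
    "\<And>n. (real n + 1) * (\<integral>x. \<bar>mixture f (G n) x - mixture f G0 x\<bar> \<partial>\<nu>) < voronoi_loss d (G n) G0" by blast
  define Rep where "Rep = (\<lambda>n t w. (\<forall>i. t i \<in> \<Theta>) \<and> (\<forall>i. 0 \<le> w i \<and> w i \<le> (1::real)) \<and>
    (\<forall>h :: rvec \<Rightarrow> real. (\<Sum>\<theta>\<in>set_pmf (G n). pmf (G n) \<theta> * h \<theta>) = (\<Sum>i<k. w i * h (t i))) \<and>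
    (\<forall>i<k. 0 < w i \<longrightarrow> t i \<in> set_pmf (G n)) \<and>
    (\<forall>i<k. \<forall>j<k. 0 < w i \<longrightarrow> 0 < w j \<longrightarrow> t i = t j \<longrightarrow> i = j))"
  have "\<forall>n. \<exists>tw. Rep n (fst tw) (snd tw)"
  proof
    fix n
    show "\<exists>tw. Rep n (fst tw) (snd tw)"
    proof (rule mixing_representation[OF G(1)[of n]])
      fix t w
      assume "\<And>i. t i \<in> \<Theta>" "\<And>i. 0 \<le> w i \<and> w i \<le> (1::real)"
        "\<And>h :: rvec \<Rightarrow> real. (\<Sum>\<theta>\<in>set_pmf (G n). pmf (G n) \<theta> * h \<theta>) = (\<Sum>i<k. w i * h (t i))"
        "\<And>i. i < k \<Longrightarrow> 0 < w i \<Longrightarrow> t i \<in> set_pmf (G n)"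
        "\<And>i j. i < k \<Longrightarrow> j < k \<Longrightarrow> 0 < w i \<Longrightarrow> 0 < w j \<Longrightarrow> t i = t j \<Longrightarrow> i = j"
      then have "Rep n t w" unfolding Rep_def by blast
      then show ?thesis by (intro exI[of _ "(t, w)"]) simp
    qed
  qed
  from choice[OF this] obtain tw where tw: "\<And>n. Rep n (fst (tw n)) (snd (tw n))" by blast
  define t where "t = (\<lambda>n. fst (tw n))"
  define w where "w = (\<lambda>n. snd (tw n))"
  have rep: "Rep n (t n) (w n)" for n using tw by (simp add: t_def w_def)
  have "\<exists>r L. strict_mono (r :: nat \<Rightarrow> nat) \<and> (\<forall>i\<in>{..<k}. L i \<in> \<Theta> \<and> (\<lambda>n. t (r n) i) \<longlonglongrightarrow> L i)"
    using rep by (intro finite_convergent_subsequence compactin_Euclidean_space(1)[OF comp]) (auto simp: Rep_def)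
  then obtain r T where r: "strict_mono (r :: nat \<Rightarrow> nat)" "\<And>i. i < k \<Longrightarrow> T i \<in> \<Theta> \<and> (\<lambda>n. t (r n) i) \<longlonglongrightarrow> T i" by auto
  have "\<exists>s L. strict_mono (s :: nat \<Rightarrow> nat) \<and> (\<forall>i\<in>{..<k}. L i \<in> {0..1} \<and> (\<lambda>n. w (r (s n)) i) \<longlonglongrightarrow> L i)"
    using rep by (intro finite_convergent_subsequence[of "{..<k}" "{0..1::real}" "\<lambda>n. w (r n)"]) (auto simp: Rep_def)
  then obtain s W where s: "strict_mono (s :: nat \<Rightarrow> nat)" "\<And>i. i < k \<Longrightarrow> (\<lambda>n. w (r (s n)) i) \<longlonglongrightarrow> W i" by auto
  interpret mixture_sequence d N \<nu> \<Theta> f k G0 "\<lambda>n. G (r (s n))" "\<lambda>n. t (r (s n))" "\<lambda>n. w (r (s n))" T W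
  proof
    fix n i j and h :: "rvec \<Rightarrow> real"
    have R: "Rep (r (s n)) (t (r (s n))) (w (r (s n)))" by (rule rep)
    show "t (r (s n)) i \<in> \<Theta>" "0 \<le> w (r (s n)) i \<and> w (r (s n)) i \<le> 1"
      "(\<Sum>\<theta>\<in>set_pmf (G (r (s n))). pmf (G (r (s n))) \<theta> * h \<theta>) = (\<Sum>i<k. w (r (s n)) i * h (t (r (s n)) i))"
      "i < k \<Longrightarrow> 0 < w (r (s n)) i \<Longrightarrow> t (r (s n)) i \<in> set_pmf (G (r (s n)))"
      "i < k \<Longrightarrow> j < k \<Longrightarrow> 0 < w (r (s n)) i \<Longrightarrow> 0 < w (r (s n)) j \<Longrightarrow> t (r (s n)) i = t (r (s n)) j \<Longrightarrow> i = j"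
      using R unfolding Rep_def by blast+
    show "T i \<in> \<Theta>" if "i < k" using r(2)[OF that] by blast
    show "(\<lambda>n. t (r (s n)) i) \<longlonglongrightarrow> T i" if "i < k"
      using LIMSEQ_subseq_LIMSEQ[OF _ s(1)] r(2)[OF that] by (auto simp: o_def)
    have "n \<le> r (s n)" using seq_suble[OF r(1)] seq_suble[OF s(1)] order_trans by blast
    then have "(real n + 1) * (\<integral>x. \<bar>mixture f (G (r (s n))) x - mixture f G0 x\<bar> \<partial>\<nu>)
      \<le> (real (r (s n)) + 1) * (\<integral>x. \<bar>mixture f (G (r (s n))) x - mixture f G0 x\<bar> \<partial>\<nu>)"
      by (intro mult_right_mono) auto
    also have "\<dots> < voronoi_loss d (G (r (s n))) G0" by (rule G(2))
    finally show "(real n + 1) * (\<integral>x. \<bar>mixture f (G (r (s n))) x - mixture f G0 x\<bar> \<partial>\<nu>) < voronoi_loss d (G (r (s n))) G0" .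
  qed (use dens comp si G0 G(1) s(2) in auto)
  show False by (rule contradiction)
qed

section \<open>Conclusion\<close>

context density_class
begin

text \<open>The difference \<open>q - p\<close> is twice the difference of the squares of
  \<open>rbar p q\<close> and \<open>sqrt p\<close>. Factoring it and applying Cauchy-Schwarz to two
  functions of norm 1 gives the constant \<open>2 * 2\<close>.\<close>

lemma L1_le_radius2:
  assumes p: "p \<in> P" and q: "q \<in> P"
  shows "(\<integral>x. \<bar>q x - p x\<bar> \<partial>\<nu>) \<le> 4 * sqrt (radius2 p q)"
proof -
  have sq: "square_integrable \<nu> (rbar p q)" using sqrt_bar[OF q p] unfolding rbar_def .
  note sp = sqrt_dens[OF p]
  have one: "L2_norm \<nu> (rbar p q) = 1" "L2_norm \<nu> (\<lambda>x. sqrt (p x)) = 1"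
  proof -
    have "(\<integral>x. (rbar p q x)\<^sup>2 \<partial>\<nu>) = (\<integral>x. (q x + p x) / 2 \<partial>\<nu>)"
      using dens_nonneg p q by (intro Bochner_Integration.integral_cong) (auto simp: rbar_def)
    also have "\<dots> = 1" using integrable_dens integral_dens p q by simp
    finally show "L2_norm \<nu> (rbar p q) = 1" by (simp add: L2_norm_def)
    have "(\<integral>x. (sqrt (p x))\<^sup>2 \<partial>\<nu>) = (\<integral>x. p x \<partial>\<nu>)"
      using dens_nonneg p by (intro Bochner_Integration.integral_cong) auto
    then show "L2_norm \<nu> (\<lambda>x. sqrt (p x)) = 1" by (simp add: L2_norm_def integral_dens[OF p])
  qed
  let ?g = "\<lambda>x. \<bar>rbar p q x - sqrt (p x)\<bar>" and ?h = "\<lambda>x. rbar p q x + sqrt (p x)"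
  have "square_integrable \<nu> (\<lambda>x. rbar p q x - sqrt (p x))" by (rule square_integrable_diff[OF sq sp])
  then have g: "square_integrable \<nu> ?g" by (auto simp: square_integrable_def intro: borel_measurable_abs)
  have h: "square_integrable \<nu> ?h" by (rule square_integrable_add[OF sq sp])
  have "(\<integral>x. \<bar>q x - p x\<bar> \<partial>\<nu>) = (\<integral>x. 2 * (?g x * ?h x) \<partial>\<nu>)"
  proof (rule Bochner_Integration.integral_cong[OF refl])
    fix x assume x: "x \<in> space \<nu>"
    have nn: "0 \<le> rbar p q x" "0 \<le> q x" "0 \<le> p x" using x dens_nonneg p q by (auto simp: rbar_def)
    have "(rbar p q x - sqrt (p x)) * ?h x = (rbar p q x)\<^sup>2 - (sqrt (p x))\<^sup>2"
      by (simp add: power2_eq_square algebra_simps)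
    also have "\<dots> = (q x - p x) / 2" using nn by (simp add: rbar_def field_simps)
    finally have "\<bar>q x - p x\<bar> = 2 * \<bar>(rbar p q x - sqrt (p x)) * ?h x\<bar>" by simp
    then show "\<bar>q x - p x\<bar> = 2 * (?g x * ?h x)" using nn by (simp add: abs_mult)
  qed
  also have "\<dots> \<le> 2 * (L2_norm \<nu> ?g * L2_norm \<nu> ?h)"
    using L2_Cauchy_Schwarz[OF g h] by simp
  also have "\<dots> \<le> 2 * (L2_norm \<nu> ?g * 2)"
    using L2_norm_triangle[OF sq sp] one by (intro mult_left_mono) (auto simp: L2_norm_nonneg)
  also have "L2_norm \<nu> ?g = sqrt (radius2 p q)" by (simp add: L2_norm_def radius2_def)
  finally show ?thesis by simp
qed

text \<open>Concavity of the logarithm: the barred log ratio is at least a quarter of the ordinary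
  one, so a maximiser of the likelihood also beats the truth after averaging.\<close>

lemma log_ratio_nonneg:
  assumes pos: "\<And>i. i < n \<Longrightarrow> 0 < p (xs i)" "\<And>i. i < n \<Longrightarrow> 0 < q (xs i)"
    and le: "(\<Sum>i<n. ln (p (xs i))) \<le> (\<Sum>i<n. ln (q (xs i)))"
  shows "0 \<le> log_ratio p n q xs"
proof -
  have "0 \<le> (\<Sum>i<n. (ln (q (xs i)) - ln (p (xs i))) / 4)"
    using le by (simp add: sum_subtractf sum_divide_distrib[symmetric])
  also have "\<dots> \<le> log_ratio p n q xs"
    unfolding log_ratio_def
  proof (rule sum_mono)
    fix i assume "i \<in> {..<n}"
    then have i: "0 < p (xs i)" "0 < q (xs i)" using pos by auto
    let ?p = "p (xs i)" and ?q = "q (xs i)"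
    have "sqrt (?q * ?p) \<le> (?q + ?p) / 2" using i by (intro arith_geo_mean_sqrt) auto
    then have "ln (sqrt (?q * ?p)) \<le> ln ((?q + ?p) / 2)" using i by (intro ln_mono) auto
    then have "(ln ?q + ln ?p) / 2 \<le> ln ((?q + ?p) / 2)" using i by (simp add: ln_sqrt ln_mult)
    moreover have "ln (rbar p q (xs i) / sqrt ?p) = ln ((?q + ?p) / 2) / 2 - ln ?p / 2"
      unfolding rbar_def using i by (simp add: ln_div ln_sqrt)
    ultimately show "(ln ?q - ln ?p) / 4 \<le> ln (rbar p q (xs i) / sqrt ?p)" by (simp add: field_simps)
  qed
  finally show ?thesis .
qed

end

section \<open>From the estimator to its expected loss\<close>

lemma sum_elog:
  "finite I \<Longrightarrow> (\<Sum>i\<in>I. elog (h i)) = (if \<forall>i\<in>I. 0 < h i then ereal (\<Sum>i\<in>I. ln (h i)) else -\<infinity>)"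
  by (induction I rule: finite_induct) (auto simp: elog_def)

text \<open>Since \<open>G0\<close> is a competitor with finite log-likelihood, the maximiser cannot
  have value \<open>-\<infinity>\<close>; this makes its density positive at the data and permits
  ordinary logarithms.\<close>

lemma MLE_log_likelihood:
  assumes mle: "is_MLE \<Theta> k f n xs G" and G0: "G0 \<in> mixing_le \<Theta> k"
    and pos: "\<And>i. i < n \<Longrightarrow> 0 < mixture f G0 (xs i)"
  shows "G \<in> mixing_le \<Theta> k" "\<And>i. i < n \<Longrightarrow> 0 < mixture f G (xs i)"
    "(\<Sum>i<n. ln (mixture f G0 (xs i))) \<le> (\<Sum>i<n. ln (mixture f G (xs i)))"
proof -
  show "G \<in> mixing_le \<Theta> k" using mle by (simp add: is_MLE_def is_arg_max_def)
  have "log_likelihood f n xs G0 \<le> log_likelihood f n xs G"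
    using mle G0 by (auto simp: is_MLE_def is_arg_max_def not_less)
  then have le: "ereal (\<Sum>i<n. ln (mixture f G0 (xs i)))
      \<le> (if \<forall>i\<in>{..<n}. 0 < mixture f G (xs i) then ereal (\<Sum>i<n. ln (mixture f G (xs i))) else -\<infinity>)"
    unfolding log_likelihood_def using pos by (simp add: sum_elog)
  then show "0 < mixture f G (xs i)" if "i < n" for i using that by (auto split: if_splits)
  then show "(\<Sum>i<n. ln (mixture f G0 (xs i))) \<le> (\<Sum>i<n. ln (mixture f G (xs i)))"
    using le by (simp split: if_splits)
qed

theorem MLE_voronoi_rate:
  assumes dens: "density_family N \<nu> \<Theta> f" and comp: "compactin (Euclidean_space d) \<Theta>"
    and G0: "G0 \<in> mixing_le \<Theta> k" and si: "strongly_identifiable d 2 \<nu> \<Theta> f"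
    and B: "condition_B k J \<nu> \<Theta> f" "0 < J"
  shows "\<exists>C>0. \<forall>n\<ge>2. \<forall>Ghat.
    (AE xs in sample_law \<nu> f G0 n. is_MLE \<Theta> k f n xs (Ghat xs)) \<longrightarrow>
    (\<integral>\<^sup>+xs. ennreal (voronoi_loss d (Ghat xs) G0) \<partial>sample_law \<nu> f G0 n)
      \<le> ennreal (C * sqrt (ln (real n) / real n))"
proof -
  obtain A where "density_class \<nu> (mixture f ` mixing_le \<Theta> k) A"
    using mixtures_density_class[OF dens si B] by blast
  then interpret D: density_class \<nu> "mixture f ` mixing_le \<Theta> k" A .
  define p0 where "p0 = mixture f G0"
  have p0: "p0 \<in> mixture f ` mixing_le \<Theta> k" using G0 by (simp add: p0_def)
  have law: "sample_law \<nu> f G0 n = D.sample p0 n" for n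
    by (simp add: sample_law_def D.sample_def D.law_def p0_def)
  obtain C1 where C1: "0 < C1" and rate: "\<forall>n\<ge>2. \<exists>E\<in>sets (D.sample p0 n). measure (D.sample p0 n) E \<le> 2 / real n \<and>
    (AE xs in D.sample p0 n. xs \<notin> E \<longrightarrow>
      (\<forall>q\<in>mixture f ` mixing_le \<Theta> k. 0 \<le> D.log_ratio p0 n q xs \<longrightarrow> D.radius2 p0 q \<le> C1 * (ln (real n) / real n)))"
    using D.likelihood_rate[OF p0] by (elim exE conjE) (rule that)
  obtain C2 where C2: "0 < C2" and inv: "\<forall>G\<in>mixing_le \<Theta> k.
    voronoi_loss d G G0 \<le> C2 * (\<integral>x. \<bar>mixture f G x - mixture f G0 x\<bar> \<partial>\<nu>)"
    using voronoi_loss_le_L1[OF dens comp si G0] by (elim exE conjE) (rule that)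
  obtain Dm where Dm: "0 \<le> Dm" "\<And>G. G \<in> mixing_le \<Theta> k \<Longrightarrow> voronoi_loss d G G0 \<le> Dm"
    using voronoi_loss_bounded[OF comp mixing_leD(1)[OF G0]] by blast
  \<comment> \<open>The first summand covers the good event. On the exceptional event the loss is at
    most \<open>Dm\<close>, and its probability \<open>2 / n\<close> is at most four times the
    rate.\<close>
  define C where "C = 4 * C2 * sqrt C1 + 4 * Dm"
  have C: "0 < C" using C1 C2 Dm(1) by (simp add: C_def add_pos_nonneg)
  show ?thesis
  proof (intro exI[of _ C] conjI C allI impI)
    fix n :: nat and Ghat :: "(nat \<Rightarrow> rvec) \<Rightarrow> rvec pmf"
    assume n: "2 \<le> n" and mle: "AE xs in sample_law \<nu> f G0 n. is_MLE \<Theta> k f n xs (Ghat xs)"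
    define s where "s = sqrt (ln (real n) / real n)"
    interpret S: prob_space "D.sample p0 n" by (rule D.prob_space_sample[OF p0])
    obtain E where E: "E \<in> sets (D.sample p0 n)" "S.prob E \<le> 2 / real n"
      "AE xs in D.sample p0 n. xs \<notin> E \<longrightarrow>
        (\<forall>q\<in>mixture f ` mixing_le \<Theta> k. 0 \<le> D.log_ratio p0 n q xs \<longrightarrow> D.radius2 p0 q \<le> C1 * (ln (real n) / real n))"
      using rate[rule_format, OF n] by (elim bexE conjE) (rule that)
    have pos: "AE xs in D.sample p0 n. \<forall>i<n. True \<and> 0 < p0 (xs i)" by (rule D.AE_sample[OF p0]) simp
    \<comment> \<open>The majorant is measurable and compared almost everywhere, so the expectation
      is bounded for any choice \<open>Ghat\<close> of maximisers.\<close>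
    have "AE xs in D.sample p0 n. ennreal (voronoi_loss d (Ghat xs) G0)
        \<le> ennreal (4 * C2 * sqrt C1 * s) + ennreal Dm * indicator E xs"
      using mle[unfolded law] E(3) pos
    proof eventually_elim
      case (elim xs)
      have mle': "Ghat xs \<in> mixing_le \<Theta> k" "\<And>i. i < n \<Longrightarrow> 0 < mixture f (Ghat xs) (xs i)"
        "(\<Sum>i<n. ln (p0 (xs i))) \<le> (\<Sum>i<n. ln (mixture f (Ghat xs) (xs i)))"
        using MLE_log_likelihood[OF elim(1) G0] elim(3) by (auto simp: p0_def)
      show ?case
      proof (cases "xs \<in> E")
        case True
        have "ennreal (voronoi_loss d (Ghat xs) G0) \<le> ennreal Dm" by (intro ennreal_leI Dm(2) mle'(1))
        then show ?thesis using True by (simp add: add_increasing)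
      next
        case False
        let ?q = "mixture f (Ghat xs)"
        have q: "?q \<in> mixture f ` mixing_le \<Theta> k" using mle'(1) by blast
        have "0 \<le> D.log_ratio p0 n ?q xs"
          by (rule D.log_ratio_nonneg) (use elim(3) mle' in auto)
        then have "D.radius2 p0 ?q \<le> C1 * (ln (real n) / real n)" using elim(2) False q by blast
        then have "sqrt (D.radius2 p0 ?q) \<le> sqrt (C1 * (ln (real n) / real n))" by (rule real_sqrt_le_mono)
        then have r: "sqrt (D.radius2 p0 ?q) \<le> sqrt C1 * s" by (simp only: real_sqrt_mult s_def)
        have "voronoi_loss d (Ghat xs) G0 \<le> C2 * (\<integral>x. \<bar>?q x - p0 x\<bar> \<partial>\<nu>)"
          using inv mle'(1) by (simp add: p0_def)
        also have "\<dots> \<le> C2 * (4 * (sqrt C1 * s))"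
          using D.L1_le_radius2[OF p0 q] r C2 by (intro mult_left_mono) auto
        finally have "ennreal (voronoi_loss d (Ghat xs) G0) \<le> ennreal (4 * C2 * sqrt C1 * s)"
          by (intro ennreal_leI) (simp add: mult_ac)
        then show ?thesis using False by simp
      qed
    qed
    then have "(\<integral>\<^sup>+xs. ennreal (voronoi_loss d (Ghat xs) G0) \<partial>D.sample p0 n)
      \<le> (\<integral>\<^sup>+xs. ennreal (4 * C2 * sqrt C1 * s) + ennreal Dm * indicator E xs \<partial>D.sample p0 n)"
      by (rule nn_integral_mono_AE)
    also have "\<dots> = ennreal (4 * C2 * sqrt C1 * s) + ennreal Dm * emeasure (D.sample p0 n) E"
      using E(1) by (subst nn_integral_add) (auto simp: nn_integral_cmult_indicator S.emeasure_space_1)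
    also have "\<dots> = ennreal (4 * C2 * sqrt C1 * s + Dm * S.prob E)"
    proof -
      have "0 \<le> s" using n by (simp add: s_def)
      then show ?thesis using C1 C2 Dm(1)
        by (simp add: S.emeasure_eq_measure ennreal_mult[symmetric] ennreal_plus[symmetric] del: ennreal_plus)
    qed
    also have "\<dots> \<le> ennreal (C * s)"
    proof (rule ennreal_leI)
      have "1 / 2 \<le> ln (2::real)" using ln_le_minus_one[of "1 / 2"] by (simp add: ln_div)
      also have "\<dots> \<le> ln (real n)" using n by (intro ln_mono) auto
      finally have l: "1 / 2 \<le> ln (real n)" .
      have "1 / (2 * real n) \<le> s"
        unfolding s_def
      proof (rule real_le_rsqrt)
        have "(1 / (2 * real n))\<^sup>2 = 1 / (4 * real n) / real n" by (simp add: power2_eq_square)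
        also have "\<dots> \<le> ln (real n) / real n"
        proof (rule divide_right_mono)
          have "1 / (4 * real n) \<le> 1 / 2" using n by (simp add: field_simps)
          then show "1 / (4 * real n) \<le> ln (real n)" using l by linarith
        qed simp
        finally show "(1 / (2 * real n))\<^sup>2 \<le> ln (real n) / real n" .
      qed
      then have "2 / real n \<le> 4 * s" using n by (simp add: field_simps)
      then have "S.prob E \<le> 4 * s" using E(2) by linarith
      then have "Dm * S.prob E \<le> Dm * (4 * s)" using Dm(1) by (intro mult_left_mono)
      then show "4 * C2 * sqrt C1 * s + Dm * S.prob E \<le> C * s" by (simp add: C_def algebra_simps)
    qed
    finally show "(\<integral>\<^sup>+xs. ennreal (voronoi_loss d (Ghat xs) G0) \<partial>sample_law \<nu> f G0 n)
      \<le> ennreal (C * sqrt (ln (real n) / real n))" unfolding law s_def .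
  qed
qed

theorem theorem2:
  shows "\<exists>J::real. J > 0 \<and>
    (\<forall>(d::nat) (N::nat) (\<nu>::rvec measure) (\<Theta>::rvec set) (f::rvec \<Rightarrow> rvec \<Rightarrow> real)
      (k::nat) (k0::nat) (G0::rvec pmf).
      d \<ge> 1 \<longrightarrow> N \<ge> 1 \<longrightarrow> density_family N \<nu> \<Theta> f \<longrightarrow>
      compactin (Euclidean_space d) \<Theta> \<longrightarrow> Euclidean_space d interior_of \<Theta> \<noteq> {} \<longrightarrow>
      1 \<le> k0 \<longrightarrow> k0 \<le> k \<longrightarrow> G0 \<in> mixing_eq \<Theta> k0 \<longrightarrow>
      strongly_identifiable d 2 \<nu> \<Theta> f \<longrightarrow>
      condition_A d 2 \<nu> \<Theta> f \<longrightarrow>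
      condition_B k J \<nu> \<Theta> f \<longrightarrow>
      (\<exists>C::real. C > 0 \<and>
        (\<forall>n\<ge>2. \<forall>Ghat :: (nat \<Rightarrow> rvec) \<Rightarrow> rvec pmf.
          (AE xs in sample_law \<nu> f G0 n. is_MLE \<Theta> k f n xs (Ghat xs)) \<longrightarrow>
          (\<lambda>xs. voronoi_loss d (Ghat xs) G0) \<in> borel_measurable (sample_law \<nu> f G0 n) \<longrightarrow>
          (\<integral>\<^sup>+xs. ennreal (voronoi_loss d (Ghat xs) G0) \<partial>sample_law \<nu> f G0 n)
            \<le> ennreal (C * sqrt (ln (real n) / real n)))))"
proof (rule exI[of _ 1], intro conjI allI impI)
  fix d N :: nat and \<nu> :: "rvec measure" and \<Theta> :: "rvec set" and f :: "rvec \<Rightarrow> rvec \<Rightarrow> real"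
    and k k0 :: nat and G0 :: "rvec pmf"
  assume dens: "density_family N \<nu> \<Theta> f" and comp: "compactin (Euclidean_space d) \<Theta>"
    and k: "k0 \<le> k" and G0: "G0 \<in> mixing_eq \<Theta> k0" and si: "strongly_identifiable d 2 \<nu> \<Theta> f"
    and B: "condition_B k 1 \<nu> \<Theta> f"
  have "G0 \<in> mixing_le \<Theta> k" using G0 k by (auto simp: mixing_eq_def mixing_le_def)
  \<comment> \<open>The rate holds for every positive \<open>J\<close>, with a constant depending on
    it, so the numerical constant is simply taken to be 1.\<close>
  from MLE_voronoi_rate[OF dens comp this si B zero_less_one]
  show "\<exists>C>0. \<forall>n\<ge>2. \<forall>Ghat.
      (AE xs in sample_law \<nu> f G0 n. is_MLE \<Theta> k f n xs (Ghat xs)) \<longrightarrow>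
      (\<lambda>xs. voronoi_loss d (Ghat xs) G0) \<in> borel_measurable (sample_law \<nu> f G0 n) \<longrightarrow>
      (\<integral>\<^sup>+xs. ennreal (voronoi_loss d (Ghat xs) G0) \<partial>sample_law \<nu> f G0 n)
        \<le> ennreal (C * sqrt (ln (real n) / real n))"
    by (elim ex_forward conj_forward) blast+
qed simp

end
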